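(* Let $\mathfrak g\subset\mathfrak t$ be a subspace, let $\chi\in\mathfrak g^*$, and let $\alpha\in V(\mathfrak g-\chi(\mathfrak g))$. Then the Goldie rank of the primitive quotient $B^\chi/J(\alpha)$ equals the number of connected components (in the Zariski topology) of the Zariski closure $\overline{\langle\alpha\rangle}_{B^\chi}\subset\mathfrak t^*$.
   Context: Let $k$ be an algebraically closed field of characteristic $0$ and let $n=r+s$ with $r,s\in\mathbb Z_{\ge0}$. The Weyl algebra $\mathcal A=\mathcal A_{r,s}$ is the $k$-algebra generated by $x_1,\dots,x_r,x_{r+1}^{\pm1},\dots,x_n^{\pm1},\partial_1,\dots,\partial_n$ with relations $[x_i,x_j]=0$, $[\partial_i,\partial_j]=0$, $[\partial_i,x_j]=\delta_{ij}$ and $x_ix_i^{-1}=1$ for $i>r$. Put $\pi_i=x_i\partial_i$ and $\mathfrak t=\mathrm{span}_k\{\pi_1,\dots,\pi_n\}\subset\mathcal A$. For a subspace $\mathfrak g\subset\mathfrak t$ and $\chi\in\mathfrak g^*$ put $\mathcal A^{\mathfrak g}=\{a\in\mathcal A: [t,a]=0\ \forall t\in\mathfrak g\}$ and $B^\chi=\mathcal A^{\mathfrak g}/(\mathfrak g-\chi(\mathfrak g))$, where $(\mathfrak g-\chi(\mathfrak g))$ is the two-sided ideal of $\mathcal A^{\mathfrak g}$ generated by all $t-\chi(t)$, $t\in\mathfrak g$. Let $V(\mathfrak g-\chi(\mathfrak g))=\{\gamma\in\mathfrak t^*:\gamma|_{\mathfrak g}=\chi\}$. For $\alpha\in\mathfrak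 t^*=\mathrm{Spec}(\mathrm{Sym}(\mathfrak t))$ (closed points) let $\mathfrak m_\alpha\subset \mathrm{Sym}(\mathfrak t)$ be the corresponding maximal ideal, acting on $B^\chi$-modules through $\mathrm{Sym}(\mathfrak t)=k[\pi_1,\dots,\pi_n]\subset\mathcal A^{\mathfrak g}\to B^\chi$. For $\alpha\in V(\mathfrak g-\chi(\mathfrak g))$ the left module $B^\chi/B^\chi\mathfrak m_\alpha$ is $\mathfrak t^*$-graded with degree-$\gamma$ part $\{m:\mathfrak m_\gamma m=0\}$ and has a unique simple quotient, denoted $L(\alpha)$, which inherits the $\mathfrak t^*$-grading. Let $\langle\alpha\rangle_{B^\chi}=\{\beta\in\mathfrak t^*: L(\alpha)_{(\beta)}\ne0\}$ be its support, $\overline{\langle\alpha\rangle}_{B^\chi}$ the Zariski closure in $\mathfrak t^*$, and $J(\alpha)=\mathrm{Ann}_{B^\chi}(L(\alpha))$, a primitive ideal. The Goldie rank of a prime noetherian ring $R$ is the maximal $m$ such that $R$ contains a direct sum $I_1\oplus\dots\oplus I_m$ of nonzero left ideals. The ring $B^\chi/J(\alpha)$ is prime and noetherian. *)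

theory Defs
  imports
    "HOL-Library.Poly_Mapping"
    "HOL-Library.Extended_Nat"
    "HOL-Computational_Algebra.Polynomial"
    "HOL-Algebra.Embedded_Algebras"
    "HOL-Algebra.QuotRing"
    "HOL-Algebra.Generated_Rings"
    "HOL-Analysis.Abstract_Topology_2"
begin

text \<open>
  Free associative algebras are monoid algebras of free monoids: with words as a
  \<^class>\<open>monoid_add\<close> (addition is concatenation), multiplication on finitely supported
  functions on words is the convolution product of \<^theory>\<open>HOL-Library.Poly_Mapping\<close>.
\<close>

datatype 'a free_word = Free_Word (letters: "'a list")

instantiation free_word :: (type) monoid_add
begin
definition zero_free_word :: "'a free_word" where "0 = Free_Word []"
definition plus_free_word :: "'a free_word \<Rightarrow> 'a free_word \<Rightarrow> 'a free_word"
  where "u + v = Free_Word (letters u @ letters v)"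
instance by standard (simp_all add: zero_free_word_def plus_free_word_def)
end


section \<open>The Weyl algebra\<close>

text \<open>
  Indices are shifted to start at \<open>0\<close>: \<open>x\<^sub>i\<close> and \<open>\<partial>\<^sub>i\<close> exist for \<open>i < r + s\<close>, and \<open>x\<^sub>i\<close> is
  invertible for \<open>r \<le> i < r + s\<close>.
\<close>

datatype weyl_gen = Gen_X nat | Gen_Xinv nat | Gen_D nat

definition weyl_gens :: "nat \<Rightarrow> nat \<Rightarrow> weyl_gen set"
  where "weyl_gens r s = Gen_X ` {..<r + s} \<union> Gen_Xinv ` {r..<r + s} \<union> Gen_D ` {..<r + s}"

type_synonym 'k free_alg = "weyl_gen free_word \<Rightarrow>\<^sub>0 'k"

definition free_gen :: "weyl_gen \<Rightarrow> 'k::field free_alg"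
  where "free_gen a = Poly_Mapping.single (Free_Word [a]) 1"

abbreviation "free_x i \<equiv> free_gen (Gen_X i)"
abbreviation "free_xinv i \<equiv> free_gen (Gen_Xinv i)"
abbreviation "free_d i \<equiv> free_gen (Gen_D i)"

definition free_ring :: "nat \<Rightarrow> nat \<Rightarrow> 'k::field free_alg ring"
  where "free_ring r s =
    \<lparr>carrier = {p. \<forall>w \<in> Poly_Mapping.keys p. set (letters w) \<subseteq> weyl_gens r s},
     monoid.mult = (*), monoid.one = 1, ring.zero = 0, ring.add = (+)\<rparr>"

text \<open>
  \<open>x\<^sub>i\<close> and its inverse generator are made two-sided inverses of each other; the commutation
  relations of the inverse generators with the remaining generators then follow.
\<close>

definition weyl_relations :: "nat \<Rightarrow> nat \<Rightarrow> 'k::field free_alg set"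
  where "weyl_relations r s =
    {free_x i * free_x j - free_x j * free_x i |i j. i < r + s \<and> j < r + s} \<union>
    {free_d i * free_d j - free_d j * free_d i |i j. i < r + s \<and> j < r + s} \<union>
    {free_d i * free_x j - free_x j * free_d i - (if i = j then 1 else 0) |i j. i < r + s \<and> j < r + s} \<union>
    {free_x i * free_xinv i - 1 |i. r \<le> i \<and> i < r + s} \<union>
    {free_xinv i * free_x i - 1 |i. r \<le> i \<and> i < r + s}"

definition weyl_ideal :: "nat \<Rightarrow> nat \<Rightarrow> 'k::field free_alg set"
  where "weyl_ideal r s = genideal (free_ring r s) (weyl_relations r s)"

type_synonym 'k weyl = "'k free_alg set"

definition weyl :: "nat \<Rightarrow> nat \<Rightarrow> 'k::field weyl ring"
  where "weyl r s = free_ring r s Quot weyl_ideal r s"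

definition weyl_class :: "nat \<Rightarrow> nat \<Rightarrow> 'k::field free_alg \<Rightarrow> 'k weyl"
  where "weyl_class r s p = weyl_ideal r s +>\<^bsub>free_ring r s\<^esub> p"

text \<open>The structure map of the \<open>k\<close>-algebra; scalar multiplication by \<open>c\<close> is multiplication
  by \<open>scal r s c\<close>.\<close>

definition scal :: "nat \<Rightarrow> nat \<Rightarrow> 'k::field \<Rightarrow> 'k weyl"
  where "scal r s c = weyl_class r s (Poly_Mapping.single 0 c)"

definition weyl_pi :: "nat \<Rightarrow> nat \<Rightarrow> nat \<Rightarrow> 'k::field weyl"
  where "weyl_pi r s i = weyl_class r s (free_x i * free_d i)"

definition tt :: "nat \<Rightarrow> nat \<Rightarrow> 'k::field weyl set"
  where "tt r s = ring.Span (weyl r s) (range (scal r s)) (map (weyl_pi r s) [0..<r + s])"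

text \<open>Despite its name, the library's \<^locale>\<open>subalgebra\<close> only asks for an additive subgroup
  closed under multiplication by scalars.\<close>

definition subspace_of_tt :: "nat \<Rightarrow> nat \<Rightarrow> 'k::field weyl set \<Rightarrow> bool"
  where "subspace_of_tt r s g \<longleftrightarrow> g \<subseteq> tt r s \<and> subalgebra (range (scal r s)) g (weyl r s)"

text \<open>Linear forms on a subspace of the Weyl algebra, made canonical outside it by
  extensionality.\<close>

definition dual :: "nat \<Rightarrow> nat \<Rightarrow> 'k::field weyl set \<Rightarrow> ('k weyl \<Rightarrow> 'k) set"
  where "dual r s V =
    {f \<in> extensional V.
       (\<forall>a\<in>V. \<forall>b\<in>V. f (a \<oplus>\<^bsub>weyl r s\<^esub> b) = f a + f b) \<and>
       (\<forall>c. \<forall>a\<in>V. f (scal r s c \<otimes>\<^bsub>weyl r s\<^esub> a) = c * f a)}"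

definition V_shift :: "nat \<Rightarrow> nat \<Rightarrow> 'k::field weyl set \<Rightarrow> ('k weyl \<Rightarrow> 'k) \<Rightarrow> ('k weyl \<Rightarrow> 'k) set"
  where "V_shift r s g chi = {\<gamma> \<in> dual r s (tt r s). restrict \<gamma> g = chi}"


section \<open>The symmetric algebra of \<open>tt\<close> and the Zariski topology\<close>

text \<open>\<open>Sym(tt)\<close> is taken as the polynomial subalgebra \<open>k[\<pi>\<^sub>1, \<dots>, \<pi>\<^sub>n]\<close> of the Weyl algebra.\<close>

definition sym_ring :: "nat \<Rightarrow> nat \<Rightarrow> 'k::field weyl ring"
  where "sym_ring r s =
    (weyl r s)\<lparr>carrier := generate_ring (weyl r s) (range (scal r s) \<union> tt r s)\<rparr>"

definition max_ideal :: "nat \<Rightarrow> nat \<Rightarrow> ('k::field weyl \<Rightarrow> 'k) \<Rightarrow> 'k weyl set"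
  where "max_ideal r s \<gamma> =
    genideal (sym_ring r s) {t \<ominus>\<^bsub>weyl r s\<^esub> scal r s (\<gamma> t) |t. t \<in> tt r s}"

text \<open>A function \<open>f\<close> in \<open>Sym(tt)\<close> vanishes at \<open>\<gamma>\<close> iff it lies in the maximal ideal of \<open>\<gamma>\<close>, so
  the sets below are the basic open sets \<open>D(f)\<close>.\<close>

definition zariski :: "nat \<Rightarrow> nat \<Rightarrow> ('k::field weyl \<Rightarrow> 'k) topology"
  where "zariski r s = topology_generated_by
    {{\<gamma> \<in> dual r s (tt r s). f \<notin> max_ideal r s \<gamma>} |f. f \<in> carrier (sym_ring r s)}"


section \<open>Left modules over a noncommutative ring\<close>

text \<open>The record \<^type>\<open>module\<close> and the locale \<^locale>\<open>submodule\<close> do not require a commutative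
  base ring (unlike the locale \<^locale>\<open>module\<close>). The multiplicative fields of the record are
  irrelevant.\<close>

definition regular_module :: "('a, 'c) ring_scheme \<Rightarrow> ('a, 'a) module"
  where "regular_module R =
    \<lparr>carrier = carrier R, monoid.mult = monoid.mult R, monoid.one = monoid.one R,
     ring.zero = ring.zero R, ring.add = ring.add R, module.smult = monoid.mult R\<rparr>"

definition quotient_module :: "('a, 'b) module \<Rightarrow> 'b set \<Rightarrow> ('a, 'b set) module"
  where "quotient_module M N =
    \<lparr>carrier = a_rcosets\<^bsub>M\<^esub> N, monoid.mult = undefined, monoid.one = undefined, ring.zero = N,
     ring.add = set_add M, module.smult = (\<lambda>a X. \<Union>x\<in>X. N +>\<^bsub>M\<^esub> (a \<odot>\<^bsub>M\<^esub> x))\<rparr>"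

definition simple_module :: "('a, 'c) ring_scheme \<Rightarrow> ('a, 'b) module \<Rightarrow> bool"
  where "simple_module R M \<longleftrightarrow>
    carrier M \<noteq> {\<zero>\<^bsub>M\<^esub>} \<and> (\<forall>N. submodule N R M \<longrightarrow> N = {\<zero>\<^bsub>M\<^esub>} \<or> N = carrier M)"

definition simple_quotient_kernel :: "('a, 'c) ring_scheme \<Rightarrow> ('a, 'b) module \<Rightarrow> 'b set"
  where "simple_quotient_kernel R M =
    (THE N. submodule N R M \<and> simple_module R (quotient_module M N))"

definition annihilator :: "('a, 'c) ring_scheme \<Rightarrow> ('a, 'b) module \<Rightarrow> 'a set"
  where "annihilator R M = {a \<in> carrier R. \<forall>x \<in> carrier M. a \<odot>\<^bsub>M\<^esub> x = \<zero>\<^bsub>M\<^esub>}"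

definition left_ideal :: "'a set \<Rightarrow> ('a, 'c) ring_scheme \<Rightarrow> bool"
  where "left_ideal I R \<longleftrightarrow> submodule I R (regular_module R)"

definition gen_left_ideal :: "('a, 'c) ring_scheme \<Rightarrow> 'a set \<Rightarrow> 'a set"
  where "gen_left_ideal R S = \<Inter>{I. left_ideal I R \<and> S \<subseteq> I}"

definition direct_left_ideals :: "('a, 'c) ring_scheme \<Rightarrow> nat \<Rightarrow> (nat \<Rightarrow> 'a set) \<Rightarrow> bool"
  where "direct_left_ideals R m I \<longleftrightarrow>
    (\<forall>i<m. left_ideal (I i) R \<and> I i \<noteq> {\<zero>\<^bsub>R\<^esub>}) \<and>
    (\<forall>x. (\<forall>i<m. x i \<in> I i) \<and> finsum R x {..<m} = \<zero>\<^bsub>R\<^esub> \<longrightarrow> (\<forall>i<m. x i = \<zero>\<^bsub>R\<^esub>))"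

definition goldie_rank :: "('a, 'c) ring_scheme \<Rightarrow> enat"
  where "goldie_rank R = Sup {enat m |m. \<exists>I. direct_left_ideals R m I}"


section \<open>The algebras \<open>B\<close>, the modules \<open>L(\<alpha>)\<close> and their supports\<close>

definition invariants :: "nat \<Rightarrow> nat \<Rightarrow> 'k::field weyl set \<Rightarrow> 'k weyl ring"
  where "invariants r s g = (weyl r s)\<lparr>carrier :=
    {a \<in> carrier (weyl r s). \<forall>t\<in>g.
       t \<otimes>\<^bsub>weyl r s\<^esub> a \<ominus>\<^bsub>weyl r s\<^esub> a \<otimes>\<^bsub>weyl r s\<^esub> t = \<zero>\<^bsub>weyl r s\<^esub>}\<rparr>"

definition shift_ideal :: "nat \<Rightarrow> nat \<Rightarrow> 'k::field weyl set \<Rightarrow> ('k weyl \<Rightarrow> 'k) \<Rightarrow> 'k weyl set"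
  where "shift_ideal r s g chi =
    genideal (invariants r s g) {t \<ominus>\<^bsub>weyl r s\<^esub> scal r s (chi t) |t. t \<in> g}"

definition B_ring :: "nat \<Rightarrow> nat \<Rightarrow> 'k::field weyl set \<Rightarrow> ('k weyl \<Rightarrow> 'k) \<Rightarrow> 'k weyl set ring"
  where "B_ring r s g chi = invariants r s g Quot shift_ideal r s g chi"

definition max_ideal_B ::
    "nat \<Rightarrow> nat \<Rightarrow> 'k::field weyl set \<Rightarrow> ('k weyl \<Rightarrow> 'k) \<Rightarrow> ('k weyl \<Rightarrow> 'k) \<Rightarrow> 'k weyl set set"
  where "max_ideal_B r s g chi \<gamma> =
    (\<lambda>f. shift_ideal r s g chi +>\<^bsub>invariants r s g\<^esub> f) ` max_ideal r s \<gamma>"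

definition graded_part ::
    "nat \<Rightarrow> nat \<Rightarrow> 'k::field weyl set \<Rightarrow> ('k weyl \<Rightarrow> 'k) \<Rightarrow>
     ('k weyl set, 'b) module \<Rightarrow> ('k weyl \<Rightarrow> 'k) \<Rightarrow> 'b set"
  where "graded_part r s g chi M \<gamma> =
    {m \<in> carrier M. \<forall>b \<in> max_ideal_B r s g chi \<gamma>. b \<odot>\<^bsub>M\<^esub> m = \<zero>\<^bsub>M\<^esub>}"

definition M_module ::
    "nat \<Rightarrow> nat \<Rightarrow> 'k::field weyl set \<Rightarrow> ('k weyl \<Rightarrow> 'k) \<Rightarrow> ('k weyl \<Rightarrow> 'k) \<Rightarrow>
     ('k weyl set, 'k weyl set set) module"
  where "M_module r s g chi \<alpha> =
    quotient_module (regular_module (B_ring r s g chi))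
      (gen_left_ideal (B_ring r s g chi) (max_ideal_B r s g chi \<alpha>))"

definition L_kernel ::
    "nat \<Rightarrow> nat \<Rightarrow> 'k::field weyl set \<Rightarrow> ('k weyl \<Rightarrow> 'k) \<Rightarrow> ('k weyl \<Rightarrow> 'k) \<Rightarrow> 'k weyl set set set"
  where "L_kernel r s g chi \<alpha> =
    simple_quotient_kernel (B_ring r s g chi) (M_module r s g chi \<alpha>)"

definition L_module ::
    "nat \<Rightarrow> nat \<Rightarrow> 'k::field weyl set \<Rightarrow> ('k weyl \<Rightarrow> 'k) \<Rightarrow> ('k weyl \<Rightarrow> 'k) \<Rightarrow>
     ('k weyl set, 'k weyl set set set) module"
  where "L_module r s g chi \<alpha> = quotient_module (M_module r s g chi \<alpha>) (L_kernel r s g chi \<alpha>)"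

text \<open>The inherited grading: the degree \<open>\<beta>\<close> part of \<open>L(\<alpha>)\<close> is the image of that of the module
  it is a quotient of.\<close>

definition L_part ::
    "nat \<Rightarrow> nat \<Rightarrow> 'k::field weyl set \<Rightarrow> ('k weyl \<Rightarrow> 'k) \<Rightarrow> ('k weyl \<Rightarrow> 'k) \<Rightarrow> ('k weyl \<Rightarrow> 'k) \<Rightarrow>
     'k weyl set set set set"
  where "L_part r s g chi \<alpha> \<beta> =
    (\<lambda>m. L_kernel r s g chi \<alpha> +>\<^bsub>M_module r s g chi \<alpha>\<^esub> m) `
      graded_part r s g chi (M_module r s g chi \<alpha>) \<beta>"

definition L_support ::
    "nat \<Rightarrow> nat \<Rightarrow> 'k::field weyl set \<Rightarrow> ('k weyl \<Rightarrow> 'k) \<Rightarrow> ('k weyl \<Rightarrow> 'k) \<Rightarrow> ('k weyl \<Rightarrow> 'k) set"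
  where "L_support r s g chi \<alpha> =
    {\<beta> \<in> dual r s (tt r s). L_part r s g chi \<alpha> \<beta> \<noteq> {\<zero>\<^bsub>L_module r s g chi \<alpha>\<^esub>}}"

definition J_ideal ::
    "nat \<Rightarrow> nat \<Rightarrow> 'k::field weyl set \<Rightarrow> ('k weyl \<Rightarrow> 'k) \<Rightarrow> ('k weyl \<Rightarrow> 'k) \<Rightarrow> 'k weyl set set"
  where "J_ideal r s g chi \<alpha> = annihilator (B_ring r s g chi) (L_module r s g chi \<alpha>)"

definition L_components ::
    "nat \<Rightarrow> nat \<Rightarrow> 'k::field weyl set \<Rightarrow> ('k weyl \<Rightarrow> 'k) \<Rightarrow> ('k weyl \<Rightarrow> 'k) \<Rightarrow> ('k weyl \<Rightarrow> 'k) set set"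
  where "L_components r s g chi \<alpha> = connected_components_of
    (subtopology (zariski r s) (zariski r s closure_of L_support r s g chi \<alpha>))"

end

theory Submission
  imports Defs "HOL-Library.Function_Algebras" "HOL-Real_Asymp.Real_Asymp"
begin

text \<open>Every element of the Weyl algebra acts on functions of a weight vector \<open>\<gamma> \<in> k\<^sup>n\<close> by a
difference operator: a word of degree \<open>\<nu> \<in> \<int>\<^sup>n\<close> in the generators shifts the argument by \<open>\<nu>\<close>
and multiplies by a polynomial in \<open>\<gamma>\<close>, and \<open>\<pi>\<^sub>i\<close> multiplies by the coordinate \<open>\<gamma>\<^sub>i\<close>. Exchanging the
roles of \<open>x\<^sub>i\<close> and \<open>\<partial>\<^sub>i\<close> in the coordinates where \<open>\<alpha>\<^sub>i\<close> is a negative integer, the simple module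
\<open>L(\<alpha>)\<close> becomes the space spanned by the weights \<open>\<alpha> + \<nu>\<close>, where \<open>\<nu>\<close> runs through the points of the
lattice \<open>\<Lambda> = \<int>\<^sup>n \<inter> \<gg>\<^sup>\<bottom>\<close> for which \<open>\<alpha>\<^sub>i + \<nu>\<^sub>i\<close> has the same sign as \<open>\<alpha>\<^sub>i\<close> whenever \<open>i < r\<close> and
\<open>\<alpha>\<^sub>i \<in> \<int>\<close>. This lattice orthant is the support (lemma \<open>L_support_eq\<close>), the primitive quotient
\<open>B/J(\<alpha>)\<close> is the algebra of operators induced on it (\<open>J_ideal_eq\<close>), and uniqueness of the maximal
submodule rests on the fact that a word of degree zero is a polynomial in the \<open>\<pi>\<^sub>i\<close>
(\<open>degree_zero_word_symF\<close>, \<open>submodule_top\<close>).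

Call one of the sign-restricted coordinates bounded if it takes finitely many values on the orthant,
and call the vector of the bounded coordinates of a point its face. By Dickson's lemma \<open>\<Lambda>\<close> contains
a vector that vanishes in the bounded coordinates and points strictly into the orthant in all others.
Moving along it shows that a polynomial which does not vanish identically on the coset of all
\<open>\<nu> \<in> \<Lambda>\<close> with a given face does not vanish at some point of the orthant as far away from the walls as
desired (\<open>deep_point\<close>), and that each such coset is irreducible (\<open>coset_irreducible\<close>). Hence the points
with a fixed face have a connected closure. There are finitely many faces, and an interpolation
polynomial in the bounded coordinates separates one face from the others; so the closures are
pairwise disjoint and are the connected components of the closure of the support (\<open>components_eq\<close>).

It remains to see that the Goldie rank of \<open>R = B/J(\<alpha>)\<close> is the number \<open>N\<close> of faces. The interpolation
polynomials are \<open>N\<close> orthogonal nonzero idempotents of \<open>R\<close>, which gives \<open>N\<close> independent left ideals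
(\<open>goldie_lower\<close>). Conversely, take nonzero elements \<open>A\<^sub>j\<close> of \<open>m > N\<close> left ideals; since the support is
connected by words, they can be chosen with a nonzero entry in the row of the weight \<open>\<alpha>\<close>. Look for
\<open>b\<^sub>j = \<Sum>\<^sub>\<delta> f\<^sub>j\<^sub>,\<^sub>\<delta> w\<^sub>\<delta>\<close> with \<open>\<Sum>\<^sub>j b\<^sub>j A\<^sub>j = 0\<close> on the face of \<open>\<alpha>\<close>, where \<open>\<delta>\<close> runs through a box of side
\<open>k\<close> in the sublattice of \<open>\<Lambda>\<close> with vanishing bounded coordinates, \<open>w\<^sub>\<delta>\<close> is a word of degree \<open>\<delta>\<close> and the
\<open>f\<^sub>j\<^sub>,\<^sub>\<delta>\<close> are unknown polynomials. The number of unknowns is \<open>m\<close> times the number of points of the box;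
the number of equations, one for each degree that can occur, is at most \<open>N\<close> times the number of points
of a box that is larger by a constant. As boxes grow polynomially, for some \<open>k\<close> there are more unknowns
than equations (\<open>counting\<close>), and a linear system over an integral domain has a nonzero solution
(\<open>relation_exists\<close>). Independence of the left ideals then forces \<open>b\<^sub>j A\<^sub>j = 0\<close> for all \<open>j\<close>, which is
impossible when some \<open>f\<^sub>j\<^sub>,\<^sub>\<delta>\<close> is nonzero: a suitable extremal degree of the product is reached in only
one way, and there the product is a product of nonzero polynomials on an irreducible coset
(\<open>product_nonzero\<close>, \<open>goldie_upper\<close>).\<close>

section \<open>Polynomial functions\<close>

text \<open>Arguments are functions on all of \<open>nat\<close>, so that the dimension stays an ordinary number and
weights and lattice vectors can be added coordinatewise; only the first \<open>n\<close> coordinates may occur.\<close>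

inductive_set polyfuns :: "nat \<Rightarrow> ((nat \<Rightarrow> 'k::comm_ring_1) \<Rightarrow> 'k) set" for n where
  const: "(\<lambda>_. c) \<in> polyfuns n"
| coord: "i < n \<Longrightarrow> (\<lambda>\<gamma>. \<gamma> i) \<in> polyfuns n"
| add: "f \<in> polyfuns n \<Longrightarrow> h \<in> polyfuns n \<Longrightarrow> (\<lambda>\<gamma>. f \<gamma> + h \<gamma>) \<in> polyfuns n"
| mult: "f \<in> polyfuns n \<Longrightarrow> h \<in> polyfuns n \<Longrightarrow> (\<lambda>\<gamma>. f \<gamma> * h \<gamma>) \<in> polyfuns n"

lemma polyfuns_diff:
  assumes "f \<in> polyfuns n" "h \<in> polyfuns n"
  shows "(\<lambda>\<gamma>. f \<gamma> - h \<gamma>) \<in> polyfuns n"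
  using polyfuns.add[OF assms(1) polyfuns.mult[OF polyfuns.const[of "-1"] assms(2)]] by simp

lemma polyfuns_sum:
  assumes "\<And>x. x \<in> A \<Longrightarrow> f x \<in> polyfuns n"
  shows "(\<lambda>\<gamma>. \<Sum>x\<in>A. f x \<gamma>) \<in> polyfuns n"
  using assms by (induction A rule: infinite_finite_induct) (auto intro: polyfuns.intros)

lemma polyfuns_prod:
  assumes "\<And>x. x \<in> A \<Longrightarrow> f x \<in> polyfuns n"
  shows "(\<lambda>\<gamma>. \<Prod>x\<in>A. f x \<gamma>) \<in> polyfuns n"
  using assms by (induction A rule: infinite_finite_induct) (auto intro: polyfuns.intros)

lemma polyfuns_shift:
  assumes "f \<in> polyfuns n"
  shows "(\<lambda>\<gamma>. f (\<gamma> - v)) \<in> polyfuns n"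
  using assms
proof induction
  case (coord i)
  show ?case using polyfuns_diff[OF polyfuns.coord[OF coord] polyfuns.const[of "v i"]] by simp
qed (auto intro: polyfuns.intros)

text \<open>On a line a polynomial function becomes a polynomial in one variable; this is how finiteness
of the set of roots enters.\<close>

lemma polyfuns_on_line:
  fixes f :: "(nat \<Rightarrow> 'k::comm_ring_1) \<Rightarrow> 'k"
  assumes "f \<in> polyfuns n"
  shows "\<exists>p. \<forall>z. f (\<lambda>i. u i + z * v i) = poly p z"
  using assms
proof induction
  case (const c)
  show ?case by (rule exI[of _ "[:c:]"]) simp
next
  case (coord i)
  show ?case by (rule exI[of _ "[:u i, v i:]"]) simp
next
  case (add f h)
  then obtain p q where "\<forall>z. f (\<lambda>i. u i + z * v i) = poly p z" "\<forall>z. h (\<lambda>i. u i + z * v i) = poly q z"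
    by blast
  then show ?case by (intro exI[of _ "p + q"]) simp
next
  case (mult f h)
  then obtain p q where "\<forall>z. f (\<lambda>i. u i + z * v i) = poly p z" "\<forall>z. h (\<lambda>i. u i + z * v i) = poly q z"
    by blast
  then show ?case by (intro exI[of _ "p * q"]) simp
qed

lemma polyfun_finite_integer_zeros:
  fixes f :: "(nat \<Rightarrow> 'k::field_char_0) \<Rightarrow> 'k"
  assumes "f \<in> polyfuns n" "f (\<lambda>i. u i + of_int z0 * v i) \<noteq> 0"
  shows "finite {z::int. f (\<lambda>i. u i + of_int z * v i) = 0}"
proof -
  obtain p where p: "\<forall>z. f (\<lambda>i. u i + z * v i) = poly p z"
    using polyfuns_on_line[OF assms(1)] by blast
  then have "p \<noteq> 0" using assms(2) by auto
  then have "finite {z. poly p z = 0}" by (rule poly_roots_finite)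
  then have "finite (of_int -` {z. poly p z = 0} :: int set)"
    by (rule finite_vimageI) (simp add: inj_def)
  then show ?thesis using p by (simp add: vimage_def)
qed

section \<open>Homogeneous linear systems\<close>

text \<open>Gaussian elimination without division. The coefficients are functions on \<open>X\<close>, and
\<open>domain\<close> says that modulo equality on \<open>X\<close> they have no zero divisors, so that multiplying by a pivot
preserves non-vanishing.\<close>

lemma homogeneous_system_solvable:
  fixes a :: "'e \<Rightarrow> 'i \<Rightarrow> 'a \<Rightarrow> 'k::comm_ring_1" and F :: "('a \<Rightarrow> 'k) set"
  assumes F: "\<And>c. (\<lambda>_. c) \<in> F"
    "\<And>f h. f \<in> F \<Longrightarrow> h \<in> F \<Longrightarrow> (\<lambda>x. f x + h x) \<in> F"
    "\<And>f h. f \<in> F \<Longrightarrow> h \<in> F \<Longrightarrow> (\<lambda>x. f x * h x) \<in> F"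
    and domain: "\<And>f h x y. f \<in> F \<Longrightarrow> h \<in> F \<Longrightarrow> x \<in> X \<Longrightarrow> y \<in> X \<Longrightarrow> f x \<noteq> 0 \<Longrightarrow> h y \<noteq> 0 \<Longrightarrow>
      \<exists>z\<in>X. f z * h z \<noteq> 0"
    and "X \<noteq> {}"
  assumes "finite E" "finite I" "card E < card I" "\<And>e i. e \<in> E \<Longrightarrow> i \<in> I \<Longrightarrow> a e i \<in> F"
  shows "\<exists>f. (\<forall>i\<in>I. f i \<in> F) \<and> (\<exists>i\<in>I. \<exists>x\<in>X. f i x \<noteq> 0) \<and>
    (\<forall>e\<in>E. \<forall>x\<in>X. (\<Sum>i\<in>I. f i x * a e i x) = 0)"
  using assms(6-)
proof (induction E arbitrary: I a rule: finite_induct)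
  case empty
  obtain x where "x \<in> X" using \<open>X \<noteq> {}\<close> by blast
  moreover obtain i where "i \<in> I" using empty by fastforce
  ultimately show ?case using F(1)[of 1] by (intro exI[of _ "\<lambda>_ _. 1"]) auto
next
  case (insert e E)
  show ?case
  proof (cases "\<forall>i\<in>I. \<forall>x\<in>X. a e i x = 0")
    case True
    obtain f where "\<forall>i\<in>I. f i \<in> F" "\<exists>i\<in>I. \<exists>x\<in>X. f i x \<noteq> 0"
      "\<forall>e\<in>E. \<forall>x\<in>X. (\<Sum>i\<in>I. f i x * a e i x) = 0"
      using insert.IH[of I a] insert.prems insert.hyps by auto
    then show ?thesis using True by (intro exI[of _ f]) auto
  next
    case False
    then obtain i0 x0 where i0: "i0 \<in> I" "x0 \<in> X" "a e i0 x0 \<noteq> 0" by blast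
    \<comment> \<open>Eliminate the unknown \<open>i0\<close> with the equation \<open>e\<close>, whose coefficient
      there is not identically zero.\<close>
    let ?J = "I - {i0}"
    define a' where "a' e' i = (\<lambda>x. a e i0 x * a e' i x + (-1) * (a e' i0 x * a e i x))" for e' i
    have fin: "finite ?J" using insert.prems by simp
    have a'F: "a' e' i \<in> F" if "e' \<in> E" "i \<in> ?J" for e' i
      unfolding a'_def using that insert.prems(3) i0(1) by (intro F) auto
    have "card E < card ?J" using insert.prems insert.hyps i0(1) by simp
    then obtain f' where f': "\<forall>i\<in>?J. f' i \<in> F" "\<exists>i\<in>?J. \<exists>x\<in>X. f' i x \<noteq> 0"
      "\<forall>e\<in>E. \<forall>x\<in>X. (\<Sum>i\<in>?J. f' i x * a' e i x) = 0"
      using insert.IH[of ?J a'] fin a'F by blast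
    define f where "f i = (if i = i0 then \<lambda>x. (-1) * (\<Sum>j\<in>?J. f' j x * a e j x)
        else (\<lambda>x. a e i0 x * f' i x))" for i
    have sumF: "(\<lambda>x. \<Sum>j\<in>J. f' j x * a e j x) \<in> F" if "J \<subseteq> ?J" for J
      using finite_subset[OF that fin] that
    proof (induction J rule: finite_induct)
      case empty
      show ?case using F(1)[of 0] by simp
    next
      case (insert j J)
      then show ?case using f'(1) insert.prems \<open>\<And>e' i. e' \<in> insert e E \<Longrightarrow> i \<in> I \<Longrightarrow> a e' i \<in> F\<close>
        by (simp, intro F) auto
    qed
    have fF: "\<forall>i\<in>I. f i \<in> F"
    proof
      fix i assume "i \<in> I"
      then show "f i \<in> F" unfolding f_def
        using f'(1) insert.prems(3) i0(1) F(3)[OF F(1)[of "-1"] sumF[OF subset_refl]]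
        by (cases "i = i0") (auto intro!: F)
    qed
    obtain i1 x1 where i1: "i1 \<in> ?J" "x1 \<in> X" "f' i1 x1 \<noteq> 0" using f'(2) by blast
    obtain z where "z \<in> X" "a e i0 z * f' i1 z \<noteq> 0"
      using domain[of "a e i0" "f' i1" x0 x1] i0 i1 f'(1) insert.prems(3) by blast
    then have nz: "\<exists>i\<in>I. \<exists>x\<in>X. f i x \<noteq> 0"
      using i1 by (intro bexI[of _ i1] bexI[of _ z]) (auto simp: f_def)
    have split: "(\<Sum>i\<in>I. f i x * a e' i x) = (\<Sum>i\<in>?J. f' i x * a' e' i x)" for x e'
    proof -
      have "(\<Sum>i\<in>I. f i x * a e' i x) = f i0 x * a e' i0 x + (\<Sum>i\<in>?J. f i x * a e' i x)"
        using insert.prems(1) i0(1) by (simp add: sum.remove)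
      also have "(\<Sum>i\<in>?J. f i x * a e' i x) = (\<Sum>i\<in>?J. a e i0 x * f' i x * a e' i x)"
        by (intro sum.cong) (auto simp: f_def)
      also have "f i0 x * a e' i0 x = (\<Sum>i\<in>?J. - (f' i x * a e i x * a e' i0 x))"
        by (simp add: f_def sum_distrib_right sum_negf)
      finally show ?thesis
        by (simp add: a'_def sum.distrib[symmetric] algebra_simps)
    qed
    have "(\<Sum>i\<in>I. f i x * a e' i x) = 0" if "e' \<in> insert e E" "x \<in> X" for e' x
    proof (cases "e' = e")
      case True
      then show ?thesis unfolding split by (auto intro!: sum.neutral simp: a'_def algebra_simps)
    next
      case False
      then show ?thesis unfolding split using f'(3) that by auto
    qed
    then show ?thesis using fF nz by blast
  qed
qed

section \<open>Finite sets of lattice points\<close>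

text \<open>Pass to the elements of \<open>A\<close> and of \<open>B\<close> with the largest coordinate \<open>0\<close>, among these to the ones
with the largest coordinate \<open>1\<close>, and so on. The two lexicographic maxima that remain have the required
property. It provides leading terms for elements graded by \<open>\<int>\<^sup>n\<close>.\<close>

lemma ex_unique_sum:
  fixes A B :: "(nat \<Rightarrow> int) set"
  assumes fin: "finite A" "finite B" and ne: "A \<noteq> {}" "B \<noteq> {}"
    and supp: "\<And>a i. a \<in> A \<union> B \<Longrightarrow> i \<ge> n \<Longrightarrow> a i = 0"
  shows "\<exists>a\<in>A. \<exists>b\<in>B. \<forall>a'\<in>A. \<forall>b'\<in>B. a' + b' = a + b \<longrightarrow> a' = a \<and> b' = b"
proof -
  define agree :: "nat \<Rightarrow> (nat \<Rightarrow> int) set \<Rightarrow> bool"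
    where "agree k X \<longleftrightarrow> (\<forall>a\<in>X. \<forall>a'\<in>X. \<forall>i<k. a i = a' i)" for k X
  define extremal where "extremal A' B' \<longleftrightarrow>
      (\<forall>a\<in>A'. \<forall>b\<in>B'. \<forall>a'\<in>A. \<forall>b'\<in>B. a' + b' = a + b \<longrightarrow> a' \<in> A' \<and> b' \<in> B')" for A' B'
  have extremalD: "a' \<in> A' \<and> b' \<in> B'"
    if "extremal A' B'" "a \<in> A'" "b \<in> B'" "a' \<in> A" "b' \<in> B" "a' + b' = a + b" for A' B' a b a' b'
    using that unfolding extremal_def by metis
  have "\<exists>A' B'. A' \<subseteq> A \<and> B' \<subseteq> B \<and> A' \<noteq> {} \<and> B' \<noteq> {} \<and> agree k A' \<and> agree k B' \<and> extremal A' B'" for k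
  proof (induction k)
    case 0
    show ?case using ne by - (rule exI[of _ A], rule exI[of _ B], simp add: agree_def extremal_def)
  next
    case (Suc k)
    then obtain A' B' where IH: "A' \<subseteq> A" "B' \<subseteq> B" "A' \<noteq> {}" "B' \<noteq> {}"
      "agree k A'" "agree k B'" "extremal A' B'"
      by blast
    have fin': "finite A'" "finite B'" using IH fin finite_subset by auto
    define mA where "mA = Max ((\<lambda>a. a k) ` A')"
    define mB where "mB = Max ((\<lambda>a. a k) ` B')"
    have le: "a \<in> A' \<Longrightarrow> a k \<le> mA" "b \<in> B' \<Longrightarrow> b k \<le> mB" for a b
      unfolding mA_def mB_def using fin' by auto
    have "mA \<in> (\<lambda>a. a k) ` A'" "mB \<in> (\<lambda>a. a k) ` B'"
      unfolding mA_def mB_def using fin' IH by (auto intro!: Max_in)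
    then have ne': "{a \<in> A'. a k = mA} \<noteq> {}" "{a \<in> B'. a k = mB} \<noteq> {}" by auto
    have "a' \<in> {a \<in> A'. a k = mA} \<and> b' \<in> {a \<in> B'. a k = mB}"
      if "a \<in> {a \<in> A'. a k = mA}" "b \<in> {a \<in> B'. a k = mB}" "a' \<in> A" "b' \<in> B" "a' + b' = a + b"
      for a b a' b'
    proof -
      have *: "a' \<in> A'" "b' \<in> B'" using extremalD[OF IH(7)] that by auto
      have "a' k + b' k = a k + b k" using that(5) by (metis plus_fun_apply)
      then show ?thesis using le(1)[OF *(1)] le(2)[OF *(2)] * that(1,2) by auto
    qed
    then have "extremal {a \<in> A'. a k = mA} {a \<in> B'. a k = mB}" unfolding extremal_def by (intro ballI impI)
    note ext = this
    have agree_Suc: "agree (Suc k) {a \<in> X. a k = m}" if "agree k X" for X m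
      unfolding agree_def
    proof (intro ballI allI impI)
      fix a a' i assume "a \<in> {a \<in> X. a k = m}" "a' \<in> {a \<in> X. a k = m}" "i < Suc k"
      then have *: "a \<in> X" "a' \<in> X" "a k = m" "a' k = m" "i < k \<or> i = k" by auto
      from that have "i < k \<longrightarrow> a i = a' i" unfolding agree_def using *(1,2) by (elim ballE allE) auto
      with *(3-5) show "a i = a' i" by auto
    qed
    have "{a \<in> A'. a k = mA} \<subseteq> A" "{a \<in> B'. a k = mB} \<subseteq> B" using IH(1,2) by auto
    then show ?case using ne' agree_Suc[OF IH(5), of mA] agree_Suc[OF IH(6), of mB] ext
      by - (rule exI[of _ "{a \<in> A'. a k = mA}"], rule exI[of _ "{a \<in> B'. a k = mB}"], intro conjI)
  qed
  from this[of n] obtain A' B' where AB: "A' \<subseteq> A" "B' \<subseteq> B" "A' \<noteq> {}" "B' \<noteq> {}"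
      "agree n A'" "agree n B'" "extremal A' B'"
    by blast
  obtain a b where ab: "a \<in> A'" "b \<in> B'" using AB(3,4) by blast
  have single: "x = y" if "agree n X" "x \<in> X" "y \<in> X" "x \<in> A \<union> B" "y \<in> A \<union> B" for X x y
  proof
    fix i show "x i = y i"
      using that supp[OF that(4), of i] supp[OF that(5), of i] unfolding agree_def
      by (cases "i < n") auto
  qed
  have "a' = a \<and> b' = b" if "a' \<in> A" "b' \<in> B" "a' + b' = a + b" for a' b'
    using extremalD[OF AB(7) ab that] single[OF AB(5), of a' a] single[OF AB(6), of b' b] ab AB(1,2) that
    by blast
  then show ?thesis using ab AB(1,2) by blast
qed

text \<open>Otherwise \<open>h\<close> would grow along the multiples of \<open>e\<close> at least like the powers of \<open>(N + 1) / N\<close>.\<close>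

lemma polynomial_growth_ratio:
  fixes h :: "nat \<Rightarrow> nat"
  assumes bound: "\<And>k. h k \<le> (2 * k + 1) ^ d" and pos: "h 0 > 0"
  shows "\<exists>k. N * h (k + e) < Suc N * h k"
proof (rule ccontr)
  assume "\<not> ?thesis"
  then have neg: "Suc N * h k \<le> N * h (k + e)" for k by (simp add: not_less)
  then have N: "N > 0" using pos neg[of 0] by (cases N) auto
  define q :: real where "q = real (Suc N) / real N"
  have q1: "q > 1" using N by (simp add: q_def field_simps)
  have qh: "q ^ j \<le> real (h (j * e))" for j
  proof (induction j)
    case 0
    then show ?case using pos by simp
  next
    case (Suc j)
    have "real (Suc N) * real (h (j * e)) \<le> real N * real (h (j * e + e))"
      using neg[of "j * e"] by (metis of_nat_le_iff of_nat_mult)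
    then have "q * real (h (j * e)) \<le> real (h (j * e + e))"
      using N by (simp add: q_def field_simps)
    moreover have "q * q ^ j \<le> q * real (h (j * e))" using Suc q1 by simp
    ultimately show ?case by (simp add: add.commute)
  qed
  then have le: "q ^ j \<le> (2 * (real j * real e) + 1) ^ d" for j
  proof -
    have "real (h (j * e)) \<le> real ((2 * (j * e) + 1) ^ d)"
      using bound[of "j * e"] by (rule of_nat_mono)
    then show ?thesis using qh[of j] by (simp add: algebra_simps)
  qed
  have "(\<lambda>j. (real j + 1) ^ d / q ^ j) \<longlonglongrightarrow> 0"
    using q1 by real_asymp
  then have "(\<lambda>j. real (2 * e + 1) ^ d * ((real j + 1) ^ d / q ^ j)) \<longlonglongrightarrow> 0"
    by (rule tendsto_mult_right_zero)
  then have "eventually (\<lambda>j. real (2 * e + 1) ^ d * ((real j + 1) ^ d / q ^ j) < 1) sequentially"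
    by (rule order_tendstoD) simp
  then obtain j where j: "real (2 * e + 1) ^ d * ((real j + 1) ^ d / q ^ j) < 1"
    by (auto simp: eventually_sequentially)
  have "(2 * (real j * real e) + 1) ^ d \<le> (real (2 * e + 1) * (real j + 1)) ^ d"
    by (intro power_mono) (auto simp: algebra_simps)
  then have "q ^ j \<le> real (2 * e + 1) ^ d * (real j + 1) ^ d"
    using le[of j] by (simp add: power_mult_distrib)
  then show False using j q1 by (simp add: field_simps)
qed

lemma nat_seq_nondecreasing_subseq:
  fixes f :: "nat \<Rightarrow> nat"
  shows "\<exists>r::nat \<Rightarrow> nat. strict_mono r \<and> mono (f \<circ> r)"
proof -
  obtain r :: "nat \<Rightarrow> nat" where r: "strict_mono r" "monoseq (f \<circ> r)"
    using seq_monosub[of f] by (auto simp: o_def)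
  show ?thesis
  proof (cases "mono (f \<circ> r)")
    case True
    then show ?thesis using r by blast
  next
    case False
    then have dec: "m \<le> k \<Longrightarrow> f (r k) \<le> f (r m)" for m k
      using r(2) by (auto simp: monoseq_def mono_def)
    obtain k0 where k0: "\<And>k. f (r k0) \<le> f (r k)"
      using ex_has_least_nat[of "\<lambda>_. True" 0 "\<lambda>k. f (r k)"] by auto
    have "f (r (k0 + k)) = f (r k0)" for k
      using dec[of k0 "k0 + k"] k0[of "k0 + k"] by simp
    then have "mono (f \<circ> (\<lambda>k. r (k0 + k)))" by (simp add: mono_def)
    moreover have "strict_mono (\<lambda>k. r (k0 + k))" using r(1) by (simp add: strict_mono_def)
    ultimately show ?thesis by blast
  qed
qed

text \<open>Dickson's lemma, obtained by thinning out the sequence one coordinate at a time.\<close>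

lemma dickson_subseq:
  fixes f :: "nat \<Rightarrow> 'i \<Rightarrow> nat"
  assumes "finite I"
  shows "\<exists>r::nat \<Rightarrow> nat. strict_mono r \<and> (\<forall>i\<in>I. mono (\<lambda>k. f (r k) i))"
  using assms
proof (induction I rule: finite_induct)
  case empty
  show ?case by (rule exI[of _ id]) (auto simp: strict_mono_def)
next
  case (insert i I)
  then obtain r :: "nat \<Rightarrow> nat" where r: "strict_mono r" "\<forall>i\<in>I. mono (\<lambda>k. f (r k) i)" by blast
  obtain r' :: "nat \<Rightarrow> nat" where r': "strict_mono r'" "mono ((\<lambda>k. f (r k) i) \<circ> r')"
    using nat_seq_nondecreasing_subseq by blast
  have "mono (\<lambda>k. f (r (r' k)) j)" if "j \<in> I" for j
    using r(2) that r'(1) by (auto simp: mono_def strict_mono_less_eq)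
  then show ?case using r r' by (intro exI[of _ "r \<circ> r'"]) (auto simp: strict_mono_def o_def)
qed

section \<open>Lattice points of an orthant\<close>

abbreviation ivec :: "(nat \<Rightarrow> int) \<Rightarrow> nat \<Rightarrow> 'k::ring_1"
  where "ivec \<nu> \<equiv> (\<lambda>i. of_int (\<nu> i))"

text \<open>In the application \<open>L\<close> is the lattice of shifts that commute with \<open>\<gg>\<close>, and \<open>\<sigma>\<^sub>i \<nu>\<^sub>i + b\<^sub>i \<ge> 0\<close> says that
the integral weight coordinate \<open>i\<close> has the same sign at \<open>\<nu>\<close> as at the origin.\<close>

locale sign_lattice =
  fixes n :: nat and L :: "(nat \<Rightarrow> int) set" and I :: "nat set" and \<sigma> b :: "nat \<Rightarrow> int"
  assumes zero_mem: "0 \<in> L"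
    and diff_mem: "\<nu> \<in> L \<Longrightarrow> \<mu> \<in> L \<Longrightarrow> \<nu> - \<mu> \<in> L"
    and supp: "\<nu> \<in> L \<Longrightarrow> n \<le> i \<Longrightarrow> \<nu> i = 0"
    and finite_I: "finite I"
    and sign: "i \<in> I \<Longrightarrow> \<sigma> i = 1 \<or> \<sigma> i = -1"
    and b_nonneg: "i \<in> I \<Longrightarrow> 0 \<le> b i"
begin

lemma minus_mem: "\<nu> \<in> L \<Longrightarrow> - \<nu> \<in> L"
  using diff_mem[OF zero_mem] by fastforce

lemma add_mem: "\<nu> \<in> L \<Longrightarrow> \<mu> \<in> L \<Longrightarrow> \<nu> + \<mu> \<in> L"
  using diff_mem[of \<nu> "- \<mu>"] minus_mem by simp

lemma scale_mem_nat: "\<nu> \<in> L \<Longrightarrow> (\<lambda>i. int m * \<nu> i) \<in> L"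
proof (induction m)
  case 0
  then show ?case using zero_mem by (simp add: zero_fun_def)
next
  case (Suc m)
  have "(\<lambda>i. int (Suc m) * \<nu> i) = (\<lambda>i. int m * \<nu> i) + \<nu>"
    by (auto simp: algebra_simps)
  then show ?case using Suc add_mem by simp
qed

lemma scale_mem: "\<nu> \<in> L \<Longrightarrow> (\<lambda>i. z * \<nu> i) \<in> L"
proof (cases "z \<ge> 0")
  case True
  then show "\<nu> \<in> L \<Longrightarrow> ?thesis" using scale_mem_nat[of \<nu> "nat z"] by simp
next
  case False
  have "(\<lambda>i. z * \<nu> i) = - (\<lambda>i. int (nat (- z)) * \<nu> i)" using False by auto
  then show "\<nu> \<in> L \<Longrightarrow> ?thesis" using minus_mem[OF scale_mem_nat[of \<nu> "nat (- z)"]] by metis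
qed

definition orthant :: "(nat \<Rightarrow> int) set"
  where "orthant = {\<nu> \<in> L. \<forall>i\<in>I. 0 \<le> \<sigma> i * \<nu> i + b i}"

definition bounded_coords :: "nat set"
  where "bounded_coords = {i \<in> I. finite ((\<lambda>\<nu>. \<nu> i) ` orthant)}"

text \<open>The bounded coordinates, padded with zeros to stay within one type.\<close>

definition face :: "(nat \<Rightarrow> int) \<Rightarrow> nat \<Rightarrow> int"
  where "face \<nu> = (\<lambda>i. if i \<in> bounded_coords then \<nu> i else 0)"

definition faces :: "(nat \<Rightarrow> int) set"
  where "faces = face ` orthant"

lemma orthant_L: "\<nu> \<in> orthant \<Longrightarrow> \<nu> \<in> L" by (simp add: orthant_def)

lemma zero_orthant: "0 \<in> orthant" by (simp add: orthant_def zero_mem b_nonneg)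

lemma face_add: "face (\<nu> + \<mu>) = face \<nu> + face \<mu>" by (auto simp: face_def)
lemma face_diff: "face (\<nu> - \<mu>) = face \<nu> - face \<mu>" by (auto simp: face_def)
lemma face_zero: "face 0 = 0" by (auto simp: face_def)

lemma face_orthant: "\<nu> \<in> orthant \<Longrightarrow> face \<nu> \<in> faces" by (simp add: faces_def)

lemma finite_bounded_coords: "finite bounded_coords"
  using finite_I by (simp add: bounded_coords_def)

lemma finite_faces: "finite faces"
proof -
  let ?P = "PiE bounded_coords (\<lambda>i. (\<lambda>\<nu>. \<nu> i) ` orthant)"
  have "finite ?P" using finite_bounded_coords by (rule finite_PiE) (simp add: bounded_coords_def)
  moreover have "faces \<subseteq> (\<lambda>p i. if i \<in> bounded_coords then p i else 0) ` ?P"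
  proof
    fix c assume "c \<in> faces"
    then obtain \<nu> where "\<nu> \<in> orthant" "c = face \<nu>" by (auto simp: faces_def)
    then show "c \<in> (\<lambda>p i. if i \<in> bounded_coords then p i else 0) ` ?P"
      by (intro image_eqI[of _ _ "restrict \<nu> bounded_coords"]) (auto simp: face_def)
  qed
  ultimately show ?thesis by (meson finite_imageI finite_subset)
qed

text \<open>Along a sequence of orthant points whose coordinate \<open>i\<close> grows, Dickson's lemma finds two points
whose difference does not decrease any coordinate.\<close>

lemma unbounded_direction:
  assumes i: "i \<in> I - bounded_coords"
  shows "\<exists>v\<in>L. (\<forall>j\<in>I. 0 \<le> \<sigma> j * v j) \<and> 0 < \<sigma> i * v i"
proof -
  define h where "h \<nu> j = nat (\<sigma> j * \<nu> j + b j)" for \<nu> j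
  have hS: "int (h \<nu> j) = \<sigma> j * \<nu> j + b j" if "\<nu> \<in> orthant" "j \<in> I" for \<nu> j
    using that by (simp add: h_def orthant_def)
  have "infinite ((\<lambda>\<nu>. h \<nu> i) ` orthant)"
  proof
    assume "finite ((\<lambda>\<nu>. h \<nu> i) ` orthant)"
    then have "finite ((\<lambda>m. \<sigma> i * (int m - b i)) ` (\<lambda>\<nu>. h \<nu> i) ` orthant)" by simp
    moreover have "(\<lambda>\<nu>. \<nu> i) ` orthant \<subseteq> (\<lambda>m. \<sigma> i * (int m - b i)) ` (\<lambda>\<nu>. h \<nu> i) ` orthant"
    proof (rule image_subsetI)
      fix \<nu> assume \<nu>: "\<nu> \<in> orthant"
      have "\<nu> i = \<sigma> i * (int (h \<nu> i) - b i)" using hS[OF \<nu>, of i] sign[of i] i by auto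
      then show "\<nu> i \<in> (\<lambda>m. \<sigma> i * (int m - b i)) ` (\<lambda>\<nu>. h \<nu> i) ` orthant" using \<nu> by blast
    qed
    ultimately show False using i by (auto simp: bounded_coords_def dest: finite_subset)
  qed
  from infinite_enumerate[OF this] obtain r0 :: "nat \<Rightarrow> nat"
    where r0: "strict_mono r0" "\<forall>k. r0 k \<in> (\<lambda>\<nu>. h \<nu> i) ` orthant"
    by (elim exE conjE)
  have "\<forall>k. \<exists>\<nu>. \<nu> \<in> orthant \<and> h \<nu> i = r0 k" using r0(2) by (metis image_iff)
  from choice[OF this] obtain f where f: "\<And>k. f k \<in> orthant" "\<And>k. h (f k) i = r0 k"
    by blast
  obtain r :: "nat \<Rightarrow> nat" where r: "strict_mono r" "\<forall>j\<in>I. mono (\<lambda>k. h (f (r k)) j)"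
    using dickson_subseq[OF finite_I, of "\<lambda>k. h (f k)"] by blast
  define v where "v = f (r 1) - f (r 0)"
  have \<sigma>v: "\<sigma> j * v j = int (h (f (r 1)) j) - int (h (f (r 0)) j)" if "j \<in> I" for j
    using hS[OF f(1) that, of "r 1"] hS[OF f(1) that, of "r 0"] by (simp add: v_def algebra_simps)
  have "0 \<le> \<sigma> j * v j" if "j \<in> I" for j
    using monoD[OF r(2)[rule_format, OF that], of 0 1] \<sigma>v[OF that] by simp
  moreover have "r0 (r 0) < r0 (r 1)" using r0(1) r(1) by (simp add: strict_mono_def)
  then have "0 < \<sigma> i * v i" using \<sigma>v[of i] i f(2) by simp
  moreover have "v \<in> L" unfolding v_def using f(1) orthant_L by (intro diff_mem) auto
  ultimately show ?thesis by blast
qed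

text \<open>All multiples of \<open>v\<close> lie in the orthant, so coordinate \<open>i\<close> of \<open>v\<close> cannot be nonzero.\<close>

lemma recession_bounded_zero:
  assumes "v \<in> L" "\<forall>j\<in>I. 0 \<le> \<sigma> j * v j" "i \<in> bounded_coords"
  shows "v i = 0"
proof (rule ccontr)
  assume "v i \<noteq> 0"
  have "(\<lambda>j. int m * v j) \<in> orthant" for m
  proof -
    have "0 \<le> \<sigma> j * (int m * v j) + b j" if "j \<in> I" for j
    proof -
      have "0 \<le> int m * (\<sigma> j * v j)" using mult_nonneg_nonneg[of "int m" "\<sigma> j * v j"] assms(2) that by simp
      then show ?thesis using b_nonneg[OF that] by (simp add: ac_simps)
    qed
    then show ?thesis using scale_mem_nat[OF assms(1)] by (simp add: orthant_def)
  qed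
  then have "(\<lambda>m. int m * v i) ` UNIV \<subseteq> (\<lambda>\<nu>. \<nu> i) ` orthant" by (auto intro!: image_eqI)
  then have "finite (range (\<lambda>m::nat. int m * v i))"
    using assms(3) finite_subset by (auto simp: bounded_coords_def)
  moreover have "inj (\<lambda>m::nat. int m * v i)" using \<open>v i \<noteq> 0\<close> by (simp add: inj_def)
  ultimately show False using finite_imageD by blast
qed

lemma interior_direction_exists:
  "\<exists>w\<in>L. (\<forall>i\<in>bounded_coords. w i = 0) \<and> (\<forall>i\<in>I - bounded_coords. 0 < \<sigma> i * w i)"
proof -
  have "finite (I - bounded_coords)" using finite_I by simp
  moreover have "\<exists>w\<in>L. (\<forall>j\<in>I. 0 \<le> \<sigma> j * w j) \<and> (\<forall>i\<in>J. 0 < \<sigma> i * w i)"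
    if "finite J" "J \<subseteq> I - bounded_coords" for J
    using that
  proof (induction J rule: finite_induct)
    case empty
    show ?case using zero_mem by (intro bexI[of _ 0]) auto
  next
    case (insert i J)
    then obtain w where w: "w \<in> L" "\<forall>j\<in>I. 0 \<le> \<sigma> j * w j" "\<forall>i\<in>J. 0 < \<sigma> i * w i" by auto
    obtain v where v: "v \<in> L" "\<forall>j\<in>I. 0 \<le> \<sigma> j * v j" "0 < \<sigma> i * v i"
      using unbounded_direction[of i] insert.prems by auto
    have "0 < \<sigma> j * w j + \<sigma> j * v j" if "j \<in> insert i J" for j
    proof -
      have "j \<in> I" using that insert.prems by auto
      then show ?thesis using w v that by (cases "j = i") (auto intro: add_nonneg_pos add_pos_nonneg)
    qed
    then show ?case using w v by (intro bexI[of _ "w + v"] add_mem) (auto simp: algebra_simps)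
  qed
  ultimately obtain w where "w \<in> L" "\<forall>j\<in>I. 0 \<le> \<sigma> j * w j" "\<forall>i\<in>I - bounded_coords. 0 < \<sigma> i * w i"
    by blast
  then show ?thesis using recession_bounded_zero by blast
qed

text \<open>A lattice vector in the relative interior of the recession cone of the orthant.\<close>

definition interior_direction :: "nat \<Rightarrow> int"
  where "interior_direction = (SOME w. w \<in> L \<and> (\<forall>i\<in>bounded_coords. w i = 0) \<and>
    (\<forall>i\<in>I - bounded_coords. 0 < \<sigma> i * w i))"

lemma interior_direction:
  "interior_direction \<in> L" "i \<in> bounded_coords \<Longrightarrow> interior_direction i = 0"
  "i \<in> I - bounded_coords \<Longrightarrow> 0 < \<sigma> i * interior_direction i"
proof -
  have "interior_direction \<in> L \<and> (\<forall>i\<in>bounded_coords. interior_direction i = 0) \<and>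
    (\<forall>i\<in>I - bounded_coords. 0 < \<sigma> i * interior_direction i)"
    using interior_direction_exists unfolding Bex_def interior_direction_def by (rule someI_ex)
  then show "interior_direction \<in> L" "i \<in> bounded_coords \<Longrightarrow> interior_direction i = 0"
    "i \<in> I - bounded_coords \<Longrightarrow> 0 < \<sigma> i * interior_direction i" by auto
qed

lemma eventually_orthant:
  assumes "\<nu> \<in> L" "face \<nu> \<in> faces"
  shows "\<exists>M. \<forall>m\<ge>M. \<nu> + (\<lambda>i. m * interior_direction i) \<in> orthant"
proof (intro exI allI impI)
  let ?w = interior_direction
  fix m assume m: "m \<ge> (\<Sum>i\<in>I. \<bar>\<sigma> i * \<nu> i + b i\<bar>)"
  obtain \<mu> where \<mu>: "\<mu> \<in> orthant" "face \<nu> = face \<mu>" using assms(2) by (auto simp: faces_def)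
  have "0 \<le> \<sigma> i * (\<nu> i + m * ?w i) + b i" if i: "i \<in> I" for i
  proof (cases "i \<in> bounded_coords")
    case True
    then have "\<nu> i = \<mu> i" using fun_cong[OF \<mu>(2), of i] by (simp add: face_def)
    then show ?thesis using \<mu>(1) i True interior_direction(2) by (simp add: orthant_def)
  next
    case False
    have "\<bar>\<sigma> i * \<nu> i + b i\<bar> \<le> (\<Sum>i\<in>I. \<bar>\<sigma> i * \<nu> i + b i\<bar>)"
      by (rule member_le_sum) (use i finite_I in auto)
    with m have "\<bar>\<sigma> i * \<nu> i + b i\<bar> \<le> m" by simp
    moreover have "m * 1 \<le> m * (\<sigma> i * ?w i)"
      by (rule mult_left_mono) (use calculation interior_direction(3)[of i] i False in auto)
    ultimately show ?thesis by (simp add: algebra_simps)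
  qed
  then show "\<nu> + (\<lambda>i. m * ?w i) \<in> orthant"
    using add_mem[OF assms(1) scale_mem[OF interior_direction(1)]] by (simp add: orthant_def)
qed

text \<open>The cosets with \<open>c \<in> faces\<close> are the lattice points of the Zariski components.\<close>

definition coset :: "(nat \<Rightarrow> int) \<Rightarrow> (nat \<Rightarrow> int) set"
  where "coset c = {\<nu> \<in> L. face \<nu> = c}"

lemma face_interior_direction: "face (\<lambda>i. m * interior_direction i) = 0"
  by (auto simp: face_def interior_direction(2))

text \<open>The line through the two points stays in the coset, and each function has finitely many zeros on
its integer points.\<close>

lemma coset_irreducible:
  fixes a :: "nat \<Rightarrow> 'k::field_char_0"
  assumes "f \<in> polyfuns N" "h \<in> polyfuns N" "\<nu> \<in> coset c" "\<mu> \<in> coset c"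
    "f (a + ivec \<nu>) \<noteq> 0" "h (a + ivec \<mu>) \<noteq> 0"
  shows "\<exists>\<rho>\<in>coset c. f (a + ivec \<rho>) * h (a + ivec \<rho>) \<noteq> 0"
proof -
  define pt where "pt z = (\<lambda>i. (a + ivec \<nu>) i + of_int z * of_int ((\<mu> - \<nu>) i))" for z
  have "pt 0 = a + ivec \<nu>" "pt 1 = a + ivec \<mu>" by (auto simp: pt_def)
  then have "f (pt 0) \<noteq> 0" "h (pt 1) \<noteq> 0" using assms(5,6) by simp_all
  then have "finite {z. f (pt z) = 0}" "finite {z. h (pt z) = 0}"
    using polyfun_finite_integer_zeros[OF assms(1), of "a + ivec \<nu>" 0 "ivec (\<mu> - \<nu>)"]
      polyfun_finite_integer_zeros[OF assms(2), of "a + ivec \<nu>" 1 "ivec (\<mu> - \<nu>)"]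
    by (simp_all add: pt_def)
  then have "finite ({z. f (pt z) = 0} \<union> {z. h (pt z) = 0})" by simp
  then obtain z where z: "z \<notin> {z. f (pt z) = 0} \<union> {z. h (pt z) = 0}"
    using ex_new_if_finite[OF infinite_UNIV_int] by blast
  define \<rho> where "\<rho> = \<nu> + (\<lambda>i. z * (\<mu> - \<nu>) i)"
  have "\<rho> \<in> L" unfolding \<rho>_def using assms(3,4)
    by (intro add_mem scale_mem diff_mem) (auto simp: coset_def)
  moreover have "face \<rho> = c" unfolding \<rho>_def
    using assms(3,4) by (auto simp: coset_def face_def fun_eq_iff split: if_splits)
  moreover have "a + ivec \<rho> = pt z" by (auto simp: pt_def \<rho>_def)
  ultimately show ?thesis using z by (intro bexI[of _ \<rho>]) (auto simp: coset_def)
qed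

text \<open>Zariski density of the orthant in a coset. Along the interior direction the function has finitely
many zeros, while every translate by an element of \<open>\<Theta>\<close> eventually enters the orthant.\<close>

lemma deep_point:
  fixes a :: "nat \<Rightarrow> 'k::field_char_0"
  assumes "f \<in> polyfuns N" "\<nu> \<in> coset c" "f (a + ivec \<nu>) \<noteq> 0"
    and "finite \<Theta>" "\<And>\<tau>. \<tau> \<in> \<Theta> \<Longrightarrow> \<tau> \<in> L \<and> c + face \<tau> \<in> faces"
  shows "\<exists>\<rho>\<in>coset c. f (a + ivec \<rho>) \<noteq> 0 \<and> (\<forall>\<tau>\<in>\<Theta>. \<rho> + \<tau> \<in> orthant)"
proof -
  let ?w = interior_direction
  define pt where "pt z = (\<lambda>i. (a + ivec \<nu>) i + of_int z * of_int (?w i))" for z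
  have "pt 0 = a + ivec \<nu>" by (auto simp: pt_def)
  then have "f (pt 0) \<noteq> 0" using assms(3) by simp
  then have fin: "finite {z. f (pt z) = 0}"
    using polyfun_finite_integer_zeros[OF assms(1), of "a + ivec \<nu>" 0 "ivec ?w"] by (simp add: pt_def)
  have \<nu>: "\<nu> \<in> L" "face \<nu> = c" using assms(2) by (auto simp: coset_def)
  have "\<exists>M. \<forall>\<tau>\<in>\<Theta>. \<forall>m\<ge>M. (\<nu> + \<tau>) + (\<lambda>i. m * ?w i) \<in> orthant"
    using assms(4,5)
  proof (induction \<Theta> rule: finite_induct)
    case empty
    show ?case by simp
  next
    case (insert \<tau> \<Theta>)
    then obtain M where M: "\<forall>\<tau>\<in>\<Theta>. \<forall>m\<ge>M. (\<nu> + \<tau>) + (\<lambda>i. m * ?w i) \<in> orthant" by blast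
    obtain M' where M': "\<forall>m\<ge>M'. (\<nu> + \<tau>) + (\<lambda>i. m * ?w i) \<in> orthant"
      using eventually_orthant[OF add_mem[OF \<nu>(1), of \<tau>]] insert.prems[of \<tau>] \<nu>(2) by (auto simp: face_add)
    show ?case
    proof (intro exI[of _ "max M M'"] ballI allI impI)
      fix \<tau>' m assume "\<tau>' \<in> insert \<tau> \<Theta>" "max M M' \<le> m"
      then show "(\<nu> + \<tau>') + (\<lambda>i. m * ?w i) \<in> orthant"
        using M M' by (cases "\<tau>' = \<tau>") (blast dest: max.boundedE)+
    qed
  qed
  then obtain M where M: "\<forall>\<tau>\<in>\<Theta>. \<forall>m\<ge>M. (\<nu> + \<tau>) + (\<lambda>i. m * ?w i) \<in> orthant" by blast
  define m where "m = Max (insert M {z. f (pt z) = 0}) + 1"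
  have "z < m" if "z \<in> insert M {z. f (pt z) = 0}" for z
    using Max_ge[OF _ that] fin by (simp add: m_def)
  then have m: "m \<in> {M..}" "m \<notin> {z. f (pt z) = 0}" by (auto simp: less_imp_le)
  define \<rho> where "\<rho> = \<nu> + (\<lambda>i. m * ?w i)"
  have "\<rho> \<in> coset c" unfolding \<rho>_def coset_def
    using add_mem[OF \<nu>(1) scale_mem[OF interior_direction(1)]] \<nu>(2)
    by (simp add: face_add face_interior_direction)
  moreover have "a + ivec \<rho> = pt m" by (auto simp: pt_def \<rho>_def)
  moreover have "\<rho> + \<tau> \<in> orthant" if "\<tau> \<in> \<Theta>" for \<tau>
  proof -
    have "\<rho> + \<tau> = (\<nu> + \<tau>) + (\<lambda>i. m * ?w i)" by (simp only: \<rho>_def ac_simps)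
    then show ?thesis using M that m(1) by (metis atLeast_iff)
  qed
  ultimately show ?thesis using m(2) by (intro bexI[of _ \<rho>]) auto
qed

definition box :: "nat \<Rightarrow> (nat \<Rightarrow> int) set"
  where "box k = {\<nu> \<in> L. face \<nu> = 0 \<and> (\<forall>i. \<bar>\<nu> i\<bar> \<le> int k)}"

lemma finite_bounded_lattice: "finite {\<nu> \<in> L. \<forall>i. \<bar>\<nu> i\<bar> \<le> int k}"
  and card_bounded_lattice: "card {\<nu> \<in> L. \<forall>i. \<bar>\<nu> i\<bar> \<le> int k} \<le> (2 * k + 1) ^ n"
proof -
  let ?B = "{\<nu> \<in> L. \<forall>i. \<bar>\<nu> i\<bar> \<le> int k}"
  let ?P = "PiE {..<n} (\<lambda>_. {- int k..int k})"
  have fin: "finite ?P" by (rule finite_PiE) auto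
  have inj: "inj_on (\<lambda>\<nu>. restrict \<nu> {..<n}) ?B"
  proof (rule inj_onI, rule ext)
    fix \<nu> \<mu> i assume *: "\<nu> \<in> ?B" "\<mu> \<in> ?B" "restrict \<nu> {..<n} = restrict \<mu> {..<n}"
    show "\<nu> i = \<mu> i" using fun_cong[OF *(3), of i] supp[of \<nu> i] supp[of \<mu> i] *(1,2)
      by (cases "i < n") auto
  qed
  have sub: "(\<lambda>\<nu>. restrict \<nu> {..<n}) ` ?B \<subseteq> ?P" 
    by (auto simp: abs_le_iff minus_le_iff PiE_iff split: if_splits)
  show "finite ?B" using inj sub fin by (rule inj_on_finite)
  have "card ?B \<le> card ?P" using inj sub fin by (rule card_inj_on_le)
  also have "card ?P = (2 * k + 1) ^ n" 
    by (simp add: card_PiE nat_add_distrib nat_mult_distrib)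
  finally show "card ?B \<le> (2 * k + 1) ^ n" .
qed

lemma finite_box: "finite (box k)"
  by (rule finite_subset[OF _ finite_bounded_lattice[of k]]) (auto simp: box_def)

text \<open>With one orthant point \<open>p c\<close> chosen on each face, a vector \<open>\<tau>\<close> counted on the left is determined by the
face \<open>c = c1 - face \<tau>\<close> and by \<open>\<tau> - (p c1 - p c)\<close>, which lies in a box enlarged by a constant. So the
left side is at most \<open>card faces\<close> times the size of such a box, and the sizes of boxes grow polynomially.\<close>

lemma counting:
  assumes c1: "c1 \<in> faces"
  shows "\<exists>k. card {\<tau> \<in> L. c1 - face \<tau> \<in> faces \<and> (\<forall>i. \<bar>\<tau> i\<bar> \<le> int (k + e))} < Suc (card faces) * card (box k)"
proof -
  have "\<exists>p. \<forall>c\<in>faces. p c \<in> orthant \<and> face (p c) = c" by (rule bchoice) (auto simp: faces_def)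
  then obtain p where p: "\<And>c. c \<in> faces \<Longrightarrow> p c \<in> orthant \<and> face (p c) = c" by blast
  define e' where "e' = (\<Sum>c\<in>faces. \<Sum>i<n. nat \<bar>p c i\<bar>)"
  have pe: "\<bar>p c i\<bar> \<le> int e'" if "c \<in> faces" for c i
  proof (cases "i < n")
    case True
    have "nat \<bar>p c i\<bar> \<le> (\<Sum>i<n. nat \<bar>p c i\<bar>)" by (rule member_le_sum) (use True in auto)
    also have "\<dots> \<le> e'" unfolding e'_def
      by (rule member_le_sum[of c faces "\<lambda>c. \<Sum>i<n. nat \<bar>p c i\<bar>"]) (use that finite_faces in auto)
    finally show ?thesis by simp
  next
    case False
    then show ?thesis using supp[of "p c" i] p[OF that] orthant_L by simp
  qed
  let ?E = "\<lambda>k. {\<tau> \<in> L. c1 - face \<tau> \<in> faces \<and> (\<forall>i. \<bar>\<tau> i\<bar> \<le> int (k + e))}"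
  have E: "card (?E k) \<le> card faces * card (box (k + (e + 2 * e')))" for k
  proof -
    let ?f = "\<lambda>\<tau>. (c1 - face \<tau>, \<tau> - (p c1 - p (c1 - face \<tau>)))"
    have "inj_on ?f (?E k)" by (rule inj_onI) auto
    moreover have "?f ` ?E k \<subseteq> faces \<times> box (k + (e + 2 * e'))"
    proof (rule image_subsetI)
      fix \<tau> assume \<tau>: "\<tau> \<in> ?E k"
      then have c: "c1 - face \<tau> \<in> faces" by blast
      have "\<tau> - (p c1 - p (c1 - face \<tau>)) \<in> L"
        using \<tau> p[OF c] p[OF c1] orthant_L by (intro diff_mem) auto
      moreover have "face (\<tau> - (p c1 - p (c1 - face \<tau>))) = 0"
        using p[OF c] p[OF c1] by (simp add: face_diff)
      moreover have "\<bar>(\<tau> - (p c1 - p (c1 - face \<tau>))) i\<bar> \<le> int (k + (e + 2 * e'))" for i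
      proof -
        have "\<bar>\<tau> i\<bar> \<le> int (k + e)" using \<tau> by blast
        then show ?thesis using pe[OF c, of i] pe[OF c1, of i] by simp
      qed
      ultimately show "?f \<tau> \<in> faces \<times> box (k + (e + 2 * e'))" using c by (simp add: box_def)
    qed
    ultimately have "card (?E k) \<le> card (faces \<times> box (k + (e + 2 * e')))"
      by (rule card_inj_on_le) (simp add: finite_faces finite_box)
    then show ?thesis by (simp add: card_cartesian_product)
  qed
  have "card (box k) \<le> (2 * k + 1) ^ n" for k
  proof -
    have "box k \<subseteq> {\<nu> \<in> L. \<forall>i. \<bar>\<nu> i\<bar> \<le> int k}" by (auto simp: box_def)
    then show ?thesis using card_mono[OF finite_bounded_lattice] card_bounded_lattice[of k] le_trans by blast
  qed
  moreover have "card (box 0) > 0"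
  proof -
    have "0 \<in> box 0" using zero_mem by (simp add: box_def face_zero)
    then show ?thesis using finite_box card_gt_0_iff by blast
  qed
  ultimately obtain k where "card faces * card (box (k + (e + 2 * e'))) < Suc (card faces) * card (box k)"
    using polynomial_growth_ratio[of "\<lambda>k. card (box k)" n] by blast
  then show ?thesis using E[of k] le_less_trans by blast
qed

end

section \<open>The free algebra acting by difference operators\<close>

abbreviation fconst :: "'k::field \<Rightarrow> 'k free_alg"
  where "fconst c \<equiv> Poly_Mapping.single 0 c"

definition word :: "weyl_gen list \<Rightarrow> 'k::field free_alg"
  where "word w = Poly_Mapping.single (Free_Word w) 1"

lemma word_Nil: "word [] = 1"
  by (simp add: word_def single_one[symmetric] zero_free_word_def del: single_one)

lemma word_append: "word (u @ v) = word u * word v"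
  by (simp add: word_def mult_single plus_free_word_def)

lemma word_single: "word [a] = free_gen a"
  by (simp add: word_def free_gen_def)

lemma word_Cons: "word (a # w) = free_gen a * word w"
  using word_append[of "[a]" w] by (simp add: word_single)

lemma fconst_mult_word: "fconst c * word w = Poly_Mapping.single (Free_Word w) c"
  by (simp add: word_def mult_single)

lemma fconst_add: "fconst (c + d) = fconst c + fconst d"
  by (simp add: single_add)

lemma fconst_mult: "fconst (c * d) = fconst c * fconst d"
  by (simp add: mult_single)

lemma fconst_minus: "fconst (- c) = - fconst c"
  by (simp add: single_uminus)

lemma free_alg_expand:
  fixes p :: "'k::field free_alg"
  shows "p = (\<Sum>w\<in>Poly_Mapping.keys p. fconst (Poly_Mapping.lookup p w) * word (letters w))"
proof (rule poly_mapping_eqI)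
  fix u
  have "Poly_Mapping.lookup (\<Sum>w\<in>Poly_Mapping.keys p. Poly_Mapping.single w (Poly_Mapping.lookup p w)) u
      = (\<Sum>w\<in>Poly_Mapping.keys p. if w = u then Poly_Mapping.lookup p w else 0)"
    by (simp add: lookup_sum lookup_single when_def)
  also have "\<dots> = Poly_Mapping.lookup p u"
    by (simp add: in_keys_iff)
  finally show "Poly_Mapping.lookup p u =
      Poly_Mapping.lookup (\<Sum>w\<in>Poly_Mapping.keys p. fconst (Poly_Mapping.lookup p w) * word (letters w)) u"
    by (simp add: fconst_mult_word)
qed

lemma free_alg_induct [case_names zero add single]:
  fixes p :: "'k::field free_alg"
  assumes "P 0" "\<And>p q. P p \<Longrightarrow> P q \<Longrightarrow> P (p + q)"
    and "\<And>c w. Free_Word w \<in> Poly_Mapping.keys p \<Longrightarrow> P (fconst c * word w)"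
  shows "P p"
proof -
  have "P (\<Sum>w\<in>A. fconst (Poly_Mapping.lookup p w) * word (letters w))"
    if "finite A" "A \<subseteq> Poly_Mapping.keys p" for A
    using that
  proof (induction A rule: finite_induct)
    case empty
    then show ?case using assms(1) by simp
  next
    case (insert w A)
    then have "P (fconst (Poly_Mapping.lookup p w) * word (letters w))"
      by (intro assms(3)) (cases w; simp)
    then show ?case using insert assms(2) by simp
  qed
  from this[of "Poly_Mapping.keys p"] show ?thesis by (simp add: free_alg_expand[symmetric])
qed

lemma fconst_commute:
  fixes p :: "'k::field free_alg"
  shows "fconst c * p = p * fconst c"
proof (induction p rule: free_alg_induct)
  case (add p q)
  then show ?case by (simp add: algebra_simps)
next
  case (single d w)
  show ?case by (simp add: fconst_mult_word mult_single mult.commute)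
qed simp

fun gen_deg :: "weyl_gen \<Rightarrow> nat \<Rightarrow> int" where
  "gen_deg (Gen_X i) = (\<lambda>j. if j = i then 1 else 0)"
| "gen_deg (Gen_Xinv i) = (\<lambda>j. if j = i then -1 else 0)"
| "gen_deg (Gen_D i) = (\<lambda>j. if j = i then -1 else 0)"

fun word_deg :: "weyl_gen list \<Rightarrow> nat \<Rightarrow> int" where
  "word_deg [] = 0"
| "word_deg (a # w) = gen_deg a + word_deg w"

lemma word_deg_append: "word_deg (u @ v) = word_deg u + word_deg v"
  by (induction u) (auto simp: add.assoc)

text \<open>The action on formal sums of weight vectors \<open>v\<^sub>\<gamma>\<close>. For \<open>i \<notin> J\<close> it is the one on monomials,
\<open>x\<^sub>i v\<^sub>\<gamma> = v\<^sub>\<gamma>\<^sub>+\<^sub>e\<close> and \<open>\<partial>\<^sub>i v\<^sub>\<gamma> = \<gamma>\<^sub>i v\<^sub>\<gamma>\<^sub>-\<^sub>e\<close> with \<open>e = e\<^sub>i\<close>. For \<open>i \<in> J\<close> it is renormalised to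
\<open>\<partial>\<^sub>i v\<^sub>\<gamma> = v\<^sub>\<gamma>\<^sub>-\<^sub>e\<close> and \<open>x\<^sub>i v\<^sub>\<gamma> = (\<gamma>\<^sub>i + 1) v\<^sub>\<gamma>\<^sub>+\<^sub>e\<close>, so that the weights with \<open>\<gamma>\<^sub>i\<close> a negative integer span a
submodule rather than a quotient. In both cases \<open>\<pi>\<^sub>i v\<^sub>\<gamma> = \<gamma>\<^sub>i v\<^sub>\<gamma>\<close>. The coefficient is written as a function
of the weight that is reached, because operators act here on coefficient functions.\<close>

fun gen_coeff :: "nat set \<Rightarrow> weyl_gen \<Rightarrow> (nat \<Rightarrow> 'k::field) \<Rightarrow> 'k" where
  "gen_coeff J (Gen_X i) \<gamma> = (if i \<in> J then \<gamma> i else 1)"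
| "gen_coeff J (Gen_Xinv i) \<gamma> = 1"
| "gen_coeff J (Gen_D i) \<gamma> = (if i \<in> J then 1 else \<gamma> i + 1)"

fun word_coeff :: "nat set \<Rightarrow> weyl_gen list \<Rightarrow> (nat \<Rightarrow> 'k::field) \<Rightarrow> 'k" where
  "word_coeff J [] \<gamma> = 1"
| "word_coeff J (a # w) \<gamma> = gen_coeff J a \<gamma> * word_coeff J w (\<gamma> - ivec (gen_deg a))"

lemma ivec_zero: "ivec 0 = 0" by auto
lemma ivec_add: "ivec (\<nu> + \<mu>) = ivec \<nu> + ivec \<mu>" by auto
lemma ivec_inject: "(ivec \<nu> :: nat \<Rightarrow> 'k::ring_char_0) = ivec \<mu> \<longleftrightarrow> \<nu> = \<mu>"
  by (auto simp: fun_eq_iff)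

lemma word_coeff_append:
  "word_coeff J (u @ v) \<gamma> = word_coeff J u \<gamma> * word_coeff J v (\<gamma> - ivec (word_deg u))"
  by (induction u arbitrary: \<gamma>) (simp_all add: ivec_zero ivec_add diff_diff_eq mult.assoc
    fun_diff_def zero_fun_def plus_fun_def algebra_simps)

definition diffop :: "nat set \<Rightarrow> 'k::field free_alg \<Rightarrow> ((nat \<Rightarrow> 'k) \<Rightarrow> 'k) \<Rightarrow> (nat \<Rightarrow> 'k) \<Rightarrow> 'k"
  where "diffop J p \<phi> \<gamma> = (\<Sum>w\<in>Poly_Mapping.keys p. Poly_Mapping.lookup p w *
    (word_coeff J (letters w) \<gamma> * \<phi> (\<gamma> - ivec (word_deg (letters w)))))"

lemma diffop_superset:
  assumes "finite A" "Poly_Mapping.keys p \<subseteq> A"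
  shows "diffop J p \<phi> \<gamma> = (\<Sum>w\<in>A. Poly_Mapping.lookup p w *
    (word_coeff J (letters w) \<gamma> * \<phi> (\<gamma> - ivec (word_deg (letters w)))))"
  unfolding diffop_def
  by (rule sum.mono_neutral_left) (use assms in \<open>auto simp: in_keys_iff\<close>)

lemma diffop_add: "diffop J (p + q) \<phi> = (\<lambda>\<gamma>. diffop J p \<phi> \<gamma> + diffop J q \<phi> \<gamma>)"
proof
  fix \<gamma>
  let ?A = "Poly_Mapping.keys p \<union> Poly_Mapping.keys q"
  have "finite ?A" "Poly_Mapping.keys (p + q) \<subseteq> ?A"
    using keys_add[of p q] by auto
  then show "diffop J (p + q) \<phi> \<gamma> = diffop J p \<phi> \<gamma> + diffop J q \<phi> \<gamma>"
    by (simp add: diffop_superset[where A = ?A] sum.distrib[symmetric] lookup_add distrib_right)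
qed

lemma diffop_monomial:
  "diffop J (fconst c * word w) \<phi> = (\<lambda>\<gamma>. c * (word_coeff J w \<gamma> * \<phi> (\<gamma> - ivec (word_deg w))))"
  by (rule ext) (simp add: fconst_mult_word diffop_def)

lemma diffop_zero: "diffop J 0 \<phi> = (\<lambda>_. 0)"
  by (rule ext) (simp add: diffop_def)

lemma diffop_const: "diffop J (fconst c) \<phi> = (\<lambda>\<gamma>. c * \<phi> \<gamma>)"
  using diffop_monomial[of J c "[]" \<phi>] by (simp add: word_Nil fun_diff_def)

lemma diffop_word: "diffop J (word w) \<phi> = (\<lambda>\<gamma>. word_coeff J w \<gamma> * \<phi> (\<gamma> - ivec (word_deg w)))"
  using diffop_monomial[of J 1 w \<phi>] by simp

lemma diffop_one: "diffop J 1 \<phi> = \<phi>"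
  using diffop_const[of J 1 \<phi>] by simp

lemma diffop_gen: "diffop J (free_gen a) \<phi> = (\<lambda>\<gamma>. gen_coeff J a \<gamma> * \<phi> (\<gamma> - ivec (gen_deg a)))"
  using diffop_word[of J "[a]" \<phi>] by (simp add: word_single ivec_add ivec_zero)

lemma diffop_arg_add: "diffop J p (\<lambda>\<gamma>. \<phi> \<gamma> + \<psi> \<gamma>) = (\<lambda>\<gamma>. diffop J p \<phi> \<gamma> + diffop J p \<psi> \<gamma>)"
  by (rule ext) (simp add: diffop_def distrib_left sum.distrib)

lemma diffop_arg_scale: "diffop J p (\<lambda>\<gamma>. c * \<phi> \<gamma>) = (\<lambda>\<gamma>. c * diffop J p \<phi> \<gamma>)"
  by (rule ext) (simp add: diffop_def sum_distrib_left mult.left_commute)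

lemma diffop_arg_zero: "diffop J p (\<lambda>_. 0) = (\<lambda>_. 0)"
  by (rule ext) (simp add: diffop_def)

lemma diffop_mult: "diffop J (p * q) \<phi> = diffop J p (diffop J q \<phi>)"
proof (induction p rule: free_alg_induct)
  case zero
  show ?case by (simp add: diffop_zero)
next
  case (add p p')
  then show ?case by (simp add: distrib_right diffop_add)
next
  case (single c u)
  show ?case
  proof (induction q rule: free_alg_induct)
    case zero
    show ?case by (simp add: diffop_zero diffop_arg_zero)
  next
    case (add q q')
    then show ?case by (simp add: distrib_left diffop_add diffop_arg_add)
  next
    case (single d v)
    have "fconst c * word u * (fconst d * word v) = fconst (c * d) * word (u @ v)"
      by (simp add: fconst_mult_word mult_single plus_free_word_def)
    then show ?case
      by (simp add: diffop_monomial word_coeff_append word_deg_append ivec_add diff_diff_eq mult_ac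
          fun_diff_def plus_fun_def algebra_simps)
  qed
qed

lemma diffop_minus: "diffop J (- p) \<phi> = (\<lambda>\<gamma>. - diffop J p \<phi> \<gamma>)"
proof
  fix \<gamma>
  have "diffop J (p + - p) \<phi> \<gamma> = 0" by (simp add: diffop_zero)
  then show "diffop J (- p) \<phi> \<gamma> = - diffop J p \<phi> \<gamma>"
    by (simp only: diffop_add add_eq_0_iff)
qed

lemma diffop_diff: "diffop J (p - q) \<phi> = (\<lambda>\<gamma>. diffop J p \<phi> \<gamma> - diffop J q \<phi> \<gamma>)"
  using diffop_add[of J p "- q" \<phi>] by (simp add: diffop_minus)

lemma diffop_sum: "diffop J (\<Sum>x\<in>A. f x) \<phi> = (\<lambda>\<gamma>. \<Sum>x\<in>A. diffop J (f x) \<phi> \<gamma>)"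
  by (induction A rule: infinite_finite_induct) (simp_all add: diffop_add diffop_zero)

definition degs :: "'k::field free_alg \<Rightarrow> (nat \<Rightarrow> int) set"
  where "degs p = (\<lambda>w. word_deg (letters w)) ` Poly_Mapping.keys p"

text \<open>The polynomial by which the part of degree \<open>\<nu>\<close> of \<open>p\<close> multiplies.\<close>

definition component :: "nat set \<Rightarrow> 'k::field free_alg \<Rightarrow> (nat \<Rightarrow> int) \<Rightarrow> (nat \<Rightarrow> 'k) \<Rightarrow> 'k"
  where "component J p \<nu> \<gamma> = (\<Sum>w | w \<in> Poly_Mapping.keys p \<and> word_deg (letters w) = \<nu>.
    Poly_Mapping.lookup p w * word_coeff J (letters w) \<gamma>)"

lemma finite_degs: "finite (degs p)" by (simp add: degs_def)

lemma component_outside: "\<nu> \<notin> degs p \<Longrightarrow> component J p \<nu> \<gamma> = 0"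
  unfolding component_def degs_def by (rule sum.neutral) auto

lemma diffop_component:
  "diffop J p \<phi> \<gamma> = (\<Sum>\<nu>\<in>degs p. component J p \<nu> \<gamma> * \<phi> (\<gamma> - ivec \<nu>))"
proof -
  have "diffop J p \<phi> \<gamma> = (\<Sum>\<nu>\<in>degs p. \<Sum>w | w \<in> Poly_Mapping.keys p \<and> word_deg (letters w) = \<nu>.
     Poly_Mapping.lookup p w * (word_coeff J (letters w) \<gamma> * \<phi> (\<gamma> - ivec (word_deg (letters w)))))"
    unfolding diffop_def degs_def by (rule sum.image_gen) simp
  also have "\<dots> = (\<Sum>\<nu>\<in>degs p. component J p \<nu> \<gamma> * \<phi> (\<gamma> - ivec \<nu>))"
    unfolding component_def sum_distrib_right by (intro sum.cong) auto
  finally show ?thesis .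
qed

definition delta :: "(nat \<Rightarrow> 'k::field) \<Rightarrow> (nat \<Rightarrow> 'k) \<Rightarrow> 'k"
  where "delta y \<gamma> = (if \<gamma> = y then 1 else 0)"

text \<open>Components are the matrix entries of the operator.\<close>

lemma diffop_delta:
  fixes p :: "'k::field_char_0 free_alg"
  shows "diffop J p (delta (\<gamma> - ivec \<nu>)) \<gamma> = component J p \<nu> \<gamma>"
proof -
  have "diffop J p (delta (\<gamma> - ivec \<nu>)) \<gamma> = (\<Sum>\<mu>\<in>degs p. if \<mu> = \<nu> then component J p \<nu> \<gamma> else 0)"
    unfolding diffop_component
  proof (rule sum.cong[OF refl])
    fix \<mu>
    have "\<gamma> - ivec \<mu> = \<gamma> - ivec \<nu> \<longleftrightarrow> \<mu> = \<nu>"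
      using ivec_inject[of \<mu> \<nu>, where 'k = 'k] by (metis diff_left_imp_eq)
    then show "component J p \<mu> \<gamma> * delta (\<gamma> - ivec \<nu>) (\<gamma> - ivec \<mu>) =
        (if \<mu> = \<nu> then component J p \<nu> \<gamma> else 0)"
      by (simp add: delta_def)
  qed
  then show ?thesis by (simp add: finite_degs component_outside)
qed

lemma component_mult:
  fixes p :: "'k::field_char_0 free_alg"
  shows "component J (p * q) \<tau> \<gamma> = (\<Sum>\<nu>\<in>degs p. component J p \<nu> \<gamma> * component J q (\<tau> - \<nu>) (\<gamma> - ivec \<nu>))"
proof -
  have eq: "\<gamma> - ivec \<tau> = (\<gamma> - ivec \<nu>) - ivec (\<tau> - \<nu>)" for \<nu> by auto
  have "component J (p * q) \<tau> \<gamma> = diffop J p (diffop J q (delta (\<gamma> - ivec \<tau>))) \<gamma>"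
    by (simp only: diffop_delta[symmetric] diffop_mult)
  also have "\<dots> = (\<Sum>\<nu>\<in>degs p. component J p \<nu> \<gamma> * component J q (\<tau> - \<nu>) (\<gamma> - ivec \<nu>))"
    unfolding diffop_component[of J p]
  proof (rule sum.cong[OF refl])
    fix \<nu>
    show "component J p \<nu> \<gamma> * diffop J q (delta (\<gamma> - ivec \<tau>)) (\<gamma> - ivec \<nu>) =
        component J p \<nu> \<gamma> * component J q (\<tau> - \<nu>) (\<gamma> - ivec \<nu>)"
      unfolding eq[of \<nu>] diffop_delta ..
  qed
  finally show ?thesis .
qed

lemma gen_index_cases:
  assumes "a \<in> weyl_gens r s"
  obtains i where "i < r + s" "a = Gen_X i" | i where "r \<le> i" "i < r + s" "a = Gen_Xinv i"
    | i where "i < r + s" "a = Gen_D i"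
  using assms by (auto simp: weyl_gens_def)

lemma gen_coeff_polyfun:
  "a \<in> weyl_gens r s \<Longrightarrow> (gen_coeff J a :: (nat \<Rightarrow> 'k::field) \<Rightarrow> 'k) \<in> polyfuns (r + s)"
proof (erule gen_index_cases)
  fix i assume i: "i < r + s"
  have "(\<lambda>\<gamma>. gen_coeff J (Gen_X i) \<gamma>) \<in> polyfuns (r + s)"
    using i by (cases "i \<in> J") (auto intro: polyfuns.intros)
  then show "a = Gen_X i \<Longrightarrow> gen_coeff J a \<in> polyfuns (r + s)" by metis
  have "(\<lambda>\<gamma>. gen_coeff J (Gen_D i) \<gamma>) \<in> polyfuns (r + s)"
    using i by (cases "i \<in> J") (auto intro: polyfuns.intros)
  then show "a = Gen_D i \<Longrightarrow> gen_coeff J a \<in> polyfuns (r + s)" by metis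
next
  fix i assume "a = Gen_Xinv i"
  moreover have "(\<lambda>\<gamma>. gen_coeff J (Gen_Xinv i) \<gamma>) \<in> polyfuns (r + s)" by (auto intro: polyfuns.intros)
  ultimately show "gen_coeff J a \<in> polyfuns (r + s)" by metis
qed

lemma word_coeff_polyfun:
  "set w \<subseteq> weyl_gens r s \<Longrightarrow> word_coeff J w \<in> polyfuns (r + s)"
proof (induction w)
  case Nil
  have "word_coeff J [] = (\<lambda>_. 1)" by auto
  then show ?case by (simp add: polyfuns.const)
next
  case (Cons a w)
  have "word_coeff J (a # w) = (\<lambda>\<gamma>. gen_coeff J a \<gamma> * word_coeff J w (\<gamma> - ivec (gen_deg a)))" by auto
  then show ?case using Cons gen_coeff_polyfun[of a r s J]
    by (auto intro!: polyfuns.mult polyfuns_shift)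
qed

lemma word_deg_supp: "set w \<subseteq> weyl_gens r s \<Longrightarrow> i \<ge> r + s \<Longrightarrow> word_deg w i = 0"
proof (induction w)
  case (Cons a w)
  from Cons.prems(1) have "a \<in> weyl_gens r s" by simp
  then show ?case using Cons by (cases rule: gen_index_cases) auto
qed simp

section \<open>The Weyl algebra as a quotient of the free algebra\<close>

lemma carrier_Quot: "carrier (R Quot I) = (\<lambda>x. I +>\<^bsub>R\<^esub> x) ` carrier R"
  by (auto simp: FactRing_simps)

lemma zero_Quot: "\<zero>\<^bsub>R Quot I\<^esub> = I"
  by (simp add: FactRing_def)

context
  fixes r s :: nat
begin

abbreviation (input) FF :: "'k::field free_alg set" where "FF \<equiv> carrier (free_ring r s)"

lemma free_ring_simps:
  "monoid.mult (free_ring r s) = (*)" "one (free_ring r s) = 1"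
  "zero (free_ring r s) = 0" "add (free_ring r s) = (+)"
  by (simp_all add: free_ring_def)

lemma FF_iff: "p \<in> FF \<longleftrightarrow> (\<forall>w \<in> Poly_Mapping.keys p. set (letters w) \<subseteq> weyl_gens r s)"
  by (simp add: free_ring_def)

lemma FF_add: "p \<in> FF \<Longrightarrow> q \<in> FF \<Longrightarrow> p + q \<in> FF"
  using keys_add[of p q] by (auto simp: FF_iff)

lemma FF_mult: "p \<in> FF \<Longrightarrow> q \<in> FF \<Longrightarrow> p * q \<in> FF"
  using keys_mult[of p q] by (fastforce simp: FF_iff plus_free_word_def)

lemma FF_minus: "p \<in> FF \<Longrightarrow> - p \<in> FF"
  by (simp add: FF_iff in_keys_iff)

lemma FF_diff: "p \<in> FF \<Longrightarrow> q \<in> FF \<Longrightarrow> p - q \<in> FF"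
  using FF_add[of p "- q"] FF_minus[of q] by simp

lemma FF_word: "set w \<subseteq> weyl_gens r s \<Longrightarrow> word w \<in> FF"
  by (simp add: FF_iff word_def)

lemma FF_const: "fconst c \<in> FF"
  by (simp add: FF_iff zero_free_word_def)

lemma FF_zero: "0 \<in> FF" by (simp add: FF_iff)

lemma FF_one: "1 \<in> FF" using FF_word[of "[]"] by (simp add: word_Nil)

lemma FF_gen: "a \<in> weyl_gens r s \<Longrightarrow> free_gen a \<in> FF"
  using FF_word[of "[a]"] by (simp add: word_single)

lemma FF_x: "i < r + s \<Longrightarrow> free_x i \<in> FF" and FF_d: "i < r + s \<Longrightarrow> free_d i \<in> FF"
  and FF_xinv: "r \<le> i \<Longrightarrow> i < r + s \<Longrightarrow> free_xinv i \<in> FF"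
  by (auto intro!: FF_gen simp: weyl_gens_def)

lemma FF_sum: "(\<And>x. x \<in> A \<Longrightarrow> f x \<in> FF) \<Longrightarrow> (\<Sum>x\<in>A. f x) \<in> FF"
  by (induction A rule: infinite_finite_induct) (auto intro: FF_add FF_zero)

lemmas FF_intros = FF_add FF_mult FF_minus FF_diff FF_word FF_const FF_zero FF_one FF_x FF_d FF_xinv FF_sum

lemma ring_free: "ring (free_ring r s :: 'k::field free_alg ring)"
proof (rule ringI)
  show "abelian_group (free_ring r s :: 'k free_alg ring)"
  proof (rule abelian_groupI)
    fix x :: "'k free_alg" assume "x \<in> carrier (free_ring r s)"
    then show "\<exists>y\<in>carrier (free_ring r s). y \<oplus>\<^bsub>free_ring r s\<^esub> x = \<zero>\<^bsub>free_ring r s\<^esub>"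
      by (intro bexI[of _ "- x"]) (auto simp: free_ring_simps intro: FF_minus)
  qed (auto simp: free_ring_simps algebra_simps intro: FF_intros)
  show "Group.monoid (free_ring r s :: 'k free_alg ring)"
    by (rule monoidI) (auto simp: free_ring_simps algebra_simps intro: FF_intros)
qed (auto simp: free_ring_simps algebra_simps)

interpretation free: ring "free_ring r s :: 'k::field free_alg ring" by (rule ring_free)

lemma free_a_inv: "p \<in> FF \<Longrightarrow> \<ominus>\<^bsub>free_ring r s\<^esub> p = - p"
  by (rule free.minus_equality) (auto simp: free_ring_simps intro: FF_minus)

lemma free_a_minus: "q \<in> FF \<Longrightarrow> p \<ominus>\<^bsub>free_ring r s\<^esub> q = p - q"
  by (simp add: a_minus_def free_a_inv free_ring_simps)

lemma relations_FF: "weyl_relations r s \<subseteq> FF"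
  unfolding weyl_relations_def by (auto intro!: FF_intros)

abbreviation (input) WI :: "'k::field free_alg set" where "WI \<equiv> weyl_ideal r s"

lemma ideal_WI: "ideal WI (free_ring r s)"
  unfolding weyl_ideal_def by (rule free.genideal_ideal[OF relations_FF])

interpretation WI: ideal "weyl_ideal r s :: 'k::field free_alg set" "free_ring r s" by (rule ideal_WI)

lemma WI_FF: "p \<in> WI \<Longrightarrow> p \<in> FF" by (rule WI.Icarr)
lemma WI_zero: "0 \<in> WI" using WI.zero_closed by (simp add: free_ring_simps)
lemma WI_add: "p \<in> WI \<Longrightarrow> q \<in> WI \<Longrightarrow> p + q \<in> WI"
  using WI.a_closed by (simp add: free_ring_simps)
lemma WI_minus: "p \<in> WI \<Longrightarrow> - p \<in> WI"
  using WI.a_inv_closed[of p] by (simp add: free_a_inv WI_FF)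
lemma WI_diff: "p \<in> WI \<Longrightarrow> q \<in> WI \<Longrightarrow> p - q \<in> WI"
  using WI_add[of p "- q"] WI_minus[of q] by simp
lemma WI_lmult: "p \<in> WI \<Longrightarrow> q \<in> FF \<Longrightarrow> q * p \<in> WI"
  using WI.I_l_closed by (simp add: free_ring_simps)
lemma WI_rmult: "p \<in> WI \<Longrightarrow> q \<in> FF \<Longrightarrow> p * q \<in> WI"
  using WI.I_r_closed by (simp add: free_ring_simps)

lemma relation_WI: "p \<in> weyl_relations r s \<Longrightarrow> p \<in> WI"
  unfolding weyl_ideal_def using free.genideal_self[OF relations_FF] by blast

text \<open>Working modulo the relations inside the free algebra keeps the operations of a type class
available for calculations.\<close>

definition weq :: "'k::field free_alg \<Rightarrow> 'k free_alg \<Rightarrow> bool"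
  where "weq p q \<longleftrightarrow> p - q \<in> WI"

lemma weq_refl: "weq p p" by (simp add: weq_def WI_zero)
lemma weq_sym: "weq p q \<Longrightarrow> weq q p" using WI_minus[of "p - q"] by (simp add: weq_def)
lemma weq_trans [trans]: "weq p q \<Longrightarrow> weq q t \<Longrightarrow> weq p t"
  using WI_add[of "p - q" "q - t"] by (simp add: weq_def)
lemma weq_add: "weq p q \<Longrightarrow> weq p' q' \<Longrightarrow> weq (p + p') (q + q')"
  using WI_add[of "p - q" "p' - q'"] by (simp add: weq_def algebra_simps)
lemma weq_diff: "weq p q \<Longrightarrow> weq p' q' \<Longrightarrow> weq (p - p') (q - q')"
  using WI_diff[of "p - q" "p' - q'"] by (simp add: weq_def algebra_simps)
lemma weq_lmult: "weq p q \<Longrightarrow> t \<in> FF \<Longrightarrow> weq (t * p) (t * q)"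
  using WI_lmult[of "p - q" t] by (simp add: weq_def algebra_simps)
lemma weq_rmult: "weq p q \<Longrightarrow> t \<in> FF \<Longrightarrow> weq (p * t) (q * t)"
  using WI_rmult[of "p - q" t] by (simp add: weq_def algebra_simps)
lemma weq_mult: "weq p q \<Longrightarrow> weq p' q' \<Longrightarrow> q \<in> FF \<Longrightarrow> p' \<in> FF \<Longrightarrow> weq (p * p') (q * q')"
  using weq_trans[OF weq_rmult weq_lmult] by blast
lemma weq_sum: "(\<And>x. x \<in> A \<Longrightarrow> weq (f x) (h x)) \<Longrightarrow> weq (\<Sum>x\<in>A. f x) (\<Sum>x\<in>A. h x)"
  by (induction A rule: infinite_finite_induct) (auto intro: weq_add weq_refl)
lemma weq_zero: "weq p 0 \<longleftrightarrow> p \<in> WI" by (simp add: weq_def)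

lemma ring_weyl: "ring (weyl r s :: 'k::field weyl ring)"
  unfolding weyl_def by (rule WI.quotient_is_ring)

lemma class_hom: "weyl_class r s \<in> ring_hom (free_ring r s) (weyl r s :: 'k::field weyl ring)"
  using WI.rcos_ring_hom unfolding weyl_class_def weyl_def by simp

lemma class_closed: "p \<in> FF \<Longrightarrow> weyl_class r s p \<in> carrier (weyl r s)"
  using ring_hom_closed[OF class_hom] by blast

lemma class_surj: "a \<in> carrier (weyl r s) \<Longrightarrow> \<exists>p\<in>FF. a = weyl_class r s p"
  by (auto simp: weyl_def carrier_Quot weyl_class_def)

lemma class_add: "p \<in> FF \<Longrightarrow> q \<in> FF \<Longrightarrow>
    weyl_class r s (p + q) = weyl_class r s p \<oplus>\<^bsub>weyl r s\<^esub> weyl_class r s q"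
  using ring_hom_add[OF class_hom] by (simp add: free_ring_simps)

lemma class_mult: "p \<in> FF \<Longrightarrow> q \<in> FF \<Longrightarrow>
    weyl_class r s (p * q) = weyl_class r s p \<otimes>\<^bsub>weyl r s\<^esub> weyl_class r s q"
  using ring_hom_mult[OF class_hom] by (simp add: free_ring_simps)

lemma class_one: "weyl_class r s 1 = \<one>\<^bsub>weyl r s\<^esub>"
  using ring_hom_one[OF class_hom] by (simp add: free_ring_simps)

lemma class_eq_iff: "p \<in> FF \<Longrightarrow> q \<in> FF \<Longrightarrow> weyl_class r s p = weyl_class r s q \<longleftrightarrow> weq p q"
  using free.quotient_eq_iff_same_a_r_cos[OF ideal_WI, of p q] by (simp add: weyl_class_def weq_def free_a_minus)

lemma class_zero: "weyl_class r s 0 = \<zero>\<^bsub>weyl r s\<^esub>"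
  using free.a_rcos_zero[OF ideal_WI WI.zero_closed]
  by (simp add: weyl_class_def weyl_def zero_Quot free_ring_simps)

lemma class_zero_iff: "p \<in> FF \<Longrightarrow> weyl_class r s p = \<zero>\<^bsub>weyl r s\<^esub> \<longleftrightarrow> p \<in> WI"
  using class_eq_iff[of p 0] FF_zero by (simp add: class_zero weq_zero)

lemma class_minus:
  fixes p :: "'k::field free_alg"
  assumes p: "p \<in> FF"
  shows "weyl_class r s (- p) = \<ominus>\<^bsub>weyl r s\<^esub> weyl_class r s p"
proof -
  interpret W: ring "weyl r s :: 'k::field weyl ring" by (rule ring_weyl)
  have "weyl_class r s (- p) \<oplus>\<^bsub>weyl r s\<^esub> weyl_class r s p = \<zero>\<^bsub>weyl r s\<^esub>"
    using class_add[of "- p" p] p FF_minus[OF p] by (simp add: class_zero)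
  then show ?thesis using p FF_minus[OF p] class_closed W.minus_equality[symmetric] by blast
qed

lemma class_diff: "p \<in> FF \<Longrightarrow> q \<in> FF \<Longrightarrow>
    weyl_class r s (p - q) = weyl_class r s p \<ominus>\<^bsub>weyl r s\<^esub> weyl_class r s q"
  using class_add[of p "- q"] FF_minus[of q] class_minus[of q] by (simp add: a_minus_def)

section \<open>Commutation rules\<close>

lemma rel_xx: "i < r + s \<Longrightarrow> j < r + s \<Longrightarrow> weq (free_x i * free_x j) (free_x j * free_x i)"
  unfolding weq_def by (rule relation_WI, unfold weyl_relations_def, blast)
lemma rel_dd: "i < r + s \<Longrightarrow> j < r + s \<Longrightarrow> weq (free_d i * free_d j) (free_d j * free_d i)"
  unfolding weq_def by (rule relation_WI, unfold weyl_relations_def, blast)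
lemma rel_dx: "i < r + s \<Longrightarrow> j < r + s \<Longrightarrow>
    weq (free_d i * free_x j) (free_x j * free_d i + (if i = j then 1 else 0))"
  unfolding weq_def diff_diff_eq[symmetric] by (rule relation_WI, unfold weyl_relations_def, blast)
lemma rel_xxinv: "r \<le> i \<Longrightarrow> i < r + s \<Longrightarrow> weq (free_x i * free_xinv i) 1"
  unfolding weq_def by (rule relation_WI, unfold weyl_relations_def, blast)
lemma rel_xinvx: "r \<le> i \<Longrightarrow> i < r + s \<Longrightarrow> weq (free_xinv i * free_x i) 1"
  unfolding weq_def by (rule relation_WI, unfold weyl_relations_def, blast)

definition weq_commute :: "'k::field free_alg \<Rightarrow> 'k free_alg \<Rightarrow> bool"
  where "weq_commute p q \<longleftrightarrow> weq (p * q) (q * p)"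

lemma weq_commute_sym: "weq_commute p q \<Longrightarrow> weq_commute q p"
  by (simp add: weq_commute_def weq_sym)

text \<open>Insert \<open>x\<^sub>i x\<^sub>i\<^sup>-\<^sup>1\<close> on the right and move \<open>u\<close> past \<open>x\<^sub>i\<close>.\<close>

lemma weq_commute_xinv:
  assumes "weq_commute (free_x i) u" "u \<in> FF" "r \<le> i" "i < r + s"
  shows "weq_commute (free_xinv i) u"
proof -
  note FF = FF_x[OF assms(4)] FF_xinv[OF assms(3,4)] assms(2)
  have "weq (free_xinv i * u) (free_xinv i * u * (free_x i * free_xinv i))"
    using weq_lmult[OF weq_sym[OF rel_xxinv[OF assms(3,4)]], of "free_xinv i * u"] FF
    by (auto intro: FF_mult)
  also have "free_xinv i * u * (free_x i * free_xinv i) = free_xinv i * (u * free_x i) * free_xinv i"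
    by (simp add: mult.assoc)
  also have "weq (free_xinv i * (u * free_x i) * free_xinv i) (free_xinv i * (free_x i * u) * free_xinv i)"
    using assms(1) FF by (intro weq_rmult weq_lmult) (auto simp: weq_commute_def weq_sym)
  also have "free_xinv i * (free_x i * u) * free_xinv i = (free_xinv i * free_x i) * (u * free_xinv i)"
    by (simp add: mult.assoc)
  also have "weq ((free_xinv i * free_x i) * (u * free_xinv i)) (1 * (u * free_xinv i))"
    using FF by (intro weq_rmult rel_xinvx assms FF_mult)
  finally show ?thesis by (simp add: weq_commute_def)
qed

fun gen_index :: "weyl_gen \<Rightarrow> nat" where
  "gen_index (Gen_X i) = i" | "gen_index (Gen_Xinv i) = i" | "gen_index (Gen_D i) = i"

lemma gens_commute:
  assumes "a \<in> weyl_gens r s" "b \<in> weyl_gens r s" "gen_index a \<noteq> gen_index b"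
  shows "weq_commute (free_gen a :: 'k::field free_alg) (free_gen b)"
proof -
  have xx: "weq_commute (free_x i :: 'k free_alg) (free_x j)" if "i < r + s" "j < r + s" for i j
    using rel_xx that by (simp add: weq_commute_def)
  have dd: "weq_commute (free_d i :: 'k free_alg) (free_d j)" if "i < r + s" "j < r + s" for i j
    using rel_dd that by (simp add: weq_commute_def)
  have dx: "weq_commute (free_d i :: 'k free_alg) (free_x j)" if "i < r + s" "j < r + s" "i \<noteq> j" for i j
    using rel_dx[of i j] that by (simp add: weq_commute_def)
  note xd = weq_commute_sym[OF dx]
  have xg: "weq_commute (free_x i :: 'k free_alg) (free_gen b)"
    if i: "i < r + s" and b: "b \<in> weyl_gens r s" "i \<noteq> gen_index b" for i b
    using b(1)
  proof (cases rule: gen_index_cases)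
    case (2 j)
    then show ?thesis
      using weq_commute_sym[OF weq_commute_xinv[OF xx FF_x]] i by simp
  qed (use i b in \<open>auto intro: xx xd\<close>)
  have ig: "weq_commute (free_xinv i :: 'k free_alg) (free_gen b)"
    if i: "r \<le> i" "i < r + s" and b: "b \<in> weyl_gens r s" "i \<noteq> gen_index b" for i b
    by (rule weq_commute_xinv) (use i b in \<open>auto intro: xg FF_gen\<close>)
  show ?thesis using assms(1)
  proof (cases rule: gen_index_cases)
    case (1 i)
    then show ?thesis using assms xg[of i b] by simp
  next
    case (2 i)
    then show ?thesis using assms ig[of i b] by simp
  next
    case (3 i)
    from assms(2) show ?thesis
    proof (cases rule: gen_index_cases)
      case (1 j)
      then show ?thesis using 3 assms dx by simp
    next
      case (2 j)
      then show ?thesis using 3 assms ig[of j a] weq_commute_sym by simp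
    next
      case (3 j)
      then show ?thesis using \<open>a = Gen_D i\<close> \<open>i < r + s\<close> dd by simp
    qed
  qed
qed

lemma weq_commute_word:
  assumes "set w \<subseteq> weyl_gens r s" "u \<in> FF" "\<And>b. b \<in> set w \<Longrightarrow> weq_commute u (free_gen b)"
  shows "weq_commute u (word w)"
  using assms
proof (induction w)
  case Nil
  show ?case by (simp add: weq_commute_def word_Nil weq_refl)
next
  case (Cons b w)
  have FF: "free_gen b \<in> FF" "word w \<in> FF" using Cons.prems by (auto intro: FF_gen FF_word)
  have "u * word (b # w) = (u * free_gen b) * word w" by (simp add: word_Cons mult.assoc)
  also have "weq ((u * free_gen b) * word w) ((free_gen b * u) * word w)"
    using Cons.prems FF by (intro weq_rmult) (auto simp: weq_commute_def)
  also have "(free_gen b * u) * word w = free_gen b * (u * word w)" by (simp add: mult.assoc)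
  also have "weq (free_gen b * (u * word w)) (free_gen b * (word w * u))"
    using Cons FF by (intro weq_lmult) (auto simp: weq_commute_def)
  finally show ?case by (simp add: weq_commute_def word_Cons mult.assoc)
qed

definition euler :: "nat \<Rightarrow> 'k::field free_alg"
  where "euler i = free_x i * free_d i"

lemma FF_euler: "i < r + s \<Longrightarrow> euler i \<in> FF"
  by (simp add: euler_def FF_intros)

lemma euler_gen:
  assumes i: "i < r + s" and a: "a \<in> weyl_gens r s"
  shows "weq (euler i * free_gen a) (free_gen a * (euler i + fconst (of_int (gen_deg a i))) :: 'k::field free_alg)"
proof -
  have x: "weq (euler i * free_x j) (free_x j * euler i + (if i = j then free_x j else 0) :: 'k free_alg)"
    if j: "j < r + s" for j
  proof -
    have "euler i * free_x j = free_x i * (free_d i * free_x j)" by (simp add: euler_def mult.assoc)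
    also have "weq \<dots> (free_x i * (free_x j * free_d i + (if i = j then 1 else 0)))"
      by (intro weq_lmult rel_dx i j FF_x)
    also have "\<dots> = (free_x i * free_x j) * free_d i + (if i = j then free_x j else 0)"
      by (auto simp: algebra_simps)
    also have "weq \<dots> ((free_x j * free_x i) * free_d i + (if i = j then free_x j else 0))"
      by (intro weq_add weq_refl weq_rmult rel_xx i j FF_d)
    finally show ?thesis by (simp add: euler_def mult.assoc)
  qed
  show ?thesis using a
  proof (cases rule: gen_index_cases)
    case (1 j)
    then show ?thesis using x[of j] by (auto simp: algebra_simps)
  next
    case (3 j)
    have "weq (euler i * free_d j) (free_x i * (free_d j * free_d i) :: 'k free_alg)"
      unfolding euler_def mult.assoc by (intro weq_lmult rel_dd i 3 FF_x)
    also have "free_x i * (free_d j * free_d i) = (free_x i * free_d j) * (free_d i :: 'k free_alg)"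
      by (simp add: mult.assoc)
    also have "weq \<dots> ((free_d j * free_x i - (if j = i then 1 else 0)) * free_d i)"
    proof (intro weq_rmult FF_d i)
      show "weq (free_x i * free_d j) (free_d j * free_x i - (if j = i then 1 else 0) :: 'k free_alg)"
        using weq_diff[OF weq_sym[OF rel_dx[of j i]] weq_refl[of "if j = i then 1 else 0 :: 'k free_alg"]] i 3
        by auto
    qed
    finally show ?thesis using 3 by (auto simp: algebra_simps euler_def fconst_minus)
  next
    case (2 j)
    note FF = FF_x[OF 2(2)] FF_xinv[OF 2(1,2)] FF_euler[OF i]
    let ?d = "if i = j then 1 else 0 :: 'k free_alg"
    have xe: "weq (free_x j * euler i) ((euler i - ?d) * free_x j)"
      using weq_diff[OF weq_sym[OF x[OF 2(2)]] weq_refl[of "if i = j then free_x j else 0 :: 'k free_alg"]]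
      by (auto simp: algebra_simps)
    have dF: "?d \<in> FF" by (simp add: FF_intros)
    have "weq (euler i * free_xinv j) ((free_xinv j * free_x j) * (euler i * free_xinv j) :: 'k free_alg)"
      using weq_rmult[OF weq_sym[OF rel_xinvx[OF 2(1,2)]], of "euler i * free_xinv j :: 'k free_alg"]
        FF_mult[OF FF_euler[OF i] FF_xinv[OF 2(1,2)]] by simp
    also have "(free_xinv j * free_x j) * (euler i * free_xinv j) =
        free_xinv j * (free_x j * euler i) * (free_xinv j :: 'k free_alg)"
      by (simp add: mult.assoc)
    also have "weq \<dots> (free_xinv j * ((euler i - ?d) * free_x j) * free_xinv j)"
      by (intro weq_rmult weq_lmult xe FF)
    also have "\<dots> = (free_xinv j * (euler i - ?d)) * (free_x j * free_xinv j)" by (simp add: mult.assoc)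
    also have "weq \<dots> ((free_xinv j * (euler i - ?d)) * 1)"
      by (intro weq_lmult rel_xxinv 2 FF_mult FF FF_diff dF)
    finally show ?thesis using 2 by (auto simp: algebra_simps fconst_minus)
  qed
qed

text \<open>A word is an eigenvector of the commutator with each \<open>\<pi>\<^sub>i\<close>, with eigenvalue its degree.\<close>

lemma euler_word:
  assumes i: "i < r + s" and w: "set w \<subseteq> weyl_gens r s"
  shows "weq (euler i * word w) (word w * (euler i + fconst (of_int (word_deg w i))) :: 'k::field free_alg)"
  using w
proof (induction w)
  case Nil
  show ?case by (simp add: word_Nil weq_refl)
next
  case (Cons a w)
  have FF: "(free_gen a :: 'k free_alg) \<in> FF" "(word w :: 'k free_alg) \<in> FF"
    using Cons.prems by (auto intro: FF_gen FF_word)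
  let ?c = "fconst (of_int (gen_deg a i)) :: 'k free_alg"
  have "euler i * word (a # w) = (euler i * free_gen a) * (word w :: 'k free_alg)"
    by (simp add: word_Cons mult.assoc)
  also have "weq \<dots> ((free_gen a * (euler i + ?c)) * word w)"
    using Cons.prems FF by (intro weq_rmult euler_gen i) auto
  also have "\<dots> = free_gen a * (euler i * word w + ?c * word w)" by (simp add: algebra_simps)
  also have "weq \<dots> (free_gen a * (word w * (euler i + fconst (of_int (word_deg w i))) + ?c * word w))"
    using Cons FF by (intro weq_lmult weq_add weq_refl) auto
  also have "\<dots> = word (a # w) * (euler i + fconst (of_int (word_deg (a # w) i)))"
    by (simp add: word_Cons algebra_simps fconst_add mult_of_int_commute)
  finally show ?case .
qed

end

context
  fixes r s :: nat
begin

interpretation free: ring "free_ring r s :: 'k::field free_alg ring" by (rule ring_free)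
interpretation WI: ideal "weyl_ideal r s :: 'k::field free_alg set" "free_ring r s" by (rule ideal_WI)
interpretation W: ring "weyl r s :: 'k::field weyl ring" by (rule ring_weyl)

section \<open>The difference operators respect the relations\<close>

text \<open>The inverse generators have coefficient \<open>1\<close> and are inverse to \<open>x\<^sub>i\<close> only for \<open>i \<notin> J\<close>, whence the condition
on \<open>J\<close>.\<close>

lemma diffop_relation:
  fixes p :: "'k::field_char_0 free_alg"
  assumes J: "J \<subseteq> {..<r}" and p: "p \<in> weyl_relations r s"
  shows "diffop J p \<phi> = (\<lambda>_. 0)"
proof
  fix \<gamma> :: "nat \<Rightarrow> 'k"
  have comm: "\<gamma> - u - v = \<gamma> - v - u" for u v :: "nat \<Rightarrow> 'k" by (auto simp: fun_eq_iff)
  have cancel: "\<gamma> - ivec (gen_deg (Gen_D i)) - ivec (gen_deg (Gen_X i)) = \<gamma>"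
    "\<gamma> - ivec (gen_deg (Gen_X i)) - ivec (gen_deg (Gen_D i)) = \<gamma>"
    "\<gamma> - ivec (gen_deg (Gen_Xinv i)) - ivec (gen_deg (Gen_X i)) = \<gamma>"
    "\<gamma> - ivec (gen_deg (Gen_X i)) - ivec (gen_deg (Gen_Xinv i)) = \<gamma>" for i
    by (auto simp: fun_eq_iff)
  note ops = diffop_diff diffop_mult diffop_gen diffop_one diffop_zero
  from p consider i j where "p = free_x i * free_x j - free_x j * free_x i"
    | i j where "p = free_d i * free_d j - free_d j * free_d i"
    | i j where "p = free_d i * free_x j - free_x j * free_d i - (if i = j then 1 else 0)"
    | i where "r \<le> i" "p = free_x i * free_xinv i - 1"
    | i where "r \<le> i" "p = free_xinv i * free_x i - 1"
    unfolding weyl_relations_def by blast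
  then show "diffop J p \<phi> \<gamma> = 0"
  proof cases
    case (1 i j)
    show ?thesis unfolding 1 ops comm[of "ivec (gen_deg (Gen_X i))" "ivec (gen_deg (Gen_X j))"]
      by auto
  next
    case (2 i j)
    show ?thesis unfolding 2 ops comm[of "ivec (gen_deg (Gen_D i))" "ivec (gen_deg (Gen_D j))"]
      by auto
  next
    case (3 i j)
    show ?thesis
    proof (cases "i = j")
      case True
      show ?thesis unfolding 3 True ops if_True cancel diffop_one by (auto simp: algebra_simps diffop_one)
    next
      case False
      show ?thesis unfolding 3 ops comm[of "ivec (gen_deg (Gen_D i))" "ivec (gen_deg (Gen_X j))"]
        using False by (auto simp: diffop_zero)
    qed
  next
    case (4 i)
    then have "i \<notin> J" using J by auto
    then show ?thesis unfolding 4 ops cancel by simp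
  next
    case (5 i)
    then have "i \<notin> J" using J by auto
    then show ?thesis unfolding 5 ops cancel by simp
  qed
qed

lemma diffop_WI:
  fixes p :: "'k::field_char_0 free_alg"
  assumes J: "J \<subseteq> {..<r}" and p: "p \<in> WI r s"
  shows "diffop J p \<phi> = (\<lambda>_. 0)"
proof -
  let ?N = "{p \<in> FF r s. \<forall>\<phi>. diffop J p \<phi> = (\<lambda>_. 0)} :: 'k free_alg set"
  have "ideal ?N (free_ring r s)"
  proof (rule idealI[OF ring_free])
    show "subgroup ?N (add_monoid (free_ring r s))"
    proof (rule free.add.subgroupI)
      fix a assume "a \<in> ?N"
      then show "\<ominus>\<^bsub>free_ring r s\<^esub> a \<in> ?N" by (simp add: free_a_inv diffop_minus FF_minus)
    qed (auto simp: free_ring_simps diffop_zero diffop_add intro: FF_intros)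
  qed (auto simp: free_ring_simps diffop_mult diffop_arg_zero intro: FF_mult)
  moreover have "weyl_relations r s \<subseteq> ?N"
    using relations_FF diffop_relation[OF J] by blast
  ultimately have "WI r s \<subseteq> ?N" unfolding weyl_ideal_def by (rule free.genideal_minimal)
  then show ?thesis using p by blast
qed

lemma diffop_weq:
  fixes p :: "'k::field_char_0 free_alg"
  assumes "J \<subseteq> {..<r}" "weq r s p q"
  shows "diffop J p = diffop J q"
proof (intro ext)
  fix \<phi> \<gamma>
  have "diffop J (p - q) \<phi> \<gamma> = 0" 
    using assms(2) by (subst diffop_WI[OF assms(1)]) (auto simp: weq_def)
  then show "diffop J p \<phi> \<gamma> = diffop J q \<phi> \<gamma>" by (simp add: diffop_diff)
qed

section \<open>The symmetric algebra\<close>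

text \<open>Representatives in the free algebra of the elements of \<open>Sym(tt)\<close>.\<close>

inductive_set symF :: "'k::field free_alg set" where
  const: "fconst c \<in> symF"
| euler: "i < r + s \<Longrightarrow> euler i \<in> symF"
| add: "p \<in> symF \<Longrightarrow> q \<in> symF \<Longrightarrow> p + q \<in> symF"
| mult: "p \<in> symF \<Longrightarrow> q \<in> symF \<Longrightarrow> p * q \<in> symF"

lemma symF_FF: "p \<in> symF \<Longrightarrow> p \<in> FF r s"
  by (induction rule: symF.induct) (auto intro: FF_intros FF_euler)

lemma symF_minus: "p \<in> symF \<Longrightarrow> - p \<in> symF"
  using symF.mult[OF symF.const[of "-1"]] by (fastforce simp: fconst_minus)

lemma symF_diff: "p \<in> symF \<Longrightarrow> q \<in> symF \<Longrightarrow> p - q \<in> symF"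
  using symF.add[OF _ symF_minus] by fastforce

lemma symF_sum: "(\<And>x. x \<in> A \<Longrightarrow> f x \<in> symF) \<Longrightarrow> (\<Sum>x\<in>A. f x) \<in> symF"
  by (induction A rule: infinite_finite_induct) (use symF.const[of 0] in \<open>auto intro: symF.add\<close>)

lemma diffop_euler: "diffop J (euler i) \<phi> = (\<lambda>\<gamma>. \<gamma> i * \<phi> \<gamma> :: 'k::field)"
proof
  fix \<gamma> :: "nat \<Rightarrow> 'k"
  have "\<gamma> - ivec (gen_deg (Gen_X i)) - ivec (gen_deg (Gen_D i)) = \<gamma>" by (auto simp: fun_eq_iff)
  then show "diffop J (euler i) \<phi> \<gamma> = \<gamma> i * \<phi> \<gamma>"
    unfolding euler_def diffop_mult diffop_gen by (simp only:) simp
qed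

text \<open>Elements of \<open>Sym(tt)\<close> act by multiplication with a function that does not depend on \<open>J\<close>; it is
read off from the constant function.\<close>

definition evalF :: "'k::field free_alg \<Rightarrow> (nat \<Rightarrow> 'k) \<Rightarrow> 'k"
  where "evalF p \<gamma> = diffop {} p (\<lambda>_. 1) \<gamma>"

lemma evalF_const: "evalF (fconst c) = (\<lambda>_. c)"
  by (rule ext) (simp add: evalF_def diffop_const)

lemma evalF_euler: "evalF (euler i) = (\<lambda>\<gamma>. \<gamma> i)"
  by (rule ext) (simp add: evalF_def diffop_euler)

lemma evalF_add: "evalF (p + q) = (\<lambda>\<gamma>. evalF p \<gamma> + evalF q \<gamma>)"
  by (rule ext) (simp add: evalF_def diffop_add)

lemma evalF_minus: "evalF (- p) = (\<lambda>\<gamma>. - evalF p \<gamma>)"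
  by (rule ext) (simp add: evalF_def diffop_minus)

lemma evalF_diff: "evalF (p - q) = (\<lambda>\<gamma>. evalF p \<gamma> - evalF q \<gamma>)"
  by (rule ext) (simp add: evalF_def diffop_diff)

lemma symF_diffop: "p \<in> symF \<Longrightarrow> diffop J p \<phi> = (\<lambda>\<gamma>. evalF p \<gamma> * \<phi> \<gamma> :: 'k::field)"
proof -
  assume p: "p \<in> (symF :: 'k free_alg set)"
  then have "\<exists>f. \<forall>J \<phi>. diffop J p \<phi> = (\<lambda>\<gamma>. f \<gamma> * \<phi> \<gamma>)"
  proof induction
    case (const c)
    show ?case by (rule exI[of _ "\<lambda>_. c"]) (simp add: diffop_const)
  next
    case (euler i)
    show ?case by (rule exI[of _ "\<lambda>\<gamma>. \<gamma> i"]) (simp add: diffop_euler)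
  next
    case (add p q)
    then obtain f h where "\<And>J \<phi>. diffop J p \<phi> = (\<lambda>\<gamma>. f \<gamma> * \<phi> \<gamma>)" "\<And>J \<phi>. diffop J q \<phi> = (\<lambda>\<gamma>. h \<gamma> * \<phi> \<gamma>)"
      by metis
    then show ?case by (intro exI[of _ "\<lambda>\<gamma>. f \<gamma> + h \<gamma>"]) (simp add: diffop_add distrib_right)
  next
    case (mult p q)
    then obtain f h where "\<And>J \<phi>. diffop J p \<phi> = (\<lambda>\<gamma>. f \<gamma> * \<phi> \<gamma>)" "\<And>J \<phi>. diffop J q \<phi> = (\<lambda>\<gamma>. h \<gamma> * \<phi> \<gamma>)"
      by metis
    then show ?case by (intro exI[of _ "\<lambda>\<gamma>. f \<gamma> * h \<gamma>"]) (simp add: diffop_mult mult.assoc)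
  qed
  then obtain f where f: "\<And>J \<phi>. diffop J p \<phi> = (\<lambda>\<gamma>. f \<gamma> * \<phi> \<gamma>)" by blast
  show ?thesis by (simp add: evalF_def f)
qed

lemma evalF_mult: "p \<in> symF \<Longrightarrow> evalF (p * q) = (\<lambda>\<gamma>. evalF p \<gamma> * evalF q \<gamma>)"
  using symF_diffop[of p "{}" "diffop {} q (\<lambda>_. 1)"] by (simp add: evalF_def diffop_mult fun_eq_iff)

lemma evalF_sum: "evalF (\<Sum>x\<in>A. f x) = (\<lambda>\<gamma>. \<Sum>x\<in>A. evalF (f x) \<gamma>)"
  by (rule ext) (simp add: evalF_def diffop_sum)

lemma evalF_polyfun: "p \<in> symF \<Longrightarrow> evalF p \<in> polyfuns (r + s)"
  by (induction rule: symF.induct)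
    (auto simp: evalF_const evalF_euler evalF_add evalF_mult intro: polyfuns.intros)

lemma polyfun_evalF: "f \<in> polyfuns (r + s) \<Longrightarrow> \<exists>p\<in>symF. evalF p = f"
proof (induction rule: polyfuns.induct)
  case (const c)
  show ?case using symF.const evalF_const by blast
next
  case (coord i)
  then show ?case using symF.euler evalF_euler by blast
next
  case (add f h)
  then show ?case using symF.add evalF_add by blast
next
  case (mult f h)
  then show ?case using symF.mult evalF_mult by blast
qed

lemma evalF_weq:
  fixes p :: "'k::field_char_0 free_alg"
  shows "weq r s p q \<Longrightarrow> evalF p = evalF q"
  by (rule ext) (simp add: evalF_def diffop_weq[of "{}" p q])

text \<open>Moving a word to the left of a polynomial in the \<open>\<pi>\<^sub>i\<close> shifts the polynomial by the degree of the word.\<close>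

lemma symF_word:
  fixes p :: "'k::field free_alg"
  assumes "p \<in> symF" and w: "set w \<subseteq> weyl_gens r s"
  shows "\<exists>p'\<in>symF. weq r s (p * word w) (word w * p')"
  using assms(1)
proof (induction rule: symF.induct)
  case (const c)
  show ?case by (rule bexI[of _ "fconst c"]) (simp_all add: fconst_commute weq_refl symF.const)
next
  case (euler i)
  show ?case
    by (rule bexI[of _ "euler i + fconst (of_int (word_deg w i))"], rule euler_word[OF euler w])
      (intro symF.add symF.euler symF.const euler)
next
  case (add p q)
  then obtain p' q' where "p' \<in> symF" "q' \<in> symF" "weq r s (p * word w) (word w * p')"
    "weq r s (q * word w) (word w * q')" by blast
  then show ?case
    by (intro bexI[of _ "p' + q'"]) (auto simp: algebra_simps intro: weq_add symF.add)
next
  case (mult p q)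
  then obtain p' q' where *: "p' \<in> symF" "q' \<in> symF" "weq r s (p * word w) (word w * p')"
    "weq r s (q * word w) (word w * q')" by blast
  have "p * q * word w = p * (q * word w)" by (simp add: mult.assoc)
  also have "weq r s \<dots> (p * (word w * q'))" by (intro weq_lmult * symF_FF mult.hyps)
  also have "\<dots> = (p * word w) * q'" by (simp add: mult.assoc)
  also have "weq r s \<dots> ((word w * p') * q')" by (intro weq_rmult * symF_FF)
  finally show ?case using * by (intro bexI[of _ "p' * q'"]) (auto simp: mult.assoc intro: symF.mult)
qed

section \<open>Words of degree zero\<close>

lemma word_split_index:
  assumes w: "set w \<subseteq> weyl_gens r s"
  shows "weq r s (word w :: 'k::field free_alg)
    (word (filter (\<lambda>a. gen_index a = m) w) * word (filter (\<lambda>a. gen_index a \<noteq> m) w))"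
  using w
proof (induction w)
  case Nil
  show ?case by (simp add: word_Nil weq_refl)
next
  case (Cons a w)
  let ?u = "filter (\<lambda>a. gen_index a = m) w" and ?v = "filter (\<lambda>a. gen_index a \<noteq> m) w"
  have sub: "set ?u \<subseteq> weyl_gens r s" "set ?v \<subseteq> weyl_gens r s" using Cons.prems by auto
  note FF = FF_word[OF sub(1)] FF_word[OF sub(2)]
  have a: "a \<in> weyl_gens r s" using Cons.prems by simp
  have step: "weq r s (word (a # w) :: 'k free_alg) (free_gen a * (word ?u * word ?v))"
    unfolding word_Cons using Cons a by (intro weq_lmult FF_gen) auto
  show ?case
  proof (cases "gen_index a = m")
    case True
    then show ?thesis using step by (simp add: word_Cons mult.assoc)
  next
    case False
    have "weq_commute r s (free_gen a :: 'k free_alg) (word ?u)"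
      by (rule weq_commute_word) (use a sub False in \<open>auto intro!: FF_gen gens_commute\<close>)
    then have "weq r s (free_gen a * word ?u * word ?v :: 'k free_alg) (word ?u * free_gen a * word ?v)"
      unfolding weq_commute_def by (intro weq_rmult FF)
    from weq_trans[OF step, unfolded mult.assoc[symmetric], OF this] show ?thesis
      using False by (simp add: word_Cons mult.assoc)
  qed
qed

text \<open>The four possible products are \<open>x\<^sub>i \<partial>\<^sub>i = \<pi>\<^sub>i\<close>, \<open>\<partial>\<^sub>i x\<^sub>i = \<pi>\<^sub>i + 1\<close> and the two products of \<open>x\<^sub>i\<close> with its
inverse.\<close>

lemma opposite_gens_symF:
  assumes a: "a \<in> weyl_gens r s" and b: "b \<in> weyl_gens r s" and "gen_index a = gen_index b"
    and "gen_deg a (gen_index a) = - gen_deg b (gen_index a)"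
  shows "\<exists>p\<in>symF. weq r s (free_gen a * free_gen b :: 'k::field free_alg) p"
proof -
  have one: "(1 :: 'k free_alg) \<in> symF" using symF.const[of 1] by simp
  have dx: "weq r s (free_d i * free_x i :: 'k free_alg) (euler i + 1)" if "i < r + s" for i
    using rel_dx[OF that that] by (simp add: euler_def)
  show ?thesis using a
  proof (cases rule: gen_index_cases)
    case (1 i)
    from b show ?thesis
    proof (cases rule: gen_index_cases)
      case (2 j)
      then show ?thesis using 1 assms rel_xxinv[of r i s] one by auto
    next
      case (3 j)
      then show ?thesis using 1 assms symF.euler[of i] weq_refl[of r s "euler i"] by (auto simp: euler_def)
    qed (use 1 assms in auto)
  next
    case (2 i)
    from b show ?thesis
    proof (cases rule: gen_index_cases)
      case (1 j)
      then show ?thesis using 2 assms rel_xinvx[of r i s] one by auto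
    qed (use 2 assms in auto)
  next
    case (3 i)
    from b show ?thesis
    proof (cases rule: gen_index_cases)
      case (1 j)
      then show ?thesis using 3 assms dx[of i] symF.add[OF symF.euler one] by auto
    qed (use 3 assms in auto)
  qed
qed

lemma sum_zero_opposite_neighbours:
  fixes f :: "'a \<Rightarrow> int"
  assumes "w \<noteq> []" "\<forall>a\<in>set w. f a = 1 \<or> f a = -1" "sum_list (map f w) = 0"
  shows "\<exists>u a b v. w = u @ a # b # v \<and> f a = - f b"
proof (rule ccontr)
  assume neg: "\<not> ?thesis"
  have const_suffix: "\<forall>a\<in>set v. f a = f (hd v)" if "w = u @ v" "v \<noteq> []" for u v
    using that
  proof (induction v arbitrary: u)
    case (Cons a v)
    show ?case
    proof (cases v)
      case Nil
      then show ?thesis by simp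
    next
      case (Cons b v')
      then have "f a \<noteq> - f b" using neg \<open>w = u @ a # v\<close> by blast
      then have "f a = f b" using assms(2) \<open>w = u @ a # v\<close> Cons by auto
      moreover have "\<forall>x\<in>set v. f x = f (hd v)" using Cons.IH[of "u @ [a]"] \<open>w = u @ a # v\<close> Cons by simp
      ultimately show ?thesis using Cons by (metis list.sel(1) set_ConsD)
    qed
  qed simp
  from const_suffix[of "[]" w] have "\<forall>a\<in>set w. f a = f (hd w)" using assms(1) append_Nil by metis
  then have "map f w = map (\<lambda>_. f (hd w)) w" by (simp only: map_eq_conv)
  then have "sum_list (map f w) = int (length w) * f (hd w)" by (simp only: sum_list_triv of_nat_id)
  moreover have "f (hd w) \<noteq> 0" using assms(2)[rule_format, OF hd_in_set[OF assms(1)]] by auto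
  ultimately show False using assms(1,3) by simp
qed

lemma word_deg_sum_list: "word_deg w i = sum_list (map (\<lambda>a. gen_deg a i) w)"
  by (induction w) auto

text \<open>A nonempty word of degree zero in one index contains two neighbouring letters of opposite degree.
Their product is in \<open>Sym(tt)\<close> and can be moved to the right end, which leaves a shorter word.\<close>

lemma one_index_word_symF:
  assumes "set w \<subseteq> weyl_gens r s" "\<forall>a\<in>set w. gen_index a = m" "word_deg w m = 0"
  shows "\<exists>p\<in>symF. weq r s (word w :: 'k::field free_alg) p"
  using assms
proof (induction w rule: length_induct)
  case (1 w)
  show ?case
  proof (cases "w = []")
    case True
    then show ?thesis using symF.const[of 1] weq_refl[of r s 1] by (auto simp: word_Nil)
  next
    case False
    have "gen_deg a m = 1 \<or> gen_deg a m = -1" if "a \<in> set w" for a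
      using 1(3) that by (cases a) auto
    then obtain u a b v where w: "w = u @ a # b # v" "gen_deg a m = - gen_deg b m"
      using sum_zero_opposite_neighbours[OF False, of "\<lambda>a. gen_deg a m"] 1(4)
      by (auto simp: word_deg_sum_list)
    have sub: "set u \<subseteq> weyl_gens r s" "set v \<subseteq> weyl_gens r s" "a \<in> weyl_gens r s" "b \<in> weyl_gens r s"
      using 1(2) w by auto
    obtain p :: "'k free_alg" where p: "p \<in> symF" "weq r s (free_gen a * free_gen b) p"
      using opposite_gens_symF[OF sub(3,4)] 1(3) w by auto
    obtain p' where p': "p' \<in> symF" "weq r s (p * word v) (word v * p')"
      using symF_word[OF p(1) sub(2)] by blast
    have "word_deg (u @ v) m = 0" using 1(4) w by (simp add: word_deg_sum_list)
    then obtain q :: "'k free_alg" where q: "q \<in> symF" "weq r s (word (u @ v)) q"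
      using 1(1)[rule_format, of "u @ v"] w 1(2,3) by auto
    have "word w = word u * ((free_gen a * free_gen b) * word v)"
      by (simp add: w word_append word_Cons mult.assoc)
    also have "weq r s \<dots> (word u * (p * word v))"
      by (intro weq_lmult weq_rmult p FF_word sub)
    also have "weq r s \<dots> (word u * (word v * p'))"
      by (intro weq_lmult p' FF_word sub)
    also have "\<dots> = word (u @ v) * p'" by (simp add: word_append mult.assoc)
    also have "weq r s \<dots> (q * p')" by (intro weq_rmult q symF_FF p')
    finally show ?thesis using q(1) p'(1) symF.mult by blast
  qed
qed

lemma word_deg_filter_index:
  "word_deg (filter (\<lambda>a. gen_index a = m) w) = (\<lambda>i. if i = m then word_deg w m else 0)"
  "word_deg (filter (\<lambda>a. gen_index a \<noteq> m) w) = (\<lambda>i. if i = m then 0 else word_deg w i)"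
proof (induction w)
  case (Cons a w)
  { case 1 show ?case using Cons(1) by (cases a) (auto simp: fun_eq_iff) }
  { case 2 show ?case using Cons(2) by (cases a) (auto simp: fun_eq_iff) }
qed auto

text \<open>Letters with different indices commute, so the word can be sorted by index, and each of its
one-index parts has degree zero.\<close>

lemma degree_zero_word_symF:
  assumes "set w \<subseteq> weyl_gens r s" "word_deg w = 0"
  shows "\<exists>p\<in>symF. weq r s (word w :: 'k::field free_alg) p"
proof -
  have "\<exists>p\<in>symF. weq r s (word w :: 'k free_alg) p"
    if "set w \<subseteq> weyl_gens r s" "\<forall>a\<in>set w. gen_index a < m" "word_deg w = 0" for m w
    using that
  proof (induction m arbitrary: w)
    case 0
    then have "w = []" by simp
    then show ?case using symF.const[of 1] weq_refl[of r s 1] by (auto simp: word_Nil)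
  next
    case (Suc m)
    let ?u = "filter (\<lambda>a. gen_index a = m) w" and ?v = "filter (\<lambda>a. gen_index a \<noteq> m) w"
    have sub: "set ?u \<subseteq> weyl_gens r s" "set ?v \<subseteq> weyl_gens r s" using Suc.prems by auto
    obtain p :: "'k free_alg" where p: "p \<in> symF" "weq r s (word ?u) p"
      using one_index_word_symF[OF sub(1), of m] Suc.prems(3) by (auto simp: word_deg_filter_index)
    have "word_deg ?v = 0" using Suc.prems(3) by (simp add: word_deg_filter_index fun_eq_iff)
    then obtain q :: "'k free_alg" where q: "q \<in> symF" "weq r s (word ?v) q"
      using Suc.IH[OF sub(2)] Suc.prems(2) by force
    have "weq r s (word w :: 'k free_alg) (word ?u * word ?v)" by (rule word_split_index) fact
    also have "weq r s \<dots> (p * q)" by (intro weq_mult p q FF_word sub symF_FF)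
    finally show ?case using p q symF.mult by blast
  qed
  moreover have "\<forall>a\<in>set w. gen_index a < r + s" using assms(1) by (auto simp: weyl_gens_def)
  ultimately show ?thesis using assms by blast
qed

end

context
  fixes r s :: nat
begin

interpretation free: ring "free_ring r s :: 'k::field free_alg ring" by (rule ring_free)
interpretation WI: ideal "weyl_ideal r s :: 'k::field free_alg set" "free_ring r s" by (rule ideal_WI)
interpretation W: ring "weyl r s :: 'k::field weyl ring" by (rule ring_weyl)

abbreviation (input) cls :: "'k::field free_alg \<Rightarrow> 'k weyl" where "cls \<equiv> weyl_class r s"
abbreviation (input) SF :: "'k::field free_alg set" where "SF \<equiv> symF r s"

section \<open>The torus and its dual\<close>

text \<open>The element of \<open>tt\<close> with coordinates \<open>c\<close> in the basis of the \<open>\<pi>\<^sub>i\<close>.\<close>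

definition torus_elt :: "(nat \<Rightarrow> 'k::field) \<Rightarrow> 'k free_alg"
  where "torus_elt c = (\<Sum>i<r + s. fconst (c i) * euler i)"

lemma torus_elt_SF: "torus_elt c \<in> SF"
  unfolding torus_elt_def by (intro symF_sum symF.mult symF.const symF.euler) auto

lemma torus_elt_FF: "torus_elt c \<in> FF r s" by (rule symF_FF[OF torus_elt_SF])

lemma evalF_torus_elt: "evalF (torus_elt c) = (\<lambda>\<gamma>. \<Sum>i<r + s. c i * \<gamma> i)"
  unfolding torus_elt_def evalF_sum
  by (intro ext sum.cong refl) (simp add: evalF_mult[OF symF.const] evalF_const evalF_euler)

lemma scal_cls: "scal r s c = cls (fconst c)" by (simp add: scal_def)
lemma weyl_pi_cls: "weyl_pi r s i = cls (euler i)" by (simp add: weyl_pi_def euler_def)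

lemma tt_eq: "tt r s = cls ` range (torus_elt :: (nat \<Rightarrow> 'k::field) \<Rightarrow> 'k free_alg)"
proof -
  have "foldr (W.line_extension (range (scal r s))) (map (weyl_pi r s) is) {\<zero>\<^bsub>weyl r s\<^esub>}
      = {cls (\<Sum>i\<in>set is. fconst (c i :: 'k) * euler i) | c. True}"
    if "distinct is" "set is \<subseteq> {..<r + s}" for "is"
    using that
  proof (induction "is")
    case Nil
    then show ?case by (simp add: class_zero)
  next
    case (Cons i "is")
    have FF: "(fconst d * euler i :: 'k free_alg) \<in> FF r s" "(\<Sum>i\<in>set is. fconst (c i :: 'k) * euler i) \<in> FF r s" for d c
      using Cons.prems by (auto intro!: FF_intros FF_euler)
    have step: "scal r s d \<otimes>\<^bsub>weyl r s\<^esub> weyl_pi r s i \<oplus>\<^bsub>weyl r s\<^esub> cls (\<Sum>i\<in>set is. fconst (c i :: 'k) * euler i)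
        = cls (fconst d * euler i + (\<Sum>i\<in>set is. fconst (c i) * euler i))" for d c
      unfolding class_add[OF FF] using Cons.prems by (simp add: class_mult FF_const FF_euler scal_cls weyl_pi_cls)
    have upd: "(\<Sum>j\<in>set (i # is). fconst ((c(i := d)) j :: 'k) * euler j)
        = fconst d * euler i + (\<Sum>j\<in>set is. fconst (c j) * euler j)" for c d
      using Cons.prems by (auto intro!: sum.cong)
    have "foldr (W.line_extension (range (scal r s))) (map (weyl_pi r s) (i # is)) {\<zero>\<^bsub>weyl r s\<^esub>}
      = W.line_extension (range (scal r s)) (weyl_pi r s i) {cls (\<Sum>i\<in>set is. fconst (c i :: 'k) * euler i) | c. True}"
      using Cons by simp
    also have "\<dots> = {cls (\<Sum>i\<in>set (i # is). fconst (c i :: 'k) * euler i) | c. True}" (is "?L = ?R")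
    proof (intro equalityI subsetI)
      fix u assume "u \<in> ?L"
      then obtain d c where "u = scal r s d \<otimes>\<^bsub>weyl r s\<^esub> weyl_pi r s i \<oplus>\<^bsub>weyl r s\<^esub> cls (\<Sum>i\<in>set is. fconst (c i :: 'k) * euler i)"
        by (auto simp: W.line_extension_mem_iff)
      then have "u = cls (\<Sum>j\<in>set (i # is). fconst ((c(i := d)) j) * euler j)" unfolding step upd .
      then show "u \<in> ?R" by blast
    next
      fix u assume "u \<in> ?R"
      then obtain c where "u = cls (\<Sum>j\<in>set (i # is). fconst ((c(i := c i)) j :: 'k) * euler j)" by auto
      then have "u = scal r s (c i) \<otimes>\<^bsub>weyl r s\<^esub> weyl_pi r s i \<oplus>\<^bsub>weyl r s\<^esub> cls (\<Sum>i\<in>set is. fconst (c i :: 'k) * euler i)"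
        unfolding step upd .
      then show "u \<in> ?L" unfolding W.line_extension_mem_iff by blast
    qed
    finally show ?case .
  qed
  from this[of "[0..<r + s]"] show ?thesis
    unfolding tt_def W.Span.simps torus_elt_def by (auto simp: atLeast0LessThan)
qed

lemma torus_elt_tt: "cls (torus_elt c) \<in> tt r s" by (simp add: tt_eq)

lemma euler_torus_elt: "i < r + s \<Longrightarrow> torus_elt (\<lambda>j. if j = i then 1 else 0) = (euler i :: 'k::field free_alg)"
proof -
  assume i: "i < r + s"
  have "torus_elt (\<lambda>j. if j = i then 1 else 0) = (\<Sum>j<r + s. if j = i then (euler i :: 'k free_alg) else 0)"
    unfolding torus_elt_def by (rule sum.cong) auto
  then show ?thesis using i by simp
qed

lemma sym_carrier: "carrier (sym_ring r s) = cls ` (SF :: 'k::field free_alg set)"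
proof -
  let ?H = "range (scal r s) \<union> tt r s :: 'k weyl set"
  have "a \<in> cls ` SF" if "a \<in> generate_ring (weyl r s) ?H" for a :: "'k weyl"
    using that
  proof induction
    case one
    show ?case using class_one[of r s] symF.const[of 1 r s] by (auto intro!: image_eqI[of _ _ 1])
  next
    case (incl h)
    then show ?case by (auto simp: scal_cls tt_eq intro: symF.const torus_elt_SF)
  next
    case (a_inv h)
    then obtain p where "p \<in> SF" "h = cls p" by blast
    then show ?case using class_minus[OF symF_FF[of p], symmetric] symF_minus[of p] by auto
  next
    case (eng_add h1 h2)
    then obtain p q where "p \<in> SF" "h1 = cls p" "q \<in> SF" "h2 = cls q" by blast
    then show ?case using class_add[OF symF_FF symF_FF, of p r s q] symF.add[of p r s q] by auto
  next
    case (eng_mult h1 h2)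
    then obtain p q where "p \<in> SF" "h1 = cls p" "q \<in> SF" "h2 = cls q" by blast
    then show ?case using class_mult[OF symF_FF symF_FF, of p r s q] symF.mult[of p r s q] by auto
  qed
  moreover have "cls p \<in> generate_ring (weyl r s) ?H" if "p \<in> SF" for p :: "'k free_alg"
    using that
  proof (induction rule: symF.induct)
    case (const c)
    show ?case by (rule generate_ring.incl) (simp add: scal_cls)
  next
    case (euler i)
    then show ?case using torus_elt_tt[of "\<lambda>j. if j = i then 1 else 0"]
      by (intro generate_ring.incl UnI2) (simp add: euler_torus_elt)
  next
    case (add p q)
    then show ?case by (simp add: class_add symF_FF generate_ring.eng_add)
  next
    case (mult p q)
    then show ?case by (simp add: class_mult symF_FF generate_ring.eng_mult)
  qed
  ultimately show ?thesis unfolding sym_ring_def by auto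
qed

lemma ring_sym: "ring (sym_ring r s :: 'k::field weyl ring)"
proof -
  have "range (scal r s) \<union> tt r s \<subseteq> carrier (weyl r s :: 'k weyl ring)"
    by (auto simp: scal_cls tt_eq intro!: class_closed FF_const torus_elt_FF)
  then show ?thesis unfolding sym_ring_def by (intro W.subring_is_ring W.generate_ring_is_subring)
qed

lemma sym_ring_simps:
  "monoid.mult (sym_ring r s) = monoid.mult (weyl r s)" "one (sym_ring r s) = one (weyl r s)"
  "zero (sym_ring r s) = zero (weyl r s)" "add (sym_ring r s) = add (weyl r s)"
  by (simp_all add: sym_ring_def)

text \<open>The coordinates of a linear form on \<open>tt\<close>; the padding by zeros makes the point unique.\<close>

definition pt :: "('k::field weyl \<Rightarrow> 'k) \<Rightarrow> nat \<Rightarrow> 'k"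
  where "pt \<gamma> i = (if i < r + s then \<gamma> (weyl_pi r s i) else 0)"

lemma dual_torus_elt:
  assumes \<gamma>: "\<gamma> \<in> dual r s (tt r s)"
  shows "\<gamma> (cls (torus_elt c)) = (\<Sum>i<r + s. c i * pt \<gamma> i)"
proof -
  have add: "\<gamma> (cls (torus_elt c + torus_elt d)) = \<gamma> (cls (torus_elt c)) + \<gamma> (cls (torus_elt d))" for c d
    using \<gamma> unfolding class_add[OF torus_elt_FF torus_elt_FF] by (simp add: dual_def torus_elt_tt)
  have scale: "\<gamma> (cls (fconst d * torus_elt c)) = d * \<gamma> (cls (torus_elt c))" for c d
    using \<gamma> unfolding class_mult[OF FF_const torus_elt_FF] scal_cls[symmetric]
    by (simp add: dual_def torus_elt_tt)
  define cut where "cut m = (\<lambda>i. if i < m then c i else 0)" for m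
  have cut_Suc: "torus_elt (cut (Suc m)) = torus_elt (cut m) + fconst (c m) * torus_elt (\<lambda>j. if j = m then 1 else 0)" for m
    unfolding torus_elt_def sum_distrib_left sum.distrib[symmetric]
    by (rule sum.cong) (auto simp: cut_def less_Suc_eq)
  have fcm: "fconst d * torus_elt c = torus_elt (\<lambda>i. d * c i)" for c d
    unfolding torus_elt_def sum_distrib_left by (simp add: fconst_mult mult.assoc)
  have zero: "\<gamma> (cls (torus_elt (cut 0))) = 0"
    using scale[of 0 "cut 0"] by (simp add: torus_elt_def cut_def)
  have "\<gamma> (cls (torus_elt (cut m))) = (\<Sum>i<m. c i * pt \<gamma> i)" if "m \<le> r + s" for m
    using that
  proof (induction m)
    case 0
    show ?case using zero by simp
  next
    case (Suc m)
    have "\<gamma> (cls (torus_elt (cut (Suc m)))) = \<gamma> (cls (torus_elt (cut m))) + c m * pt \<gamma> m"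
      unfolding cut_Suc fcm add unfolding fcm[symmetric] scale using Suc.prems
      by (simp add: euler_torus_elt pt_def weyl_pi_cls)
    then show ?case using Suc by simp
  qed
  from this[of "r + s"] show ?thesis unfolding torus_elt_def cut_def by simp
qed

lemma pt_outside: "i \<ge> r + s \<Longrightarrow> pt \<gamma> i = 0" by (simp add: pt_def)

text \<open>The form is well defined because the coordinates of an element of \<open>tt\<close> matter only through its action
on functions.\<close>

lemma ex_dual_pt:
  fixes y :: "nat \<Rightarrow> 'k::field_char_0"
  assumes "\<And>i. i \<ge> r + s \<Longrightarrow> y i = 0"
  shows "\<exists>\<gamma>\<in>dual r s (tt r s). pt \<gamma> = y"
proof -
  define coord where "coord t = (SOME c. t = cls (torus_elt c :: 'k free_alg))" for t
  define \<gamma> where "\<gamma> = restrict (\<lambda>t. evalF (torus_elt (coord t)) y) (tt r s)"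
  have val: "\<gamma> (cls (torus_elt c)) = evalF (torus_elt c) y" for c
  proof -
    have "cls (torus_elt c) = cls (torus_elt (coord (cls (torus_elt c))))"
      unfolding coord_def by (rule someI[of "\<lambda>d. cls (torus_elt c) = cls (torus_elt d)"]) (rule refl)
    then have "weq r s (torus_elt c) (torus_elt (coord (cls (torus_elt c))))"
      by (simp add: class_eq_iff torus_elt_FF)
    from evalF_weq[OF this] show ?thesis by (simp add: \<gamma>_def torus_elt_tt)
  qed
  have add: "torus_elt (\<lambda>i. c i + d i) = torus_elt c + (torus_elt d :: 'k free_alg)" for c d
    unfolding torus_elt_def sum.distrib[symmetric] by (simp add: fconst_add distrib_right)
  have scale: "torus_elt (\<lambda>i. d * c i) = fconst d * (torus_elt c :: 'k free_alg)" for c d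
    unfolding torus_elt_def sum_distrib_left by (simp add: fconst_mult mult.assoc)
  have "\<gamma> \<in> dual r s (tt r s)"
    unfolding dual_def
  proof (intro CollectI conjI ballI allI)
    show "\<gamma> \<in> extensional (tt r s)" by (simp add: \<gamma>_def)
  next
    fix a b :: "'k weyl" assume "a \<in> tt r s" "b \<in> tt r s"
    then obtain c d where ab: "a = cls (torus_elt c)" "b = cls (torus_elt d)" by (auto simp: tt_eq)
    then have *: "a \<oplus>\<^bsub>weyl r s\<^esub> b = cls (torus_elt (\<lambda>i. c i + d i))"
      by (simp add: add class_add torus_elt_FF)
    show "\<gamma> (a \<oplus>\<^bsub>weyl r s\<^esub> b) = \<gamma> a + \<gamma> b"
      unfolding * unfolding ab val unfolding add evalF_add ..
  next
    fix d :: 'k and a :: "'k weyl" assume "a \<in> tt r s"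
    then obtain c where a: "a = cls (torus_elt c)" by (auto simp: tt_eq)
    then have *: "scal r s d \<otimes>\<^bsub>weyl r s\<^esub> a = cls (torus_elt (\<lambda>i. d * c i))"
      by (simp add: scale class_mult torus_elt_FF FF_const scal_cls)
    show "\<gamma> (scal r s d \<otimes>\<^bsub>weyl r s\<^esub> a) = d * \<gamma> a"
      unfolding * unfolding a val unfolding scale evalF_mult[OF symF.const] evalF_const ..
  qed
  moreover have "pt \<gamma> = y"
  proof
    fix i
    show "pt \<gamma> i = y i"
      using val[of "\<lambda>j. if j = i then 1 else 0"] assms[of i]
      by (cases "i < r + s") (auto simp: pt_def weyl_pi_cls euler_torus_elt evalF_euler)
  qed
  ultimately show ?thesis by blast
qed

text \<open>Modulo the maximal ideal, every element of \<open>Sym(tt)\<close> is congruent to its value at \<open>\<gamma>\<close>.\<close>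

lemma max_ideal_eq:
  fixes \<gamma> :: "'k::field_char_0 weyl \<Rightarrow> 'k"
  assumes \<gamma>: "\<gamma> \<in> dual r s (tt r s)"
  shows "max_ideal r s \<gamma> = cls ` {p \<in> SF. evalF p (pt \<gamma>) = 0}"
proof -
  interpret S: ring "sym_ring r s :: 'k weyl ring" by (rule ring_sym)
  let ?G = "{t \<ominus>\<^bsub>weyl r s\<^esub> scal r s (\<gamma> t) |t. t \<in> tt r s}"
  let ?M = "cls ` {p \<in> SF. evalF p (pt \<gamma>) = 0}"
  have gen: "cls (torus_elt c) \<ominus>\<^bsub>weyl r s\<^esub> scal r s (\<gamma> (cls (torus_elt c)))
      = cls (torus_elt c - fconst (evalF (torus_elt c) (pt \<gamma>)))" for c
    by (simp add: class_diff torus_elt_FF FF_const scal_cls dual_torus_elt[OF \<gamma>] evalF_torus_elt)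
  have G: "?G \<subseteq> ?M"
  proof
    fix x assume "x \<in> ?G"
    then obtain c where x: "x = cls (torus_elt c) \<ominus>\<^bsub>weyl r s\<^esub> scal r s (\<gamma> (cls (torus_elt c)))"
      by (auto simp: tt_eq)
    show "x \<in> ?M" unfolding x gen
      by (intro imageI CollectI conjI symF_diff torus_elt_SF symF.const) (simp add: evalF_diff evalF_const)
  qed
  have Mc: "?M \<subseteq> carrier (sym_ring r s)" by (auto simp: sym_carrier)
  have "ideal ?M (sym_ring r s)"
  proof (rule idealI[OF ring_sym])
    show "subgroup ?M (add_monoid (sym_ring r s))"
    proof (rule S.add.subgroupI)
      show "?M \<subseteq> carrier (sym_ring r s)" by (rule Mc)
      have "cls 0 \<in> ?M" using symF.const[of 0 r s] by (intro imageI) (auto simp: evalF_def diffop_zero)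
      then show "?M \<noteq> {}" by blast
    next
      fix a assume "a \<in> ?M"
      then obtain p where p: "p \<in> SF" "evalF p (pt \<gamma>) = 0" "a = cls p" by blast
      have "cls (- p) \<oplus>\<^bsub>sym_ring r s\<^esub> cls p = \<zero>\<^bsub>sym_ring r s\<^esub>"
        unfolding sym_ring_simps
        by (subst class_add[symmetric]) (use p in \<open>auto intro: symF_FF symF_minus simp: class_zero\<close>)
      then have "\<ominus>\<^bsub>sym_ring r s\<^esub> a = cls (- p)"
        using p symF_minus[OF p(1)] by (intro S.minus_equality) (auto simp: sym_carrier)
      then show "\<ominus>\<^bsub>sym_ring r s\<^esub> a \<in> ?M"
        using p symF_minus[OF p(1)] by (auto simp: evalF_minus)
    next
      fix a b assume "a \<in> ?M" "b \<in> ?M"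
      then obtain p q where "p \<in> SF" "evalF p (pt \<gamma>) = 0" "a = cls p" "q \<in> SF" "evalF q (pt \<gamma>) = 0" "b = cls q"
        by blast
      moreover from this have "a \<oplus>\<^bsub>sym_ring r s\<^esub> b = cls (p + q)"
        by (simp add: sym_ring_simps class_add symF_FF)
      ultimately show "a \<oplus>\<^bsub>sym_ring r s\<^esub> b \<in> ?M"
        by (auto simp: evalF_add intro!: imageI symF.add)
    qed
  next
    fix a x :: "'k weyl" assume "a \<in> ?M" "x \<in> carrier (sym_ring r s)"
    then obtain p q where pq: "p \<in> SF" "evalF p (pt \<gamma>) = 0" "a = cls p" "q \<in> SF" "x = cls q"
      by (auto simp: sym_carrier)
    have "x \<otimes>\<^bsub>sym_ring r s\<^esub> a = cls (q * p)" "a \<otimes>\<^bsub>sym_ring r s\<^esub> x = cls (p * q)"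
      using pq by (simp_all add: sym_ring_simps class_mult symF_FF)
    then show "x \<otimes>\<^bsub>sym_ring r s\<^esub> a \<in> ?M" "a \<otimes>\<^bsub>sym_ring r s\<^esub> x \<in> ?M"
      using pq by (auto simp: evalF_mult intro!: imageI symF.mult)
  qed
  then have le: "max_ideal r s \<gamma> \<subseteq> ?M" unfolding max_ideal_def using G by (rule S.genideal_minimal)
  have Gc: "?G \<subseteq> carrier (sym_ring r s)" using G Mc by (rule subset_trans)
  interpret m: ideal "max_ideal r s \<gamma>" "sym_ring r s"
    unfolding max_ideal_def by (rule S.genideal_ideal[OF Gc])
  have mgen: "cls (torus_elt c - fconst (evalF (torus_elt c) (pt \<gamma>))) \<in> max_ideal r s \<gamma>" for c
    unfolding gen[symmetric] max_ideal_def using S.genideal_self[OF Gc] torus_elt_tt[of c] by blast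
  have "cls (p - fconst (evalF p (pt \<gamma>))) \<in> max_ideal r s \<gamma>" if "p \<in> SF" for p
    using that
  proof (induction rule: symF.induct)
    case (const c)
    show ?case using m.zero_closed by (simp add: evalF_const class_zero sym_ring_simps)
  next
    case (euler i)
    then show ?case using mgen[of "\<lambda>j. if j = i then 1 else 0"] by (simp add: euler_torus_elt)
  next
    case (add p q)
    have "p + q - fconst (evalF (p + q) (pt \<gamma>)) =
        (p - fconst (evalF p (pt \<gamma>))) + (q - fconst (evalF q (pt \<gamma>)))"
      by (simp add: evalF_add fconst_add algebra_simps)
    then have "cls (p + q - fconst (evalF (p + q) (pt \<gamma>))) =
        cls (p - fconst (evalF p (pt \<gamma>))) \<oplus>\<^bsub>sym_ring r s\<^esub> cls (q - fconst (evalF q (pt \<gamma>)))"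
      using add.hyps by (simp only: sym_ring_simps class_add FF_diff FF_const symF_FF)
    then show ?case using m.a_closed[OF add.IH] by (simp only:)
  next
    case (mult p q)
    let ?p = "fconst (evalF p (pt \<gamma>))" and ?q = "fconst (evalF q (pt \<gamma>))"
    note FF = symF_FF[OF mult.hyps(1)] symF_FF[OF mult.hyps(2)] FF_const FF_diff FF_mult
    have "p * q - fconst (evalF (p * q) (pt \<gamma>)) = (p - ?p) * q + ?p * (q - ?q)"
      by (simp add: evalF_mult[OF mult.hyps(1)] fconst_mult algebra_simps)
    then have eq: "cls (p * q - fconst (evalF (p * q) (pt \<gamma>))) =
        cls (p - ?p) \<otimes>\<^bsub>sym_ring r s\<^esub> cls q \<oplus>\<^bsub>sym_ring r s\<^esub> cls ?p \<otimes>\<^bsub>sym_ring r s\<^esub> cls (q - ?q)"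
      by (simp only: sym_ring_simps class_add class_mult FF)
    have "cls q \<in> carrier (sym_ring r s)" "cls ?p \<in> carrier (sym_ring r s)"
      using mult.hyps symF.const by (auto simp: sym_carrier)
    then show ?case unfolding eq
      using m.a_closed m.I_r_closed[OF mult.IH(1)] m.I_l_closed[OF mult.IH(2)] by blast
  qed
  then have "?M \<subseteq> max_ideal r s \<gamma>" by fastforce
  then show ?thesis using le by blast
qed

lemma cls_max_ideal_iff:
  fixes \<gamma> :: "'k::field_char_0 weyl \<Rightarrow> 'k"
  assumes \<gamma>: "\<gamma> \<in> dual r s (tt r s)" and p: "p \<in> SF"
  shows "cls p \<in> max_ideal r s \<gamma> \<longleftrightarrow> evalF p (pt \<gamma>) = 0"
proof
  assume "cls p \<in> max_ideal r s \<gamma>"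
  then obtain q where "q \<in> SF" "evalF q (pt \<gamma>) = 0" "cls p = cls q" unfolding max_ideal_eq[OF \<gamma>] by blast
  then show "evalF p (pt \<gamma>) = 0" using evalF_weq[of r s p q] p by (simp add: class_eq_iff symF_FF)
qed (use max_ideal_eq[OF \<gamma>] p in blast)

end

section \<open>Left modules, their quotients and annihilators\<close>

locale left_module = R: ring R + M: abelian_group M
  for R :: "('a, 'c) ring_scheme" (structure) and M :: "('a, 'b) module" +
  assumes smult_closed: "a \<in> carrier R \<Longrightarrow> x \<in> carrier M \<Longrightarrow> a \<odot>\<^bsub>M\<^esub> x \<in> carrier M"
    and smult_assoc: "a \<in> carrier R \<Longrightarrow> b \<in> carrier R \<Longrightarrow> x \<in> carrier M \<Longrightarrow>
      (a \<otimes> b) \<odot>\<^bsub>M\<^esub> x = a \<odot>\<^bsub>M\<^esub> (b \<odot>\<^bsub>M\<^esub> x)"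
    and smult_add_left: "a \<in> carrier R \<Longrightarrow> b \<in> carrier R \<Longrightarrow> x \<in> carrier M \<Longrightarrow>
      (a \<oplus> b) \<odot>\<^bsub>M\<^esub> x = a \<odot>\<^bsub>M\<^esub> x \<oplus>\<^bsub>M\<^esub> b \<odot>\<^bsub>M\<^esub> x"
    and smult_add_right: "a \<in> carrier R \<Longrightarrow> x \<in> carrier M \<Longrightarrow> y \<in> carrier M \<Longrightarrow>
      a \<odot>\<^bsub>M\<^esub> (x \<oplus>\<^bsub>M\<^esub> y) = a \<odot>\<^bsub>M\<^esub> x \<oplus>\<^bsub>M\<^esub> a \<odot>\<^bsub>M\<^esub> y"
    and smult_one: "x \<in> carrier M \<Longrightarrow> \<one> \<odot>\<^bsub>M\<^esub> x = x"
begin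

lemma smult_zero_left: "x \<in> carrier M \<Longrightarrow> \<zero> \<odot>\<^bsub>M\<^esub> x = \<zero>\<^bsub>M\<^esub>"
  using smult_add_left[of \<zero> \<zero> x] smult_closed[of \<zero> x] by simp

lemma smult_zero_right: "a \<in> carrier R \<Longrightarrow> a \<odot>\<^bsub>M\<^esub> \<zero>\<^bsub>M\<^esub> = \<zero>\<^bsub>M\<^esub>"
  using smult_add_right[of a "\<zero>\<^bsub>M\<^esub>" "\<zero>\<^bsub>M\<^esub>"] smult_closed[of a "\<zero>\<^bsub>M\<^esub>"] by simp

lemma smult_minus_one: "x \<in> carrier M \<Longrightarrow> (\<ominus> \<one>) \<odot>\<^bsub>M\<^esub> x = \<ominus>\<^bsub>M\<^esub> x"
proof -
  assume x: "x \<in> carrier M"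
  have "(\<ominus> \<one>) \<odot>\<^bsub>M\<^esub> x \<oplus>\<^bsub>M\<^esub> x = (\<ominus> \<one> \<oplus> \<one>) \<odot>\<^bsub>M\<^esub> x"
    using smult_add_left[of "\<ominus> \<one>" \<one> x] smult_one[OF x] x by simp
  also have "\<dots> = \<zero>\<^bsub>M\<^esub>" using smult_zero_left[OF x] by (simp add: R.l_neg)
  finally show ?thesis using x smult_closed[of "\<ominus> \<one>" x] M.minus_equality by simp
qed

lemma submoduleI:
  assumes "N \<subseteq> carrier M" "\<zero>\<^bsub>M\<^esub> \<in> N"
    and "\<And>x y. x \<in> N \<Longrightarrow> y \<in> N \<Longrightarrow> x \<oplus>\<^bsub>M\<^esub> y \<in> N"
    and "\<And>a x. a \<in> carrier R \<Longrightarrow> x \<in> N \<Longrightarrow> a \<odot>\<^bsub>M\<^esub> x \<in> N"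
  shows "submodule N R M"
proof (intro submodule.intro submodule_axioms.intro M.add.subgroupI)
  show "\<ominus>\<^bsub>M\<^esub> x \<in> N" if "x \<in> N" for x
    using assms(1) assms(4)[of "\<ominus> \<one>" x] that smult_minus_one[of x] by auto
qed (use assms in auto)

lemma submoduleD:
  assumes "submodule N R M"
  shows "N \<subseteq> carrier M" "\<zero>\<^bsub>M\<^esub> \<in> N"
    and "x \<in> N \<Longrightarrow> y \<in> N \<Longrightarrow> x \<oplus>\<^bsub>M\<^esub> y \<in> N"
    and "a \<in> carrier R \<Longrightarrow> x \<in> N \<Longrightarrow> a \<odot>\<^bsub>M\<^esub> x \<in> N"
    and "x \<in> N \<Longrightarrow> \<ominus>\<^bsub>M\<^esub> x \<in> N"
proof -
  interpret N: submodule N R M by fact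
  show "N \<subseteq> carrier M" using N.subset by simp
  show "\<zero>\<^bsub>M\<^esub> \<in> N" using N.one_closed by simp
  show "x \<in> N \<Longrightarrow> y \<in> N \<Longrightarrow> x \<oplus>\<^bsub>M\<^esub> y \<in> N" using N.m_closed by simp
  show "a \<in> carrier R \<Longrightarrow> x \<in> N \<Longrightarrow> a \<odot>\<^bsub>M\<^esub> x \<in> N" by (rule N.smult_closed)
  show "x \<in> N \<Longrightarrow> \<ominus>\<^bsub>M\<^esub> x \<in> N" using N.m_inv_closed[of x] by (simp add: a_inv_def)
qed

lemma annihilator_ideal: "ideal (annihilator R M) R"
proof (rule idealI)
  show "ring R" by (rule R.ring_axioms)
  show "subgroup (annihilator R M) (add_monoid R)"
  proof (rule R.add.subgroupI)
    show "annihilator R M \<noteq> {}" using smult_zero_left by (auto simp: annihilator_def)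
    fix a assume a: "a \<in> annihilator R M"
    have "(\<ominus> a) \<odot>\<^bsub>M\<^esub> x = \<zero>\<^bsub>M\<^esub>" if x: "x \<in> carrier M" for x
    proof -
      have "(\<ominus> a) \<odot>\<^bsub>M\<^esub> x = (\<ominus> \<one>) \<odot>\<^bsub>M\<^esub> (a \<odot>\<^bsub>M\<^esub> x)"
        using a x smult_assoc[of "\<ominus> \<one>" a x] by (simp add: annihilator_def R.l_minus)
      then show ?thesis using a x smult_zero_right by (simp add: annihilator_def)
    qed
    then show "\<ominus> a \<in> annihilator R M" using a by (simp add: annihilator_def)
  qed (auto simp: annihilator_def smult_add_left)
qed (auto simp: annihilator_def smult_assoc smult_zero_right smult_closed)

end

lemma left_module_regular:
  assumes "ring R"
  shows "left_module R (regular_module R)"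
proof -
  interpret ring R by fact
  show ?thesis
  proof (intro left_module.intro left_module_axioms.intro)
    show "abelian_group (regular_module R)"
      by (rule abelian_groupI) (auto simp: regular_module_def a_ac intro: bexI[of _ "\<ominus>\<^bsub>R\<^esub> x" for x] l_neg)
  qed (auto simp: regular_module_def m_assoc l_distr r_distr ring_axioms)
qed

context left_module
begin

context
  fixes N
  assumes N: "submodule N R M"
begin

interpretation NM: abelian_subgroup N M
  by (rule abelian_subgroupI3) (use N in \<open>auto simp: submodule_def additive_subgroup_def M.abelian_group_axioms\<close>)

lemma quotient_carrier: "carrier (quotient_module M N) = (\<lambda>x. N +>\<^bsub>M\<^esub> x) ` carrier M"
  by (auto simp: quotient_module_def A_RCOSETS_def')

lemma quotient_zero: "\<zero>\<^bsub>quotient_module M N\<^esub> = N"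
  by (simp add: quotient_module_def)

lemma quotient_add: "x \<in> carrier M \<Longrightarrow> y \<in> carrier M \<Longrightarrow>
    (N +>\<^bsub>M\<^esub> x) \<oplus>\<^bsub>quotient_module M N\<^esub> (N +>\<^bsub>M\<^esub> y) = N +>\<^bsub>M\<^esub> (x \<oplus>\<^bsub>M\<^esub> y)"
  using NM.a_rcos_sum[of x y] by (simp add: quotient_module_def)

lemma coset_eq_zero_iff: "x \<in> carrier M \<Longrightarrow> N +>\<^bsub>M\<^esub> x = N \<longleftrightarrow> x \<in> N"
  using NM.a_rcos_self[of x] NM.a_rcos_const[of x] by auto

lemma coset_mem: "x \<in> carrier M \<Longrightarrow> z \<in> N +>\<^bsub>M\<^esub> x \<longleftrightarrow> (\<exists>u\<in>N. z = u \<oplus>\<^bsub>M\<^esub> x)"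
  by (auto simp: a_r_coset_def')

lemma quotient_smult:
  assumes a: "a \<in> carrier R" and x: "x \<in> carrier M"
  shows "a \<odot>\<^bsub>quotient_module M N\<^esub> (N +>\<^bsub>M\<^esub> x) = N +>\<^bsub>M\<^esub> (a \<odot>\<^bsub>M\<^esub> x)"
proof -
  have const: "N +>\<^bsub>M\<^esub> (a \<odot>\<^bsub>M\<^esub> z) = N +>\<^bsub>M\<^esub> (a \<odot>\<^bsub>M\<^esub> x)" if "z \<in> N +>\<^bsub>M\<^esub> x" for z
  proof -
    from coset_mem[OF x, THEN iffD1, OF that]
    obtain u where u: "u \<in> N" "z = u \<oplus>\<^bsub>M\<^esub> x" by (elim bexE)
    have "a \<odot>\<^bsub>M\<^esub> z = a \<odot>\<^bsub>M\<^esub> u \<oplus>\<^bsub>M\<^esub> a \<odot>\<^bsub>M\<^esub> x"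
      unfolding u(2) by (rule smult_add_right[OF a subsetD[OF submoduleD(1)[OF N] u(1)] x])
    moreover have "a \<odot>\<^bsub>M\<^esub> u \<in> N" using submoduleD(4)[OF N a u(1)] .
    ultimately have "a \<odot>\<^bsub>M\<^esub> z \<in> N +>\<^bsub>M\<^esub> (a \<odot>\<^bsub>M\<^esub> x)"
      unfolding coset_mem[OF smult_closed[OF a x]] by blast
    from M.a_repr_independence[OF this smult_closed[OF a x] NM.a_subgroup] show ?thesis by simp
  qed
  have "(\<Union>z\<in>N +>\<^bsub>M\<^esub> x. N +>\<^bsub>M\<^esub> (a \<odot>\<^bsub>M\<^esub> z)) = (\<Union>z\<in>N +>\<^bsub>M\<^esub> x. N +>\<^bsub>M\<^esub> (a \<odot>\<^bsub>M\<^esub> x))"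
    by (rule SUP_cong[OF refl]) (rule const)
  also have "\<dots> = N +>\<^bsub>M\<^esub> (a \<odot>\<^bsub>M\<^esub> x)"
    unfolding UN_constant using NM.a_rcos_self[OF x] by (metis empty_iff)
  finally show ?thesis by (simp add: quotient_module_def)
qed

lemma left_module_quotient: "left_module R (quotient_module M N)"
proof (intro left_module.intro left_module_axioms.intro)
  show "ring R" by (rule R.ring_axioms)
  have Nz: "N = N +>\<^bsub>M\<^esub> \<zero>\<^bsub>M\<^esub>" using coset_eq_zero_iff[of "\<zero>\<^bsub>M\<^esub>"] submoduleD(2)[OF N] by simp
  show "abelian_group (quotient_module M N)"
  proof (rule abelian_groupI)
    fix X assume "X \<in> carrier (quotient_module M N)"
    then obtain x where x: "x \<in> carrier M" "X = N +>\<^bsub>M\<^esub> x" by (auto simp: quotient_carrier)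
    show "\<zero>\<^bsub>quotient_module M N\<^esub> \<oplus>\<^bsub>quotient_module M N\<^esub> X = X"
      using quotient_add[of "\<zero>\<^bsub>M\<^esub>" x] x Nz by (simp add: quotient_zero)
    show "\<exists>y\<in>carrier (quotient_module M N). y \<oplus>\<^bsub>quotient_module M N\<^esub> X = \<zero>\<^bsub>quotient_module M N\<^esub>"
      using quotient_add[of "\<ominus>\<^bsub>M\<^esub> x" x] x Nz
      by (intro bexI[of _ "N +>\<^bsub>M\<^esub> (\<ominus>\<^bsub>M\<^esub> x)"]) (auto simp: quotient_zero quotient_carrier M.l_neg)
  next
    show "\<zero>\<^bsub>quotient_module M N\<^esub> \<in> carrier (quotient_module M N)"
      using Nz by (auto simp: quotient_carrier quotient_zero)
  qed (auto simp: quotient_carrier quotient_add M.a_ac)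
qed (auto simp: quotient_carrier quotient_add quotient_smult smult_closed smult_assoc smult_add_left
    smult_add_right smult_one)

lemma coset_eq_iff: "x \<in> carrier M \<Longrightarrow> y \<in> carrier M \<Longrightarrow>
    N +>\<^bsub>M\<^esub> x = N +>\<^bsub>M\<^esub> y \<longleftrightarrow> x \<ominus>\<^bsub>M\<^esub> y \<in> N"
proof -
  assume xy: "x \<in> carrier M" "y \<in> carrier M"
  interpret Q: left_module R "quotient_module M N" by (rule left_module_quotient)
  have minus: "\<ominus>\<^bsub>quotient_module M N\<^esub> (N +>\<^bsub>M\<^esub> y) = N +>\<^bsub>M\<^esub> (\<ominus>\<^bsub>M\<^esub> y)"
    using quotient_add[of "\<ominus>\<^bsub>M\<^esub> y" y] xy coset_eq_zero_iff[of "\<zero>\<^bsub>M\<^esub>"] submoduleD(2)[OF N]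
    by (intro Q.M.minus_equality) (auto simp: quotient_carrier M.l_neg quotient_zero)
  have "N +>\<^bsub>M\<^esub> x = N +>\<^bsub>M\<^esub> y \<longleftrightarrow>
      (N +>\<^bsub>M\<^esub> x) \<ominus>\<^bsub>quotient_module M N\<^esub> (N +>\<^bsub>M\<^esub> y) = \<zero>\<^bsub>quotient_module M N\<^esub>"
  proof -
    have c: "N +>\<^bsub>M\<^esub> x \<in> carrier (quotient_module M N)" "N +>\<^bsub>M\<^esub> y \<in> carrier (quotient_module M N)"
      using xy by (auto simp: quotient_carrier)
    have "N +>\<^bsub>M\<^esub> x = (N +>\<^bsub>M\<^esub> x) \<ominus>\<^bsub>quotient_module M N\<^esub> (N +>\<^bsub>M\<^esub> y) \<oplus>\<^bsub>quotient_module M N\<^esub> (N +>\<^bsub>M\<^esub> y)"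
      using c by (simp add: a_minus_def Q.M.a_assoc Q.M.l_neg)
    then show ?thesis using c by (auto simp: a_minus_def Q.M.r_neg)
  qed
  also have "(N +>\<^bsub>M\<^esub> x) \<ominus>\<^bsub>quotient_module M N\<^esub> (N +>\<^bsub>M\<^esub> y) = N +>\<^bsub>M\<^esub> (x \<ominus>\<^bsub>M\<^esub> y)"
    using xy quotient_add[of x "\<ominus>\<^bsub>M\<^esub> y"] by (simp add: a_minus_def minus)
  finally show ?thesis using coset_eq_zero_iff[of "x \<ominus>\<^bsub>M\<^esub> y"] xy by (simp add: quotient_zero)
qed

end

text \<open>If every submodule outside \<open>N0\<close> is everything, then a submodule \<open>N\<close> with simple quotient lies in
\<open>N0\<close>, and \<open>N0\<close> gives a proper submodule of the simple quotient, so \<open>N = N0\<close>.\<close>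

lemma simple_quotient_kernel_eq:
  assumes N0: "submodule N0 R M" "N0 \<noteq> carrier M"
    and top: "\<And>N. submodule N R M \<Longrightarrow> \<not> N \<subseteq> N0 \<Longrightarrow> N = carrier M"
  shows "simple_quotient_kernel R M = N0"
  unfolding simple_quotient_kernel_def
proof (rule the_equality)
  show "submodule N0 R M \<and> simple_module R (quotient_module M N0)"
  proof (intro conjI N0)
    interpret Q: left_module R "quotient_module M N0" by (rule left_module_quotient[OF N0(1)])
    have "\<exists>x\<in>carrier M. x \<notin> N0" using N0 submoduleD(1) by blast
    then have ne: "carrier (quotient_module M N0) \<noteq> {\<zero>\<^bsub>quotient_module M N0\<^esub>}"
      using coset_eq_zero_iff[OF N0(1)] by (auto simp: quotient_carrier[OF N0(1)] quotient_zero[OF N0(1)])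
    have "X = {\<zero>\<^bsub>quotient_module M N0\<^esub>} \<or> X = carrier (quotient_module M N0)"
      if X: "submodule X R (quotient_module M N0)" for X
    proof -
      let ?X = "{x \<in> carrier M. N0 +>\<^bsub>M\<^esub> x \<in> X}"
      have sub: "submodule ?X R M"
      proof (rule submoduleI)
        show "\<zero>\<^bsub>M\<^esub> \<in> ?X" using coset_eq_zero_iff[OF N0(1), of "\<zero>\<^bsub>M\<^esub>"] submoduleD(2)[OF N0(1)] Q.submoduleD(2)[OF X]
          by (simp add: quotient_zero[OF N0(1)])
      next
        fix x y assume "x \<in> ?X" "y \<in> ?X"
        then show "x \<oplus>\<^bsub>M\<^esub> y \<in> ?X" using Q.submoduleD(3)[OF X, of "N0 +>\<^bsub>M\<^esub> x" "N0 +>\<^bsub>M\<^esub> y"]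
          by (simp add: quotient_add[OF N0(1)])
      next
        fix a x assume "a \<in> carrier R" "x \<in> ?X"
        then show "a \<odot>\<^bsub>M\<^esub> x \<in> ?X" using Q.submoduleD(4)[OF X, of a "N0 +>\<^bsub>M\<^esub> x"]
          by (simp add: quotient_smult[OF N0(1)] smult_closed)
      qed auto
      have Xc: "X \<subseteq> carrier (quotient_module M N0)" by (rule Q.submoduleD(1)[OF X])
      show ?thesis
      proof (cases "?X \<subseteq> N0")
        case True
        have "x = \<zero>\<^bsub>quotient_module M N0\<^esub>" if "x \<in> X" for x
          using that Xc True coset_eq_zero_iff[OF N0(1)]
          by (auto simp: quotient_carrier[OF N0(1)] quotient_zero[OF N0(1)])
        then show ?thesis using Q.submoduleD(2)[OF X] by blast
      next
        case False
        then have "?X = carrier M" by (rule top[OF sub])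
        then show ?thesis using Xc by (auto simp: quotient_carrier[OF N0(1)])
      qed
    qed
    then show "simple_module R (quotient_module M N0)" using ne by (auto simp: simple_module_def)
  qed
next
  fix N assume "submodule N R M \<and> simple_module R (quotient_module M N)"
  then have N: "submodule N R M" and simple: "simple_module R (quotient_module M N)" by auto
  interpret Q: left_module R "quotient_module M N" by (rule left_module_quotient[OF N])
  have "N \<noteq> carrier M"
  proof
    assume "N = carrier M"
    then have "\<forall>x\<in>carrier M. N +>\<^bsub>M\<^esub> x = N" using coset_eq_zero_iff[OF N] by blast
    then have "carrier (quotient_module M N) = {\<zero>\<^bsub>quotient_module M N\<^esub>}"
      unfolding quotient_carrier[OF N] quotient_zero[OF N] using M.zero_closed by blast
    then show False using simple by (simp add: simple_module_def)
  qed
  then have NN0: "N \<subseteq> N0" using top[OF N] by blast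
  let ?X = "(\<lambda>x. N +>\<^bsub>M\<^esub> x) ` N0"
  have N0c: "N0 \<subseteq> carrier M" by (rule submoduleD(1)[OF N0(1)])
  have X: "submodule ?X R (quotient_module M N)"
  proof (rule Q.submoduleI)
    show "?X \<subseteq> carrier (quotient_module M N)" using N0c by (auto simp: quotient_carrier[OF N])
    show "\<zero>\<^bsub>quotient_module M N\<^esub> \<in> ?X"
      using coset_eq_zero_iff[OF N, of "\<zero>\<^bsub>M\<^esub>"] submoduleD(2)[OF N] submoduleD(2)[OF N0(1)]
      by (auto simp: quotient_zero[OF N] intro!: image_eqI[of _ _ "\<zero>\<^bsub>M\<^esub>"])
  next
    fix x y assume "x \<in> ?X" "y \<in> ?X"
    then show "x \<oplus>\<^bsub>quotient_module M N\<^esub> y \<in> ?X"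
      using N0c submoduleD(3)[OF N0(1)] quotient_add[OF N] by blast
  next
    fix a x assume "a \<in> carrier R" "x \<in> ?X"
    then show "a \<odot>\<^bsub>quotient_module M N\<^esub> x \<in> ?X"
      using N0c submoduleD(4)[OF N0(1)] quotient_smult[OF N] by blast
  qed
  from simple X consider "?X = {\<zero>\<^bsub>quotient_module M N\<^esub>}" | "?X = carrier (quotient_module M N)"
    by (auto simp: simple_module_def)
  then show "N = N0"
  proof cases
    case 1
    then have "x \<in> N" if "x \<in> N0" for x
      using that coset_eq_zero_iff[OF N, of x] N0c by (auto simp: quotient_zero[OF N])
    then show ?thesis using NN0 by blast
  next
    case 2
    have "x \<in> N0" if x: "x \<in> carrier M" for x
    proof -
      have "N +>\<^bsub>M\<^esub> x \<in> ?X" unfolding 2 using x by (simp add: quotient_carrier[OF N])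
      then obtain y where y: "y \<in> N0" "N +>\<^bsub>M\<^esub> x = N +>\<^bsub>M\<^esub> y" by blast
      then have "x \<ominus>\<^bsub>M\<^esub> y \<in> N0" using coset_eq_iff[OF N x, of y] N0c NN0 by blast
      from submoduleD(3)[OF N0(1) this y(1)] show ?thesis
        using x y N0c by (auto simp: a_minus_def M.a_assoc M.l_neg)
    qed
    then show ?thesis using N0 N0c by blast
  qed
qed

end

lemma gen_left_ideal:
  assumes R: "ring R" and S: "S \<subseteq> carrier R"
  shows "left_ideal (gen_left_ideal R S) R" "S \<subseteq> gen_left_ideal R S"
    and "left_ideal I R \<Longrightarrow> S \<subseteq> I \<Longrightarrow> gen_left_ideal R S \<subseteq> I"
proof -
  interpret L: left_module R "regular_module R" by (rule left_module_regular[OF R])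
  have c: "carrier (regular_module R) = carrier R" by (simp add: regular_module_def)
  have top: "left_ideal (carrier R) R"
    unfolding left_ideal_def by (rule L.submoduleI) (use L.smult_closed in \<open>auto simp: c[symmetric]\<close>)
  show "left_ideal (gen_left_ideal R S) R"
    unfolding left_ideal_def gen_left_ideal_def
  proof (rule L.submoduleI)
    show "\<Inter> {I. submodule I R (regular_module R) \<and> S \<subseteq> I} \<subseteq> carrier (regular_module R)"
      using top S by (auto simp: c left_ideal_def)
  qed (use L.submoduleD in blast)+
  show "S \<subseteq> gen_left_ideal R S" by (auto simp: gen_left_ideal_def)
  show "left_ideal I R \<Longrightarrow> S \<subseteq> I \<Longrightarrow> gen_left_ideal R S \<subseteq> I" by (auto simp: gen_left_ideal_def)
qed

section \<open>Orthogonal idempotents and Goldie rank\<close>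

text \<open>Right multiplication by \<open>e j\<close> extracts the summand \<open>j\<close>.\<close>

lemma orthogonal_idempotents_direct:
  assumes R: "ring R" and e: "\<And>i. i < m \<Longrightarrow> e i \<in> carrier R" "\<And>i. i < m \<Longrightarrow> e i \<noteq> \<zero>\<^bsub>R\<^esub>"
    "\<And>i. i < m \<Longrightarrow> e i \<otimes>\<^bsub>R\<^esub> e i = e i"
    "\<And>i j. i < m \<Longrightarrow> j < m \<Longrightarrow> i \<noteq> j \<Longrightarrow> e i \<otimes>\<^bsub>R\<^esub> e j = \<zero>\<^bsub>R\<^esub>"
  shows "direct_left_ideals R m (\<lambda>i. (\<lambda>x. x \<otimes>\<^bsub>R\<^esub> e i) ` carrier R)"
proof -
  interpret ring R by fact
  interpret L: left_module R "regular_module R" by (rule left_module_regular[OF R])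
  let ?I = "\<lambda>i. (\<lambda>x. x \<otimes>\<^bsub>R\<^esub> e i) ` carrier R"
  have left: "left_ideal (?I i) R" if "i < m" for i
    unfolding left_ideal_def
  proof (rule L.submoduleI)
    show "\<zero>\<^bsub>regular_module R\<^esub> \<in> ?I i"
      using e(1)[OF that] by (auto simp: regular_module_def intro!: image_eqI[of _ _ "\<zero>\<^bsub>R\<^esub>"])
  next
    fix x y assume "x \<in> ?I i" "y \<in> ?I i"
    then obtain x' y' where "x' \<in> carrier R" "y' \<in> carrier R" "x = x' \<otimes>\<^bsub>R\<^esub> e i" "y = y' \<otimes>\<^bsub>R\<^esub> e i" by blast
    then show "x \<oplus>\<^bsub>regular_module R\<^esub> y \<in> ?I i"
      using e(1)[OF that] by (auto simp: regular_module_def l_distr[symmetric])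
  next
    fix a x assume "a \<in> carrier R" "x \<in> ?I i"
    then obtain x' where "x' \<in> carrier R" "x = x' \<otimes>\<^bsub>R\<^esub> e i" by blast
    then show "a \<odot>\<^bsub>regular_module R\<^esub> x \<in> ?I i"
      using e(1)[OF that] \<open>a \<in> carrier R\<close> by (auto simp: regular_module_def m_assoc[symmetric])
  qed (use e(1)[OF that] in \<open>auto simp: regular_module_def\<close>)
  have "?I i \<noteq> {\<zero>\<^bsub>R\<^esub>}" if "i < m" for i
  proof -
    have "e i \<in> ?I i" using e(1)[OF that] by (auto intro!: image_eqI[of _ _ "\<one>\<^bsub>R\<^esub>"])
    then show ?thesis using e(2)[OF that] by auto
  qed
  moreover have "x j = \<zero>\<^bsub>R\<^esub>" if x: "\<forall>i<m. x i \<in> ?I i" "finsum R x {..<m} = \<zero>\<^bsub>R\<^esub>" and j: "j < m" for x j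
  proof -
    have xe: "x i \<in> carrier R" "x i \<otimes>\<^bsub>R\<^esub> e j = (if j = i then x i else \<zero>\<^bsub>R\<^esub>)" if "i < m" for i
    proof -
      from x(1)[rule_format, OF that] obtain y where y: "x i = y \<otimes>\<^bsub>R\<^esub> e i" "y \<in> carrier R"
        by (rule imageE)
      show "x i \<in> carrier R" using y e(1)[OF that] by simp
      show "x i \<otimes>\<^bsub>R\<^esub> e j = (if j = i then x i else \<zero>\<^bsub>R\<^esub>)"
        unfolding y(1) using y(2) e(1)[OF that] e(1)[OF j] e(3)[OF that] e(4)[OF that j]
        by (simp add: m_assoc)
    qed
    have "\<zero>\<^bsub>R\<^esub> = finsum R x {..<m} \<otimes>\<^bsub>R\<^esub> e j" unfolding x(2) using e(1)[OF j] by simp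
    also have "\<dots> = finsum R (\<lambda>i. x i \<otimes>\<^bsub>R\<^esub> e j) {..<m}"
      using e(1)[OF j] xe by (intro finsum_ldistr) auto
    also have "\<dots> = finsum R (\<lambda>i. if j = i then x i else \<zero>\<^bsub>R\<^esub>) {..<m}"
      using xe by (intro finsum_cong') auto
    also have "\<dots> = x j" using xe j by (intro add.finprod_singleton) auto
    finally show ?thesis by simp
  qed
  ultimately show ?thesis unfolding direct_left_ideals_def using left by blast
qed

section \<open>The simple module in coordinates\<close>

locale weight_data =
  fixes r s :: nat and g :: "'k::field_char_0 weyl set" and chi \<alpha> :: "'k weyl \<Rightarrow> 'k"
  assumes subspace: "subspace_of_tt r s g"
    and alpha: "\<alpha> \<in> V_shift r s g chi"
begin

abbreviation n :: nat where "n \<equiv> r + s"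
abbreviation cls :: "'k free_alg \<Rightarrow> 'k weyl" where "cls \<equiv> weyl_class r s"
abbreviation FF :: "'k free_alg set" where "FF \<equiv> carrier (free_ring r s)"
abbreviation WI :: "'k free_alg set" where "WI \<equiv> weyl_ideal r s"
abbreviation SF :: "'k free_alg set" where "SF \<equiv> symF r s"

definition a0 :: "nat \<Rightarrow> 'k" where "a0 = pt r s \<alpha>"

definition gcoords :: "(nat \<Rightarrow> 'k) set" where "gcoords = {c. cls (torus_elt r s c) \<in> g}"

text \<open>The shifts \<open>\<nu>\<close> in \<open>\<int>\<^sup>n\<close> on which all elements of \<open>g\<close> vanish; these are the degrees that occur in
\<open>A\<^sup>g\<close>.\<close>

definition lat :: "(nat \<Rightarrow> int) set"
  where "lat = {\<nu>. (\<forall>i\<ge>n. \<nu> i = 0) \<and> (\<forall>c\<in>gcoords. (\<Sum>i<n. c i * of_int (\<nu> i)) = 0)}"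

text \<open>Only these coordinates restrict the support. In every other coordinate either \<open>\<alpha>\<^sub>i\<close> is not an integer,
so that \<open>x\<^sub>i\<close> and \<open>\<partial>\<^sub>i\<close> never kill a weight vector, or \<open>x\<^sub>i\<close> is invertible.\<close>

definition int_coords :: "nat set" where "int_coords = {i. i < r \<and> a0 i \<in> \<int>}"
definition int_val :: "nat \<Rightarrow> int" where "int_val i = (SOME m. a0 i = of_int m)"
definition neg_coords :: "nat set" where "neg_coords = {i \<in> int_coords. int_val i < 0}"
definition sg :: "nat \<Rightarrow> int" where "sg i = (if i \<in> neg_coords then -1 else 1)"
text \<open>With \<open>sg\<close>, this writes \<open>\<alpha>\<^sub>i + \<nu>\<^sub>i < 0\<close> as \<open>- \<nu>\<^sub>i + (- 1 - \<alpha>\<^sub>i) \<ge> 0\<close> when \<open>\<alpha>\<^sub>i\<close> is a negative integer.\<close>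

definition off :: "nat \<Rightarrow> int" where "off i = (if i \<in> neg_coords then - 1 - int_val i else int_val i)"

lemma int_val: "i \<in> int_coords \<Longrightarrow> a0 i = of_int (int_val i)"
  unfolding int_val_def by (rule someI_ex) (auto simp: int_coords_def elim: Ints_cases)

sublocale sign_lattice n lat int_coords sg off
proof
  show "0 \<in> lat" by (simp add: lat_def)
next
  fix \<nu> \<mu> assume "\<nu> \<in> lat" "\<mu> \<in> lat"
  then show "\<nu> - \<mu> \<in> lat" by (simp add: lat_def right_diff_distrib sum_subtractf)
next
  fix \<nu> i assume "\<nu> \<in> lat" "n \<le> i"
  then show "\<nu> i = 0" by (simp add: lat_def)
next
  show "finite int_coords" by (simp add: int_coords_def)
next
  fix i assume "i \<in> int_coords"
  show "sg i = 1 \<or> sg i = - 1" by (simp add: sg_def)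
  show "0 \<le> off i" using \<open>i \<in> int_coords\<close> by (simp add: off_def neg_coords_def)
qed

lemma alpha_dual: "\<alpha> \<in> dual r s (tt r s)" using alpha by (simp add: V_shift_def)

lemma a0_outside: "i \<ge> n \<Longrightarrow> a0 i = 0" by (simp add: a0_def pt_outside)

lemma g_torus_elt: "t \<in> g \<Longrightarrow> \<exists>c\<in>gcoords. t = cls (torus_elt r s c)"
  using subspace by (auto simp: subspace_of_tt_def tt_eq gcoords_def)

lemma chi_torus_elt: "c \<in> gcoords \<Longrightarrow> chi (cls (torus_elt r s c)) = (\<Sum>i<n. c i * a0 i)"
proof -
  assume c: "c \<in> gcoords"
  then have "chi (cls (torus_elt r s c)) = \<alpha> (cls (torus_elt r s c))"
    using alpha by (auto simp: V_shift_def gcoords_def)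
  then show ?thesis by (simp add: dual_torus_elt[OF alpha_dual] a0_def)
qed

definition weight :: "(nat \<Rightarrow> int) \<Rightarrow> nat \<Rightarrow> 'k" where "weight \<nu> = a0 + ivec \<nu>"

lemma weight_diff: "weight \<nu> - ivec \<mu> = weight (\<nu> - \<mu>)" by (auto simp: weight_def)
lemma weight_inject: "weight \<nu> = weight \<mu> \<longleftrightarrow> \<nu> = \<mu>" by (simp add: weight_def ivec_inject)
lemma weight_zero: "weight 0 = a0" by (auto simp: weight_def)

text \<open>The matrix entry of \<open>p\<close> from the weight \<open>\<alpha> + \<nu> - \<tau>\<close> to the weight \<open>\<alpha> + \<nu>\<close>.\<close>

definition entry :: "'k free_alg \<Rightarrow> (nat \<Rightarrow> int) \<Rightarrow> (nat \<Rightarrow> int) \<Rightarrow> 'k"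
  where "entry p \<tau> \<nu> = component neg_coords p \<tau> (weight \<nu>)"

lemma entry_diffop: "entry p \<tau> \<nu> = diffop neg_coords p (delta (weight (\<nu> - \<tau>))) (weight \<nu>)"
  by (simp only: entry_def diffop_delta[symmetric] weight_diff)

lemma neg_coords_r: "neg_coords \<subseteq> {..<r}" by (auto simp: neg_coords_def int_coords_def)

lemma entry_outside_degs: "entry p \<tau> \<nu> \<noteq> 0 \<Longrightarrow> \<tau> \<in> degs p"
  using component_outside by (auto simp: entry_def)

lemma entry_mult: "entry (p * q) \<tau> \<nu> = (\<Sum>\<mu>\<in>degs p. entry p \<mu> \<nu> * entry q (\<tau> - \<mu>) (\<nu> - \<mu>))"
  by (simp add: entry_def component_mult weight_diff)

lemma entry_add: "entry (p + q) \<tau> \<nu> = entry p \<tau> \<nu> + entry q \<tau> \<nu>"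
  by (simp add: entry_diffop diffop_add)

lemma entry_diff: "entry (p - q) \<tau> \<nu> = entry p \<tau> \<nu> - entry q \<tau> \<nu>"
  by (simp add: entry_diffop diffop_diff)

lemma entry_sum: "entry (\<Sum>x\<in>A. f x) \<tau> \<nu> = (\<Sum>x\<in>A. entry (f x) \<tau> \<nu>)"
  by (simp add: entry_diffop diffop_sum)

lemma entry_weq: "weq r s p q \<Longrightarrow> entry p = entry q"
  by (intro ext) (simp add: entry_diffop diffop_weq[OF neg_coords_r])

lemma entry_WI: "p \<in> WI \<Longrightarrow> entry p \<tau> \<nu> = 0"
  by (simp add: entry_diffop diffop_WI[OF neg_coords_r])

lemma entry_SF: "p \<in> SF \<Longrightarrow> entry p \<tau> \<nu> = (if \<tau> = 0 then evalF p (weight \<nu>) else 0)"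
proof -
  assume p: "p \<in> SF"
  have "weight (\<nu> - \<tau>) = weight \<nu> \<longleftrightarrow> \<tau> = 0" by (simp add: weight_inject)
  then show ?thesis by (auto simp: entry_diffop symF_diffop[OF p] delta_def)
qed

lemma entry_SF_mult: "p \<in> SF \<Longrightarrow> entry (p * q) \<tau> \<nu> = evalF p (weight \<nu>) * entry q \<tau> \<nu>"
  by (simp add: entry_diffop diffop_mult symF_diffop[of p])

lemma entry_mult_SF: "p \<in> SF \<Longrightarrow> entry (q * p) \<tau> \<nu> = entry q \<tau> \<nu> * evalF p (weight (\<nu> - \<tau>))"
proof -
  assume p: "p \<in> SF"
  have *: "diffop neg_coords p (delta (weight (\<nu> - \<tau>))) = (\<lambda>\<gamma>. evalF p (weight (\<nu> - \<tau>)) * delta (weight (\<nu> - \<tau>)) \<gamma>)"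
    by (rule ext) (simp add: symF_diffop[OF p] delta_def)
  show ?thesis unfolding entry_diffop diffop_mult * diffop_arg_scale by (rule mult.commute)
qed

lemma entry_word: "entry (word w) \<tau> \<nu> = (if \<tau> = word_deg w then word_coeff neg_coords w (weight \<nu>) else 0)"
proof -
  have "weight \<nu> - ivec (word_deg w) = weight (\<nu> - \<tau>) \<longleftrightarrow> \<tau> = word_deg w"
    by (auto simp: weight_diff weight_inject)
  then show ?thesis by (simp add: entry_diffop diffop_word delta_def)
qed

lemma entry_word_mult: "entry (word w * q) \<tau> \<nu> = word_coeff neg_coords w (weight \<nu>) * entry q (\<tau> - word_deg w) (\<nu> - word_deg w)"
proof -
  have "weight (\<nu> - \<tau>) = weight ((\<nu> - word_deg w) - (\<tau> - word_deg w))" by simp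
  then show ?thesis by (simp only: entry_diffop diffop_mult diffop_word weight_diff)
qed

lemma entry_mult_nonzero:
  assumes "entry (p * q) \<tau> \<nu> \<noteq> 0"
  shows "\<exists>\<mu>. entry p \<mu> \<nu> \<noteq> 0 \<and> entry q (\<tau> - \<mu>) (\<nu> - \<mu>) \<noteq> 0"
proof -
  obtain \<mu> where "\<mu> \<in> degs p" "entry p \<mu> \<nu> * entry q (\<tau> - \<mu>) (\<nu> - \<mu>) \<noteq> 0"
    using assms unfolding entry_mult by (meson sum.not_neutral_contains_not_neutral)
  then show ?thesis by auto
qed

lemma fconst_sum: "fconst (\<Sum>x\<in>A. f x) = (\<Sum>x\<in>A. fconst (f x) :: 'k free_alg)"
  by (induction A rule: infinite_finite_induct) (simp_all add: fconst_add)

subsection \<open>Invariant elements\<close>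

text \<open>Representatives in the free algebra of the elements of the invariant ring.\<close>

definition invF :: "'k free_alg set"
  where "invF = {p \<in> FF. \<forall>c\<in>gcoords. weq_commute r s (torus_elt r s c) p}"

lemma invF_FF: "p \<in> invF \<Longrightarrow> p \<in> FF" by (simp add: invF_def)

lemma invF_add: "p \<in> invF \<Longrightarrow> q \<in> invF \<Longrightarrow> p + q \<in> invF"
  by (auto simp: invF_def weq_commute_def distrib_left distrib_right intro: FF_add weq_add)

lemma invF_diff: "p \<in> invF \<Longrightarrow> q \<in> invF \<Longrightarrow> p - q \<in> invF"
  by (auto simp: invF_def weq_commute_def left_diff_distrib right_diff_distrib intro: FF_diff weq_diff)

lemma invF_mult: "p \<in> invF \<Longrightarrow> q \<in> invF \<Longrightarrow> p * q \<in> invF"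
proof -
  assume pq: "p \<in> invF" "q \<in> invF"
  have "weq_commute r s (torus_elt r s c) (p * q)" if c: "c \<in> gcoords" for c
  proof -
    let ?t = "torus_elt r s c"
    have "?t * (p * q) = (?t * p) * q" by (simp add: mult.assoc)
    also have "weq r s \<dots> ((p * ?t) * q)"
      using pq c by (intro weq_rmult) (auto simp: invF_def weq_commute_def)
    also have "\<dots> = p * (?t * q)" by (simp add: mult.assoc)
    also have "weq r s \<dots> (p * (q * ?t))"
      using pq c by (intro weq_lmult) (auto simp: invF_def weq_commute_def)
    finally show ?thesis by (simp add: weq_commute_def mult.assoc)
  qed
  then show ?thesis using pq by (auto simp: invF_def intro: FF_mult)
qed

lemma invF_sum: "(\<And>x. x \<in> A \<Longrightarrow> f x \<in> invF) \<Longrightarrow> 0 \<in> invF \<Longrightarrow> (\<Sum>x\<in>A. f x) \<in> invF"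
  by (induction A rule: infinite_finite_induct) (auto intro: invF_add)

lemma WI_invF: "p \<in> WI \<Longrightarrow> p \<in> invF"
  unfolding invF_def weq_commute_def weq_def
  using WI_diff WI_lmult[OF _ torus_elt_FF] WI_rmult[OF _ torus_elt_FF] WI_FF by blast

lemma euler_commute_SF:
  assumes "i < n" "q \<in> SF"
  shows "weq_commute r s (euler i) q"
  using assms(2)
proof (induction rule: symF.induct)
  case (const c)
  show ?case by (simp add: weq_commute_def fconst_commute weq_refl)
next
  case (euler j)
  have w: "word [Gen_X j, Gen_D j] = euler j" by (simp add: word_Cons word_Nil euler_def)
  have "set [Gen_X j, Gen_D j] \<subseteq> weyl_gens r s" using euler by (auto simp: weyl_gens_def)
  moreover have "word_deg [Gen_X j, Gen_D j] i = 0" by simp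
  ultimately have "weq r s (euler i * euler j) (euler j * (euler i + fconst (of_int 0)) :: 'k free_alg)"
    using euler_word[OF assms(1), of "[Gen_X j, Gen_D j]", where 'k = 'k] unfolding w by metis
  then show ?case by (simp add: weq_commute_def)
next
  case (add p q)
  then show ?case by (auto simp: weq_commute_def distrib_left distrib_right intro: weq_add)
next
  case (mult p q)
  have "euler i * (p * q) = (euler i * p) * q" by (simp add: mult.assoc)
  also have "weq r s \<dots> ((p * euler i) * q)"
    using mult by (intro weq_rmult) (auto simp: weq_commute_def symF_FF)
  also have "\<dots> = p * (euler i * q)" by (simp add: mult.assoc)
  also have "weq r s \<dots> (p * (q * euler i))"
    using mult by (intro weq_lmult) (auto simp: weq_commute_def symF_FF)
  finally show ?case by (simp add: weq_commute_def mult.assoc)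
qed

lemma SF_invF: "q \<in> SF \<Longrightarrow> q \<in> invF"
proof -
  assume q: "q \<in> SF"
  have "weq_commute r s (torus_elt r s c) q" for c
  proof -
    have "weq r s (\<Sum>i<n. fconst (c i) * (euler i * q)) (\<Sum>i<n. fconst (c i) * (q * euler i))"
      using euler_commute_SF[OF _ q] by (intro weq_sum weq_lmult FF_const) (auto simp: weq_commute_def)
    moreover have "fconst (c i) * (q * euler i) = q * (fconst (c i) * euler i)" for i
      by (metis fconst_commute mult.assoc)
    ultimately show ?thesis
      by (simp add: weq_commute_def torus_elt_def sum_distrib_left sum_distrib_right mult.assoc)
  qed
  then show ?thesis using symF_FF[OF q] by (simp add: invF_def)
qed

lemma const_invF: "fconst c \<in> invF" by (rule SF_invF[OF symF.const])

lemma one_SF: "1 \<in> SF" using symF.const[of 1 r s] by simp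
lemma zero_SF: "0 \<in> SF" using symF.const[of 0 r s] by simp

lemma word_invF:
  assumes w: "set w \<subseteq> weyl_gens r s" and L: "word_deg w \<in> lat"
  shows "word w \<in> invF"
proof -
  have "weq_commute r s (torus_elt r s c) (word w)" if c: "c \<in> gcoords" for c
  proof -
    have "torus_elt r s c * word w = (\<Sum>i<n. fconst (c i) * (euler i * word w))"
      by (simp add: torus_elt_def sum_distrib_right mult.assoc)
    also have "weq r s \<dots> (\<Sum>i<n. fconst (c i) * (word w * (euler i + fconst (of_int (word_deg w i)))))"
      by (intro weq_sum weq_lmult FF_const euler_word[OF _ w]) auto
    also have "(\<Sum>i<n. fconst (c i) * (word w * (euler i + fconst (of_int (word_deg w i)))))
       = word w * (torus_elt r s c + (\<Sum>i<n. fconst (c i * of_int (word_deg w i))))"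
    proof -
      have "fconst (c i) * (word w * (euler i + fconst (of_int (word_deg w i))))
        = word w * (fconst (c i) * euler i + fconst (c i * of_int (word_deg w i)))" for i
        by (simp add: mult.assoc[symmetric] fconst_commute[of "c i" "word w"] distrib_left fconst_mult)
      then show ?thesis by (simp add: torus_elt_def sum_distrib_left distrib_left sum.distrib)
    qed
    also have "(\<Sum>i<n. fconst (c i * of_int (word_deg w i))) = fconst (\<Sum>i<n. c i * of_int (word_deg w i))"
      by (rule fconst_sum[symmetric])
    also have "(\<Sum>i<n. c i * of_int (word_deg w i)) = 0" using L c by (simp add: lat_def)
    finally show ?thesis by (simp add: weq_commute_def)
  qed
  then show ?thesis using FF_word[OF w] by (simp add: invF_def)
qed

lemma degs_supp: "p \<in> FF \<Longrightarrow> \<tau> \<in> degs p \<Longrightarrow> i \<ge> n \<Longrightarrow> \<tau> i = 0"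
  unfolding degs_def FF_iff using word_deg_supp by blast

text \<open>An invariant element commutes with the torus elements of \<open>g\<close>, which act on the two weights of a
nonzero entry by the same scalar.\<close>

lemma entry_lat:
  assumes p: "p \<in> invF" and nz: "entry p \<tau> \<nu> \<noteq> 0"
  shows "\<tau> \<in> lat"
proof -
  have "(\<Sum>i<n. c i * of_int (\<tau> i)) = 0" if c: "c \<in> gcoords" for c
  proof -
    let ?t = "torus_elt r s c"
    have "entry (?t * p) \<tau> \<nu> = entry (p * ?t) \<tau> \<nu>"
      using p c entry_weq by (metis (mono_tags, lifting) invF_def mem_Collect_eq weq_commute_def)
    then have "evalF ?t (weight \<nu>) = evalF ?t (weight (\<nu> - \<tau>))"
      using nz by (simp add: entry_SF_mult[OF torus_elt_SF] entry_mult_SF[OF torus_elt_SF])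
    then have "(\<Sum>i<n. c i * (weight \<nu> i - weight (\<nu> - \<tau>) i)) = 0"
      by (simp add: evalF_torus_elt right_diff_distrib sum_subtractf)
    then show ?thesis by (simp add: weight_def)
  qed
  then show ?thesis using degs_supp[OF invF_FF[OF p] entry_outside_degs[OF nz]] by (simp add: lat_def)
qed

subsection \<open>Stability of the orthant\<close>

definition inside :: "(nat \<Rightarrow> int) \<Rightarrow> bool"
  where "inside \<nu> \<longleftrightarrow> (\<forall>i\<in>int_coords. 0 \<le> sg i * \<nu> i + off i)"

lemma orthant_inside: "orthant = {\<nu> \<in> lat. inside \<nu>}"
  by (simp add: orthant_def inside_def)

lemma weight_int_coords: "i \<in> int_coords \<Longrightarrow> weight \<nu> i = of_int (int_val i + \<nu> i)"
  by (simp add: weight_def int_val)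

lemma inside_iff: "inside \<nu> \<longleftrightarrow> (\<forall>i\<in>int_coords. if i \<in> neg_coords then int_val i + \<nu> i < 0 else 0 \<le> int_val i + \<nu> i)"
  unfolding inside_def sg_def off_def by (intro ball_cong) auto

text \<open>The coefficients vanish on the walls of the orthant; this is what the normalisation of \<open>gen_coeff\<close>
achieves.\<close>

lemma gen_coeff_leaving:
  assumes a: "a \<in> weyl_gens r s" and "\<not> inside \<nu>" "inside (\<nu> - gen_deg a)"
  shows "gen_coeff neg_coords a (weight \<nu>) = 0"
proof -
  obtain i where i: "i \<in> int_coords" "\<not> (if i \<in> neg_coords then int_val i + \<nu> i < 0 else 0 \<le> int_val i + \<nu> i)"
    using assms(2) unfolding inside_iff by blast
  have i': "if i \<in> neg_coords then int_val i + (\<nu> - gen_deg a) i < 0 else 0 \<le> int_val i + (\<nu> - gen_deg a) i"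
    using assms(3) i(1) unfolding inside_iff by blast
  have ir: "i < r" using i(1) by (simp add: int_coords_def)
  have Pi: "weight \<nu> i = of_int (int_val i + \<nu> i)" by (rule weight_int_coords[OF i(1)])
  show ?thesis using a
  proof (cases rule: gen_index_cases)
    case (1 j)
    have "j = i" "i \<in> neg_coords" "int_val i + \<nu> i = 0" using i(2) i' 1 by (auto split: if_splits)
    then show ?thesis using 1 Pi by simp
  next
    case (2 j)
    then show ?thesis using i(2) i' ir by (auto split: if_splits)
  next
    case (3 j)
    have "j = i" "i \<notin> neg_coords" "int_val i + \<nu> i = - 1" using i(2) i' 3 by (auto split: if_splits)
    then show ?thesis using 3 Pi by simp
  qed
qed

lemma word_coeff_leaving:
  assumes "set w \<subseteq> weyl_gens r s" "\<not> inside \<nu>" "inside (\<nu> - word_deg w)"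
  shows "word_coeff neg_coords w (weight \<nu>) = 0"
  using assms
proof (induction w arbitrary: \<nu>)
  case (Cons a w)
  show ?case
  proof (cases "inside (\<nu> - gen_deg a)")
    case True
    then show ?thesis using gen_coeff_leaving[of a \<nu>] Cons.prems by simp
  next
    case False
    have ins: "inside ((\<nu> - gen_deg a) - word_deg w)" 
      using Cons.prems(3) by (simp only: word_deg.simps diff_diff_eq)
    have "word_coeff neg_coords w (weight (\<nu> - gen_deg a)) = 0"
      by (rule Cons.IH[OF _ False ins]) (use Cons.prems(1) in auto)
    then show ?thesis by (simp add: weight_diff)
  qed
qed simp

text \<open>The functions supported on the orthant form a submodule.\<close>

lemma entry_leaving:
  assumes p: "p \<in> invF" and "\<nu> \<notin> orthant" "\<nu> - \<tau> \<in> orthant"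
  shows "entry p \<tau> \<nu> = 0"
proof (rule ccontr)
  assume nz: "entry p \<tau> \<nu> \<noteq> 0"
  have "\<nu> = (\<nu> - \<tau>) + \<tau>" by simp
  then have "\<nu> \<in> lat" using add_mem[OF orthant_L[OF assms(3)] entry_lat[OF p nz]] by simp
  then have out: "\<not> inside \<nu>" "inside (\<nu> - \<tau>)" using assms(2,3) by (auto simp: orthant_inside)
  have "word_coeff neg_coords (letters w) (weight \<nu>) = 0"
    if "w \<in> Poly_Mapping.keys p" "word_deg (letters w) = \<tau>" for w
    using word_coeff_leaving[of "letters w" \<nu>] out that invF_FF[OF p] by (auto simp: FF_iff)
  then have "entry p \<tau> \<nu> = 0" unfolding entry_def component_def by (intro sum.neutral) auto
  then show False using nz by simp
qed

lemma weight_nonint: "i < r \<Longrightarrow> i \<notin> int_coords \<Longrightarrow> weight \<nu> i + 1 \<noteq> 0"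
proof
  assume i: "i < r" "i \<notin> int_coords" and "weight \<nu> i + 1 = 0"
  then have "a0 i = of_int (- \<nu> i - 1)" by (simp add: weight_def eq_neg_iff_add_eq_0 algebra_simps)
  then show False using i by (auto simp: int_coords_def)
qed

lemma step_up:
  assumes "i < n" "inside (\<nu> + gen_deg (Gen_X i))"
  shows "word_coeff neg_coords [Gen_X i] (weight (\<nu> + gen_deg (Gen_X i))) \<noteq> 0"
proof (cases "i \<in> neg_coords")
  case True
  then have "i \<in> int_coords" by (simp add: neg_coords_def)
  then have "int_val i + (\<nu> + gen_deg (Gen_X i)) i < 0" using assms(2) True unfolding inside_iff by metis
  then have "of_int (int_val i + (\<nu> + gen_deg (Gen_X i)) i) \<noteq> (0 :: 'k)"
    unfolding of_int_eq_0_iff by linarith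
  then show ?thesis using True unfolding weight_int_coords[OF \<open>i \<in> int_coords\<close>, symmetric] by simp
qed simp

lemma step_down:
  assumes "i < n" "inside (\<nu> - gen_deg (Gen_X i))"
  shows "\<exists>a\<in>weyl_gens r s. gen_deg a = - gen_deg (Gen_X i) \<and> gen_coeff neg_coords a (weight (\<nu> - gen_deg (Gen_X i))) \<noteq> 0"
proof (cases "i < r")
  case False
  have "gen_deg (Gen_Xinv i) = - gen_deg (Gen_X i)" by auto
  then show ?thesis using assms(1) False by (intro bexI[of _ "Gen_Xinv i"]) (auto simp: weyl_gens_def)
next
  case True
  have "gen_coeff neg_coords (Gen_D i) (weight (\<nu> - gen_deg (Gen_X i))) \<noteq> 0"
  proof (cases "i \<in> neg_coords")
    case notneg: False
    show ?thesis
    proof (cases "i \<in> int_coords")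
      case int: True
      then have "0 \<le> int_val i + (\<nu> - gen_deg (Gen_X i)) i" using assms(2) notneg unfolding inside_iff by auto
      then have "of_int (int_val i + (\<nu> - gen_deg (Gen_X i)) i + 1) \<noteq> (0 :: 'k)"
        unfolding of_int_eq_0_iff by linarith
      then show ?thesis using notneg weight_int_coords[OF int, of "\<nu> - gen_deg (Gen_X i)"] by simp
    next
      case False
      then show ?thesis using notneg weight_nonint[OF True False, of "\<nu> - gen_deg (Gen_X i)"] by simp
    qed
  qed simp
  moreover have "gen_deg (Gen_D i) = - gen_deg (Gen_X i)" by auto
  ultimately show ?thesis using assms(1) by (intro bexI[of _ "Gen_D i"]) (auto simp: weyl_gens_def)
qed

text \<open>Change one coordinate by one at a time; inside the orthant no coefficient on the way vanishes.\<close>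

lemma connecting_word_inside:
  assumes "inside \<nu>" "inside \<mu>" "\<forall>i\<ge>n. \<nu> i = 0" "\<forall>i\<ge>n. \<mu> i = 0"
  shows "\<exists>w. set w \<subseteq> weyl_gens r s \<and> word_deg w = \<nu> - \<mu> \<and> word_coeff neg_coords w (weight \<nu>) \<noteq> 0"
  using assms
proof (induction "\<Sum>i<n. nat \<bar>\<nu> i - \<mu> i\<bar>" arbitrary: \<nu> rule: less_induct)
  case less
  show ?case
  proof (cases "\<nu> = \<mu>")
    case True
    then show ?thesis by (intro exI[of _ "[]"]) auto
  next
    case False
    then obtain i where neq: "\<nu> i \<noteq> \<mu> i" by auto
    have i: "i < n"
    proof (rule ccontr)
      assume "\<not> i < n"
      then show False using neq less.prems(3,4) by simp
    qed
    define d where "d = gen_deg (Gen_X i)"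
    define e where "e = (if \<nu> i < \<mu> i then d else - d)"
    have ei: "e j = (if j = i then (if \<nu> i < \<mu> i then 1 else -1) else 0)" for j
      by (simp add: e_def d_def)
    have ins: "inside (\<nu> + e)" unfolding inside_iff
    proof
      fix j assume j: "j \<in> int_coords"
      have "if j \<in> neg_coords then int_val j + \<nu> j < 0 else 0 \<le> int_val j + \<nu> j"
        "if j \<in> neg_coords then int_val j + \<mu> j < 0 else 0 \<le> int_val j + \<mu> j"
        using less.prems(1,2) j unfolding inside_iff by blast+
      then show "if j \<in> neg_coords then int_val j + (\<nu> + e) j < 0 else 0 \<le> int_val j + (\<nu> + e) j"
        using neq by (auto simp: ei split: if_splits)
    qed
    have supp: "\<forall>j\<ge>n. (\<nu> + e) j = 0" using less.prems(3) i by (simp add: ei)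
    have "(\<Sum>j<n. nat \<bar>(\<nu> + e) j - \<mu> j\<bar>) < (\<Sum>j<n. nat \<bar>\<nu> j - \<mu> j\<bar>)"
    proof (rule sum_strict_mono_ex1)
      show "\<forall>x\<in>{..<n}. nat \<bar>(\<nu> + e) x - \<mu> x\<bar> \<le> nat \<bar>\<nu> x - \<mu> x\<bar>" using neq by (auto simp: ei)
      show "\<exists>a\<in>{..<n}. nat \<bar>(\<nu> + e) a - \<mu> a\<bar> < nat \<bar>\<nu> a - \<mu> a\<bar>"
        using neq i by (intro bexI[of _ i]) (auto simp: ei)
    qed simp
    from less.hyps[OF this ins less.prems(2) supp less.prems(4)]
    obtain w where w: "set w \<subseteq> weyl_gens r s" "word_deg w = \<nu> + e - \<mu>" "word_coeff neg_coords w (weight (\<nu> + e)) \<noteq> 0"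
      by blast
    have "\<exists>a\<in>weyl_gens r s. gen_deg a = - e \<and> gen_coeff neg_coords a (weight \<nu>) \<noteq> 0"
    proof (cases "\<nu> i < \<mu> i")
      case True
      then have "e = d" by (simp add: e_def)
      then show ?thesis using step_down[OF i, of "\<nu> + d"] less.prems(1) by (simp add: d_def)
    next
      case False
      then have "e = - d" by (simp add: e_def)
      then show ?thesis using step_up[OF i, of "\<nu> - d"] less.prems(1) i
        by (intro bexI[of _ "Gen_X i"]) (auto simp: d_def weyl_gens_def)
    qed
    then obtain a where a: "a \<in> weyl_gens r s" "gen_deg a = - e" "gen_coeff neg_coords a (weight \<nu>) \<noteq> 0" by blast
    have "word_deg (a # w) = \<nu> - \<mu>" using a w by simp
    moreover have "weight \<nu> - ivec (gen_deg a) = weight (\<nu> + e)" unfolding weight_diff a(2) diff_minus_eq_add ..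
    then have "word_coeff neg_coords (a # w) (weight \<nu>) \<noteq> 0" using a w by simp
    ultimately show ?thesis using a(1) w(1) by (intro exI[of _ "a # w"]) simp
  qed
qed

lemma connecting_word:
  assumes "\<nu> \<in> orthant" "\<mu> \<in> orthant"
  shows "\<exists>w. word w \<in> invF \<and> word_deg w = \<nu> - \<mu> \<and> word_coeff neg_coords w (weight \<nu>) \<noteq> 0 \<and> set w \<subseteq> weyl_gens r s"
proof -
  have "\<nu> \<in> lat" "\<mu> \<in> lat" "inside \<nu>" "inside \<mu>" using assms by (auto simp: orthant_inside)
  moreover from this obtain w where "set w \<subseteq> weyl_gens r s" "word_deg w = \<nu> - \<mu>" "word_coeff neg_coords w (weight \<nu>) \<noteq> 0"
    using connecting_word_inside[of \<nu> \<mu>] supp by blast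
  ultimately show ?thesis using word_invF[of w] diff_mem[of \<nu> \<mu>] by auto
qed

subsection \<open>Annihilators\<close>

text \<open>The invariant elements that act as zero on all weights of the orthant: representatives of the
annihilator of \<open>L(\<alpha>)\<close>.\<close>

definition annF :: "'k free_alg set"
  where "annF = {p \<in> invF. \<forall>\<nu>\<in>orthant. \<forall>\<mu>\<in>orthant. entry p (\<nu> - \<mu>) \<nu> = 0}"

text \<open>The invariant elements that kill the weight vector of \<open>\<alpha>\<close>: representatives of the kernel of
\<open>B \<rightarrow> L(\<alpha>)\<close>.\<close>

definition annF0 :: "'k free_alg set"
  where "annF0 = {p \<in> invF. \<forall>\<nu>\<in>orthant. entry p \<nu> \<nu> = 0}"

lemma annF_annF0: "annF \<subseteq> annF0"
proof
  fix p assume "p \<in> annF"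
  then have "p \<in> invF" "\<forall>\<nu>\<in>orthant. entry p (\<nu> - 0) \<nu> = 0" using zero_orthant unfolding annF_def by blast+
  then show "p \<in> annF0" unfolding annF0_def diff_zero by blast
qed

lemma WI_annF: "p \<in> WI \<Longrightarrow> p \<in> annF" by (simp add: annF_def WI_invF entry_WI)

lemma annF_add: "p \<in> annF \<Longrightarrow> q \<in> annF \<Longrightarrow> p + q \<in> annF" by (simp add: annF_def invF_add entry_add)
lemma annF_diff: "p \<in> annF \<Longrightarrow> q \<in> annF \<Longrightarrow> p - q \<in> annF" by (simp add: annF_def invF_diff entry_diff)
lemma annF0_add: "p \<in> annF0 \<Longrightarrow> q \<in> annF0 \<Longrightarrow> p + q \<in> annF0" by (simp add: annF0_def invF_add entry_add)

lemma annF_rmult: "p \<in> annF \<Longrightarrow> q \<in> invF \<Longrightarrow> p * q \<in> annF"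
proof -
  assume p: "p \<in> annF" and q: "q \<in> invF"
  have "entry (p * q) (\<nu> - \<mu>) \<nu> = 0" if o: "\<nu> \<in> orthant" "\<mu> \<in> orthant" for \<nu> \<mu>
  proof (rule ccontr)
    assume "entry (p * q) (\<nu> - \<mu>) \<nu> \<noteq> 0"
    then obtain \<kappa> where \<kappa>: "entry p \<kappa> \<nu> \<noteq> 0" "entry q (\<nu> - \<mu> - \<kappa>) (\<nu> - \<kappa>) \<noteq> 0"
      using entry_mult_nonzero by blast
    have "(\<nu> - \<kappa>) - (\<nu> - \<mu> - \<kappa>) \<in> orthant" using o by simp
    then have "\<nu> - \<kappa> \<in> orthant" using entry_leaving[OF q] \<kappa>(2) by blast
    then have "entry p (\<nu> - (\<nu> - \<kappa>)) \<nu> = 0" using p o unfolding annF_def by blast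
    then show False using \<kappa>(1) by simp
  qed
  then show ?thesis using p q by (auto simp: annF_def invF_mult)
qed

lemma annF_lmult: "p \<in> annF \<Longrightarrow> q \<in> invF \<Longrightarrow> q * p \<in> annF"
proof -
  assume p: "p \<in> annF" and q: "q \<in> invF"
  have pG: "p \<in> invF" using p by (simp add: annF_def)
  have "entry (q * p) (\<nu> - \<mu>) \<nu> = 0" if o: "\<nu> \<in> orthant" "\<mu> \<in> orthant" for \<nu> \<mu>
  proof (rule ccontr)
    assume "entry (q * p) (\<nu> - \<mu>) \<nu> \<noteq> 0"
    then obtain \<kappa> where \<kappa>: "entry q \<kappa> \<nu> \<noteq> 0" "entry p (\<nu> - \<mu> - \<kappa>) (\<nu> - \<kappa>) \<noteq> 0"
      using entry_mult_nonzero by blast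
    have "(\<nu> - \<kappa>) - (\<nu> - \<mu> - \<kappa>) \<in> orthant" using o by simp
    then have "\<nu> - \<kappa> \<in> orthant" using entry_leaving[OF pG] \<kappa>(2) by blast
    then have "entry p ((\<nu> - \<kappa>) - \<mu>) (\<nu> - \<kappa>) = 0" using p o unfolding annF_def by blast
    then show False using \<kappa>(2) by (simp add: algebra_simps)
  qed
  then show ?thesis using pG q by (auto simp: annF_def invF_mult)
qed

lemma annF0_lmult: "p \<in> annF0 \<Longrightarrow> q \<in> invF \<Longrightarrow> q * p \<in> annF0"
proof -
  assume p: "p \<in> annF0" and q: "q \<in> invF"
  have pG: "p \<in> invF" using p by (simp add: annF0_def)
  have "entry (q * p) \<nu> \<nu> = 0" if o: "\<nu> \<in> orthant" for \<nu>
  proof (rule ccontr)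
    assume "entry (q * p) \<nu> \<nu> \<noteq> 0"
    then obtain \<kappa> where \<kappa>: "entry q \<kappa> \<nu> \<noteq> 0" "entry p (\<nu> - \<kappa>) (\<nu> - \<kappa>) \<noteq> 0"
      using entry_mult_nonzero by blast
    have "(\<nu> - \<kappa>) - (\<nu> - \<kappa>) \<in> orthant" using zero_orthant by simp
    then have "\<nu> - \<kappa> \<in> orthant" using entry_leaving[OF pG] \<kappa>(2) by blast
    then show False using \<kappa>(2) p unfolding annF0_def by blast
  qed
  then show ?thesis using pG q by (auto simp: annF0_def invF_mult)
qed

text \<open>The weight vector of \<open>\<alpha>\<close> generates the module, because words connect it to every other weight.\<close>

lemma annF_iff:
  assumes p: "p \<in> invF"
  shows "p \<in> annF \<longleftrightarrow> (\<forall>q\<in>invF. p * q \<in> annF0)"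
proof
  assume "p \<in> annF"
  then show "\<forall>q\<in>invF. p * q \<in> annF0" using annF_rmult annF_annF0 by blast
next
  assume all: "\<forall>q\<in>invF. p * q \<in> annF0"
  have "entry p (\<nu> - \<mu>) \<nu> = 0" if o: "\<nu> \<in> orthant" "\<mu> \<in> orthant" for \<nu> \<mu>
  proof -
    obtain w where w: "word w \<in> invF" "word_deg w = \<mu>" "word_coeff neg_coords w (weight \<mu>) \<noteq> 0"
      using connecting_word[OF o(2) zero_orthant] by auto
    have eq: "\<kappa> = \<nu> - \<mu> \<longleftrightarrow> \<nu> - \<kappa> = \<mu>" for \<kappa> by (auto simp: algebra_simps)
    have "0 = entry (p * word w) \<nu> \<nu>" using all w(1) o unfolding annF0_def by auto
    also have "\<dots> = (\<Sum>\<kappa>\<in>degs p. if \<kappa> = \<nu> - \<mu> then entry p (\<nu> - \<mu>) \<nu> * word_coeff neg_coords w (weight \<mu>) else 0)"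
      unfolding entry_mult entry_word w(2) by (rule sum.cong) (auto simp: eq)
    also have "\<dots> = entry p (\<nu> - \<mu>) \<nu> * word_coeff neg_coords w (weight \<mu>)"
      using entry_outside_degs[of p "\<nu> - \<mu>" \<nu>] by (auto simp: finite_degs)
    finally show ?thesis using w(3) by simp
  qed
  then show "p \<in> annF" using p by (simp add: annF_def)
qed

lemma SF_annF_iff: "p \<in> SF \<Longrightarrow> p \<in> annF \<longleftrightarrow> (\<forall>\<nu>\<in>orthant. evalF p (weight \<nu>) = 0)"
  by (auto simp: annF_def SF_invF entry_SF)

end

section \<open>Homogeneous components\<close>

lemma fconst_bracket:
  fixes u v :: "'k::field free_alg"
  shows "u * (fconst c * v) - (fconst c * v) * u = fconst c * (u * v - v * u)"
proof -
  have "u * (fconst c * v) = fconst c * (u * v)"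
    unfolding mult.assoc[symmetric] fconst_commute[of c u] ..
  then show ?thesis by (simp add: right_diff_distrib mult.assoc)
qed

lemma fconst_left_commute:
  fixes v :: "'k::field free_alg"
  shows "fconst c * (fconst d * v) = fconst d * (fconst c * v)"
  unfolding mult.assoc[symmetric] fconst_mult[symmetric] by (simp only: mult.commute)

text \<open>A subspace that is stable under the commutators with the \<open>\<pi>\<^sub>i\<close> contains the homogeneous components of
its elements, since these are eigenvectors with distinct systems of eigenvalues.\<close>

lemma homogeneous_component_mem:
  fixes H :: "'k::field_char_0 free_alg set"
  assumes H: "\<And>p. p \<in> H \<Longrightarrow> p \<in> carrier (free_ring r s)" "\<And>p. p \<in> weyl_ideal r s \<Longrightarrow> p \<in> H"
    "\<And>p q. p \<in> H \<Longrightarrow> q \<in> H \<Longrightarrow> p + q \<in> H" "\<And>c p. p \<in> H \<Longrightarrow> fconst c * p \<in> H"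
    "\<And>i p. i < r + s \<Longrightarrow> p \<in> H \<Longrightarrow> euler i * p - p * euler i \<in> H"
    and fin: "finite F" and \<delta>0: "\<delta>0 \<notin> F"
    and t: "\<And>\<delta>. \<delta> \<in> insert \<delta>0 F \<Longrightarrow> t \<delta> \<in> carrier (free_ring r s) \<and> (\<forall>i\<ge>r + s. \<delta> i = 0) \<and>
      (\<forall>i<r + s. weq r s (euler i * t \<delta> - t \<delta> * euler i) (fconst (of_int (\<delta> i)) * t \<delta>))"
    and sum: "(\<Sum>\<delta>\<in>insert \<delta>0 F. t \<delta>) \<in> H"
  shows "t \<delta>0 \<in> H"
  using fin \<delta>0 t sum
proof (induction F arbitrary: t rule: finite_induct)
  case empty
  then show ?case by simp
next
  case (insert \<mu> F)
  have weqH: "q \<in> H" if "p \<in> H" "weq r s q p" for p q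
    using H(3)[OF that(1) H(2), of "q - p"] that(2) by (simp add: weq_def)
  let ?A = "insert \<delta>0 (insert \<mu> F)"
  let ?t = "\<Sum>\<delta>\<in>?A. t \<delta>"
  have "\<mu> \<noteq> \<delta>0" using insert.prems(1) by auto
  then obtain i where neq: "\<mu> i \<noteq> \<delta>0 i" by auto
  have i: "i < r + s"
  proof (rule ccontr)
    assume "\<not> i < r + s"
    moreover have "\<forall>i\<ge>r + s. \<mu> i = 0" "\<forall>i\<ge>r + s. \<delta>0 i = 0"
      using insert.prems(2)[of \<mu>] insert.prems(2)[of \<delta>0] by blast+
    ultimately show False using neq by simp
  qed
  define d where "d \<delta> = (of_int (\<delta> i) - of_int (\<mu> i)) / (of_int (\<delta>0 i) - of_int (\<mu> i) :: 'k)" for \<delta> :: "nat \<Rightarrow> int"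
  have ne: "of_int (\<delta>0 i) - of_int (\<mu> i) \<noteq> (0 :: 'k)" using neq by simp
  \<comment> \<open>Applying the commutator with \<open>\<pi>\<^sub>i\<close> minus \<open>\<mu>\<^sub>i\<close>, and
    rescaling, kills the component \<open>\<mu>\<close> and fixes the component \<open>\<delta>0\<close>.\<close>
  define t' where "t' \<delta> = fconst (d \<delta>) * t \<delta>" for \<delta>
  have FFt: "t \<delta> \<in> carrier (free_ring r s)" if "\<delta> \<in> ?A" for \<delta> using insert.prems(2)[OF that] by blast
  have s0: "fconst (1 / (of_int (\<delta>0 i) - of_int (\<mu> i))) *
      ((euler i * ?t - ?t * euler i) + fconst (- of_int (\<mu> i)) * ?t) \<in> H"
    by (rule H(4)[OF H(3)[OF H(5)[OF i insert.prems(3)] H(4)[OF insert.prems(3)]]])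
  have "weq r s (\<Sum>\<delta>\<in>?A. t' \<delta>) (fconst (1 / (of_int (\<delta>0 i) - of_int (\<mu> i))) *
      ((euler i * ?t - ?t * euler i) + fconst (- of_int (\<mu> i)) * ?t))"
  proof -
    have "weq r s (t' \<delta>) (fconst (1 / (of_int (\<delta>0 i) - of_int (\<mu> i))) *
      ((euler i * t \<delta> - t \<delta> * euler i) + fconst (- of_int (\<mu> i)) * t \<delta>))" if "\<delta> \<in> ?A" for \<delta>
    proof -
      have act: "weq r s (euler i * t \<delta> - t \<delta> * euler i) (fconst (of_int (\<delta> i)) * t \<delta>)"
        using insert.prems(2)[OF that] i by blast
      have "t' \<delta> = fconst (1 / (of_int (\<delta>0 i) - of_int (\<mu> i))) *
          (fconst (of_int (\<delta> i)) * t \<delta> + fconst (- of_int (\<mu> i)) * t \<delta>)"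
        unfolding t'_def d_def distrib_right[symmetric] mult.assoc[symmetric]
        unfolding fconst_add[symmetric] fconst_mult[symmetric] by simp
      also have "weq r s \<dots> (fconst (1 / (of_int (\<delta>0 i) - of_int (\<mu> i))) *
          ((euler i * t \<delta> - t \<delta> * euler i) + fconst (- of_int (\<mu> i)) * t \<delta>))"
        by (rule weq_lmult[OF weq_add[OF weq_sym[OF act] weq_refl] FF_const])
      finally show ?thesis .
    qed
    then have "weq r s (\<Sum>\<delta>\<in>?A. t' \<delta>) (\<Sum>\<delta>\<in>?A. fconst (1 / (of_int (\<delta>0 i) - of_int (\<mu> i))) *
      ((euler i * t \<delta> - t \<delta> * euler i) + fconst (- of_int (\<mu> i)) * t \<delta>))" by (rule weq_sum)
    then show ?thesis
      by (simp only: sum_distrib_left[symmetric] sum_distrib_right[symmetric] sum.distrib sum_subtractf)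
  qed
  from weqH[OF s0 this] have "(\<Sum>\<delta>\<in>?A. t' \<delta>) \<in> H" .
  moreover have "t' \<mu> = 0" by (simp add: t'_def d_def)
  then have "(\<Sum>\<delta>\<in>?A. t' \<delta>) = (\<Sum>\<delta>\<in>insert \<delta>0 F. t' \<delta>)"
    using insert.hyps insert.prems(1) by simp
  ultimately have sum': "(\<Sum>\<delta>\<in>insert \<delta>0 F. t' \<delta>) \<in> H" by simp
  have "t' \<delta> \<in> carrier (free_ring r s) \<and> (\<forall>i\<ge>r + s. \<delta> i = 0) \<and>
      (\<forall>i<r + s. weq r s (euler i * t' \<delta> - t' \<delta> * euler i) (fconst (of_int (\<delta> i)) * t' \<delta>))"
    if "\<delta> \<in> insert \<delta>0 F" for \<delta>
  proof -
    have \<delta>: "\<delta> \<in> ?A" using that by auto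
    have "weq r s (euler j * t' \<delta> - t' \<delta> * euler j) (fconst (of_int (\<delta> j)) * t' \<delta>)" if j: "j < r + s" for j
    proof -
      have "euler j * t' \<delta> - t' \<delta> * euler j = fconst (d \<delta>) * (euler j * t \<delta> - t \<delta> * euler j)"
        unfolding t'_def by (rule fconst_bracket)
      also have "weq r s \<dots> (fconst (d \<delta>) * (fconst (of_int (\<delta> j)) * t \<delta>))"
        using insert.prems(2)[OF \<delta>] j by (intro weq_lmult[OF _ FF_const]) blast
      also have "\<dots> = fconst (of_int (\<delta> j)) * t' \<delta>"
        unfolding t'_def by (rule fconst_left_commute)
      finally show ?thesis .
    qed
    then show ?thesis using insert.prems(2)[OF \<delta>] by (auto simp: t'_def intro: FF_mult FF_const)
  qed
  from insert.IH[OF _ this sum'] have "t' \<delta>0 \<in> H" using insert.prems(1) by auto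
  moreover have "t' \<delta>0 = t \<delta>0" using ne by (simp add: t'_def d_def)
  ultimately show ?case by simp
qed

section \<open>The modules and ideals of the statement in coordinates\<close>

context weight_data
begin

interpretation W: ring "weyl r s :: 'k weyl ring" by (rule ring_weyl)

abbreviation INV :: "'k weyl ring" where "INV \<equiv> invariants r s g"
abbreviation SH :: "'k weyl set" where "SH \<equiv> shift_ideal r s g chi"
abbreviation BB :: "'k weyl set ring" where "BB \<equiv> B_ring r s g chi"

lemma INV_simps: "monoid.mult INV = monoid.mult (weyl r s)" "one INV = one (weyl r s)"
  "zero INV = zero (weyl r s)" "add INV = add (weyl r s)"
  by (simp_all add: invariants_def)

lemma INV_carrier: "carrier INV = cls ` invF"
proof -
  have commutes_iff: "(\<forall>t\<in>g. t \<otimes>\<^bsub>weyl r s\<^esub> cls p \<ominus>\<^bsub>weyl r s\<^esub> cls p \<otimes>\<^bsub>weyl r s\<^esub> t = \<zero>\<^bsub>weyl r s\<^esub>) \<longleftrightarrow> p \<in> invF"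
    if p: "p \<in> FF" for p
  proof -
    have "cls (torus_elt r s c) \<otimes>\<^bsub>weyl r s\<^esub> cls p \<ominus>\<^bsub>weyl r s\<^esub> cls p \<otimes>\<^bsub>weyl r s\<^esub> cls (torus_elt r s c) = \<zero>\<^bsub>weyl r s\<^esub>
      \<longleftrightarrow> weq_commute r s (torus_elt r s c) p" for c
      unfolding class_mult[OF p torus_elt_FF, symmetric] class_mult[OF torus_elt_FF p, symmetric]
        class_diff[OF FF_mult[OF torus_elt_FF p] FF_mult[OF p torus_elt_FF], symmetric]
      by (simp add: class_zero_iff FF_diff FF_mult torus_elt_FF p weq_commute_def weq_def)
    moreover have "(\<forall>t\<in>g. Q t) \<longleftrightarrow> (\<forall>c\<in>gcoords. Q (cls (torus_elt r s c)))" for Q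
      using g_torus_elt unfolding gcoords_def by blast
    ultimately show ?thesis using p by (simp only: invF_def mem_Collect_eq simp_thms)
  qed
  have mem: "a \<in> carrier INV \<longleftrightarrow> a \<in> carrier (weyl r s) \<and>
      (\<forall>t\<in>g. t \<otimes>\<^bsub>weyl r s\<^esub> a \<ominus>\<^bsub>weyl r s\<^esub> a \<otimes>\<^bsub>weyl r s\<^esub> t = \<zero>\<^bsub>weyl r s\<^esub>)" for a
    by (simp add: invariants_def)
  show ?thesis
  proof (intro equalityI subsetI)
    fix a assume a: "a \<in> carrier INV"
    then obtain p where p: "p \<in> FF" "a = cls p" unfolding mem using class_surj by blast
    then show "a \<in> cls ` invF" using a unfolding mem p(2) commutes_iff[OF p(1)] by blast
  next
    fix a assume "a \<in> cls ` invF"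
    then obtain p where p: "p \<in> invF" "a = cls p" by blast
    then show "a \<in> carrier INV"
      unfolding mem p(2) commutes_iff[OF invF_FF[OF p(1)]] using class_closed invF_FF by blast
  qed
qed

lemma ring_INV: "ring INV"
proof -
  have "subring (cls ` invF) (weyl r s)"
  proof (rule W.subringI)
    show "cls ` invF \<subseteq> carrier (weyl r s)" by (auto intro: class_closed invF_FF)
    show "\<one>\<^bsub>weyl r s\<^esub> \<in> cls ` invF" using SF_invF[OF one_SF] class_one[of r s] by (metis image_eqI)
    show "\<ominus>\<^bsub>weyl r s\<^esub> h \<in> cls ` invF" if h: "h \<in> cls ` invF" for h
    proof -
      obtain p where p: "p \<in> invF" "h = cls p" using h by blast
      have "cls (0 - p) \<in> cls ` invF" by (intro imageI invF_diff SF_invF zero_SF p)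
      then show ?thesis using p class_minus[OF invF_FF[OF p(1)]] by simp
    qed
    show "h1 \<otimes>\<^bsub>weyl r s\<^esub> h2 \<in> cls ` invF" if "h1 \<in> cls ` invF" "h2 \<in> cls ` invF" for h1 h2
      using that by (auto simp: class_mult[symmetric] invF_FF invF_mult)
    show "h1 \<oplus>\<^bsub>weyl r s\<^esub> h2 \<in> cls ` invF" if "h1 \<in> cls ` invF" "h2 \<in> cls ` invF" for h1 h2
      using that by (auto simp: class_add[symmetric] invF_FF invF_add)
  qed
  from W.subring_is_ring[OF this] show ?thesis
    unfolding INV_carrier[symmetric] by (simp add: invariants_def)
qed

interpretation INV: ring INV by (rule ring_INV)

lemma ideal_class_annF: "ideal (cls ` annF) INV"
proof (rule idealI[OF ring_INV])
  have KG: "p \<in> annF \<Longrightarrow> p \<in> invF" for p by (simp add: annF_def)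
  have annF0: "0 \<in> annF" by (rule WI_annF[OF WI_zero])
  show "subgroup (cls ` annF) (add_monoid INV)"
  proof (rule INV.add.subgroupI)
    show "cls ` annF \<subseteq> carrier INV" using KG by (auto simp: INV_carrier)
    show "cls ` annF \<noteq> {}" using annF0 by blast
    fix a assume "a \<in> cls ` annF"
    then obtain p where p: "p \<in> annF" "a = cls p" by blast
    have m: "- p \<in> annF" using annF_diff[OF annF0 p(1)] by simp
    have "cls (- p) \<oplus>\<^bsub>INV\<^esub> a = \<zero>\<^bsub>INV\<^esub>"
      unfolding INV_simps p(2) class_add[OF invF_FF invF_FF, OF KG KG, OF m p(1), symmetric]
      by (simp add: class_zero)
    then have "\<ominus>\<^bsub>INV\<^esub> a = cls (- p)"
      using KG[OF m] KG[OF p(1)] p(2) by (intro INV.minus_equality) (auto simp: INV_carrier)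
    then show "\<ominus>\<^bsub>INV\<^esub> a \<in> cls ` annF" using m by simp
  next
    fix a b assume "a \<in> cls ` annF" "b \<in> cls ` annF"
    then show "a \<oplus>\<^bsub>INV\<^esub> b \<in> cls ` annF"
      using KG by (auto simp: INV_simps class_add[symmetric] invF_FF annF_add)
  qed
  fix a x assume "a \<in> cls ` annF" "x \<in> carrier INV"
  then show "x \<otimes>\<^bsub>INV\<^esub> a \<in> cls ` annF" "a \<otimes>\<^bsub>INV\<^esub> x \<in> cls ` annF"
    using KG by (auto simp: INV_simps INV_carrier class_mult[symmetric] invF_FF annF_lmult annF_rmult)
qed

lemma shift_generators: "{t \<ominus>\<^bsub>weyl r s\<^esub> scal r s (chi t) |t. t \<in> g} \<subseteq> cls ` annF"
proof
  fix x assume "x \<in> {t \<ominus>\<^bsub>weyl r s\<^esub> scal r s (chi t) |t. t \<in> g}"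
  then obtain c where c: "c \<in> gcoords" "x = cls (torus_elt r s c) \<ominus>\<^bsub>weyl r s\<^esub> scal r s (chi (cls (torus_elt r s c)))"
    using g_torus_elt by blast
  let ?p = "torus_elt r s c - fconst (\<Sum>i<n. c i * a0 i)"
  have x: "x = cls ?p"
    unfolding c(2) chi_torus_elt[OF c(1)] scal_cls by (simp add: class_diff torus_elt_FF FF_const)
  have p: "?p \<in> SF" by (intro symF_diff torus_elt_SF symF.const)
  have "evalF ?p (weight \<nu>) = 0" if "\<nu> \<in> orthant" for \<nu>
  proof -
    have "(\<Sum>i<n. c i * of_int (\<nu> i)) = 0" using orthant_L[OF that] c(1) by (simp add: lat_def)
    then show ?thesis
      by (simp add: evalF_diff evalF_torus_elt evalF_const weight_def distrib_left sum.distrib)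
  qed
  then show "x \<in> cls ` annF" unfolding x using SF_annF_iff[OF p] by blast
qed

text \<open>An element \<open>t - \<chi>(t)\<close> with \<open>t \<in> g\<close> acts on every weight of the orthant by \<open>\<alpha>(t) - \<chi>(t) = 0\<close>.\<close>

lemma shift_annF: "SH \<subseteq> cls ` annF"
  unfolding shift_ideal_def by (rule INV.genideal_minimal[OF ideal_class_annF shift_generators])

lemma ideal_SH: "ideal SH INV"
proof -
  have "cls ` annF \<subseteq> carrier INV" by (auto simp: INV_carrier annF_def)
  then show ?thesis unfolding shift_ideal_def using shift_generators
    by (intro INV.genideal_ideal) blast
qed

interpretation SH: ideal SH INV by (rule ideal_SH)

lemma ring_BB: "ring BB" unfolding B_ring_def by (rule SH.quotient_is_ring)
interpretation BB: ring BB by (rule ring_BB)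

definition to_B :: "'k free_alg \<Rightarrow> 'k weyl set" where "to_B p = SH +>\<^bsub>INV\<^esub> cls p"

lemma to_B_hom: "(\<lambda>x. SH +>\<^bsub>INV\<^esub> x) \<in> ring_hom INV BB"
  using SH.rcos_ring_hom unfolding B_ring_def by simp

lemma cls_INV: "p \<in> invF \<Longrightarrow> cls p \<in> carrier INV" by (auto simp: INV_carrier)

lemma to_B_carrier: "carrier BB = to_B ` invF"
  by (auto simp: B_ring_def carrier_Quot INV_carrier to_B_def)
lemma to_B_closed: "p \<in> invF \<Longrightarrow> to_B p \<in> carrier BB" by (simp add: to_B_carrier)
lemma to_B_add: "p \<in> invF \<Longrightarrow> q \<in> invF \<Longrightarrow> to_B (p + q) = to_B p \<oplus>\<^bsub>BB\<^esub> to_B q"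
  using ring_hom_add[OF to_B_hom cls_INV cls_INV, of p q] by (simp add: to_B_def class_add invF_FF INV_simps)
lemma to_B_mult: "p \<in> invF \<Longrightarrow> q \<in> invF \<Longrightarrow> to_B (p * q) = to_B p \<otimes>\<^bsub>BB\<^esub> to_B q"
  using ring_hom_mult[OF to_B_hom cls_INV cls_INV, of p q] by (simp add: to_B_def class_mult invF_FF INV_simps)
lemma to_B_WI: "p \<in> WI \<Longrightarrow> to_B p = \<zero>\<^bsub>BB\<^esub>"
proof -
  assume p: "p \<in> WI"
  have "cls p = \<zero>\<^bsub>INV\<^esub>" using class_zero_iff[OF WI_FF[OF p]] p by (simp add: INV_simps)
  then show ?thesis using INV.a_rcos_zero[OF ideal_SH SH.zero_closed] by (simp add: to_B_def B_ring_def zero_Quot)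
qed
lemma to_B_zero: "to_B 0 = \<zero>\<^bsub>BB\<^esub>" by (rule to_B_WI[OF WI_zero])
lemma to_B_minus: "p \<in> invF \<Longrightarrow> to_B (- p) = \<ominus>\<^bsub>BB\<^esub> to_B p"
proof -
  assume p: "p \<in> invF"
  have m: "- p \<in> invF" using invF_diff[OF SF_invF[OF zero_SF] p] by simp
  have "to_B (- p) \<oplus>\<^bsub>BB\<^esub> to_B p = \<zero>\<^bsub>BB\<^esub>" using to_B_add[OF m p] by (simp add: to_B_zero)
  then show ?thesis using to_B_closed m p BB.minus_equality by metis
qed
lemma to_B_diff: "p \<in> invF \<Longrightarrow> q \<in> invF \<Longrightarrow> to_B (p - q) = to_B p \<ominus>\<^bsub>BB\<^esub> to_B q"
  using to_B_add[of p "- q"] to_B_minus[of q] invF_diff[OF SF_invF[OF zero_SF], of q] by (simp add: a_minus_def)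
lemma to_B_weq: "p \<in> invF \<Longrightarrow> q \<in> invF \<Longrightarrow> weq r s p q \<Longrightarrow> to_B p = to_B q"
  using class_eq_iff[of p r s q] by (simp add: invF_FF to_B_def)

lemma to_B_zero_annF: "p \<in> invF \<Longrightarrow> to_B p = \<zero>\<^bsub>BB\<^esub> \<Longrightarrow> p \<in> annF"
proof -
  assume p: "p \<in> invF" and z: "to_B p = \<zero>\<^bsub>BB\<^esub>"
  have "SH +>\<^bsub>INV\<^esub> cls p = SH" using z by (simp add: to_B_def B_ring_def zero_Quot)
  then have "cls p \<in> SH" using SH.rcos_const_imp_mem[OF cls_INV[OF p]] by simp
  then obtain k where k: "k \<in> annF" "cls p = cls k" using shift_annF by blast
  then have "p - k \<in> WI" using class_eq_iff[of p r s k] p by (simp add: invF_FF annF_def weq_def)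
  then show ?thesis using annF_add[OF k(1) WI_annF] by fastforce
qed

lemma to_B_eq_diff: "p \<in> invF \<Longrightarrow> q \<in> invF \<Longrightarrow> to_B p = to_B q \<Longrightarrow> p - q \<in> annF"
  using to_B_zero_annF[OF invF_diff, of p q] to_B_diff[of p q] to_B_closed[of q] by (simp add: BB.r_right_minus_eq)

lemma to_B_annF0_iff: "p \<in> invF \<Longrightarrow> to_B p \<in> to_B ` annF0 \<longleftrightarrow> p \<in> annF0"
proof
  assume p: "p \<in> invF" and "to_B p \<in> to_B ` annF0"
  then obtain k where k: "k \<in> annF0" "to_B p = to_B k" by blast
  then have "p - k \<in> annF0" using to_B_eq_diff[OF p, of k] annF_annF0 by (auto simp: annF0_def)
  from annF0_add[OF this k(1)] show "p \<in> annF0" by simp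
qed blast

lemma max_ideal_B_eq:
  "\<gamma> \<in> dual r s (tt r s) \<Longrightarrow> max_ideal_B r s g chi \<gamma> = to_B ` {f \<in> SF. evalF f (pt r s \<gamma>) = 0}"
  unfolding max_ideal_B_def by (auto simp: max_ideal_eq to_B_def)

abbreviation RM :: "('k weyl set, 'k weyl set) module" where "RM \<equiv> regular_module BB"
abbreviation GI :: "'k weyl set set" where "GI \<equiv> gen_left_ideal BB (max_ideal_B r s g chi \<alpha>)"
abbreviation MM :: "('k weyl set, 'k weyl set set) module" where "MM \<equiv> M_module r s g chi \<alpha>"

interpretation RM: left_module BB RM by (rule left_module_regular[OF ring_BB])

lemma RM_simps: "carrier RM = carrier BB" "add RM = add BB" "zero RM = zero BB"
  "smult RM = monoid.mult BB"
  by (simp_all add: regular_module_def)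

lemma max_alpha: "max_ideal_B r s g chi \<alpha> = to_B ` {f \<in> SF. evalF f a0 = 0}"
  by (simp add: max_ideal_B_eq[OF alpha_dual] a0_def)

lemma max_alpha_carrier: "max_ideal_B r s g chi \<alpha> \<subseteq> carrier BB"
  unfolding max_alpha by (auto intro!: to_B_closed SF_invF)

lemma GI_submodule: "submodule GI BB RM"
  using gen_left_ideal(1)[OF ring_BB max_alpha_carrier] by (simp add: left_ideal_def)

lemma left_ideal_annF0: "left_ideal (to_B ` annF0) BB"
  unfolding left_ideal_def
proof (rule RM.submoduleI)
  show "to_B ` annF0 \<subseteq> carrier RM" by (auto simp: RM_simps annF0_def intro: to_B_closed)
  show "\<zero>\<^bsub>RM\<^esub> \<in> to_B ` annF0" using WI_annF[OF WI_zero] annF_annF0 to_B_zero by (auto simp: RM_simps intro!: image_eqI[of _ _ 0])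
next
  fix x y assume "x \<in> to_B ` annF0" "y \<in> to_B ` annF0"
  then obtain p q where "p \<in> annF0" "x = to_B p" "q \<in> annF0" "y = to_B q" by blast
  moreover from this have "to_B p \<oplus>\<^bsub>BB\<^esub> to_B q = to_B (p + q)" by (simp add: to_B_add annF0_def)
  ultimately show "x \<oplus>\<^bsub>RM\<^esub> y \<in> to_B ` annF0" by (auto simp: RM_simps annF0_add)
next
  fix a x assume "a \<in> carrier BB" "x \<in> to_B ` annF0"
  then obtain p q where "p \<in> invF" "a = to_B p" "q \<in> annF0" "x = to_B q" by (auto simp: to_B_carrier)
  moreover from this have "to_B p \<otimes>\<^bsub>BB\<^esub> to_B q = to_B (p * q)" by (simp add: to_B_mult annF0_def)
  ultimately show "a \<odot>\<^bsub>RM\<^esub> x \<in> to_B ` annF0" by (auto simp: RM_simps annF0_lmult)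
qed

lemma GI_annF0: "p \<in> invF \<Longrightarrow> to_B p \<in> GI \<Longrightarrow> p \<in> annF0"
proof -
  have "max_ideal_B r s g chi \<alpha> \<subseteq> to_B ` annF0"
  proof -
    have "f \<in> annF0" if "f \<in> SF" "evalF f a0 = 0" for f
      using that by (auto simp: annF0_def SF_invF entry_SF weight_zero)
    then show ?thesis unfolding max_alpha by blast
  qed
  then have "GI \<subseteq> to_B ` annF0" by (rule gen_left_ideal(3)[OF ring_BB max_alpha_carrier left_ideal_annF0])
  then show "p \<in> invF \<Longrightarrow> to_B p \<in> GI \<Longrightarrow> p \<in> annF0" using to_B_annF0_iff by blast
qed

lemma invF_max_GI: "p \<in> invF \<Longrightarrow> f \<in> SF \<Longrightarrow> evalF f a0 = 0 \<Longrightarrow> to_B (p * f) \<in> GI"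
proof -
  assume p: "p \<in> invF" and f: "f \<in> SF" "evalF f a0 = 0"
  have "to_B f \<in> GI" using gen_left_ideal(2)[OF ring_BB max_alpha_carrier] f unfolding max_alpha by blast
  from RM.submoduleD(4)[OF GI_submodule to_B_closed[OF p] this] show ?thesis
    by (simp add: RM_simps to_B_mult p SF_invF f)
qed

lemma MM_left_module: "left_module BB MM"
  unfolding M_module_def by (rule RM.left_module_quotient[OF GI_submodule])

interpretation MM: left_module BB MM by (rule MM_left_module)

definition to_M :: "'k free_alg \<Rightarrow> 'k weyl set set" where "to_M p = GI +>\<^bsub>RM\<^esub> to_B p"

lemma to_M_carrier: "carrier MM = to_M ` invF"
  unfolding M_module_def RM.quotient_carrier[OF GI_submodule] by (auto simp: RM_simps to_B_carrier to_M_def)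

lemma to_M_closed: "p \<in> invF \<Longrightarrow> to_M p \<in> carrier MM" by (simp add: to_M_carrier)

lemma to_M_zero_iff: "p \<in> invF \<Longrightarrow> to_M p = \<zero>\<^bsub>MM\<^esub> \<longleftrightarrow> to_B p \<in> GI"
  unfolding M_module_def RM.quotient_zero[OF GI_submodule] to_M_def
  by (rule RM.coset_eq_zero_iff[OF GI_submodule]) (simp add: RM_simps to_B_closed)

lemma to_M_add: "p \<in> invF \<Longrightarrow> q \<in> invF \<Longrightarrow> to_M (p + q) = to_M p \<oplus>\<^bsub>MM\<^esub> to_M q"
  unfolding M_module_def to_M_def
  by (subst RM.quotient_add[OF GI_submodule]) (simp_all add: RM_simps to_B_closed to_B_add)

lemma to_M_smult: "p \<in> invF \<Longrightarrow> q \<in> invF \<Longrightarrow> to_B p \<odot>\<^bsub>MM\<^esub> to_M q = to_M (p * q)"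
  unfolding M_module_def to_M_def
  by (subst RM.quotient_smult[OF GI_submodule]) (simp_all add: RM_simps to_B_closed to_B_mult)

lemma to_M_eq_annF0: "p \<in> invF \<Longrightarrow> q \<in> invF \<Longrightarrow> to_M p = to_M q \<Longrightarrow> p - q \<in> annF0"
proof -
  assume p: "p \<in> invF" and q: "q \<in> invF" and eq: "to_M p = to_M q"
  have d: "p - q \<in> invF" by (rule invF_diff[OF p q])
  have "to_M p = to_M (p - q) \<oplus>\<^bsub>MM\<^esub> to_M q" using to_M_add[OF d q] by simp
  then have "to_M (p - q) = \<zero>\<^bsub>MM\<^esub>" using eq to_M_closed[OF d] to_M_closed[OF q] by (metis MM.M.add.r_cancel_one)
  then show ?thesis using to_M_zero_iff[OF d] GI_annF0[OF d] by simp
qed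

lemma to_M_annF0_iff: "p \<in> invF \<Longrightarrow> to_M p \<in> to_M ` annF0 \<longleftrightarrow> p \<in> annF0"
proof
  assume p: "p \<in> invF" and "to_M p \<in> to_M ` annF0"
  then obtain k where k: "k \<in> annF0" "to_M p = to_M k" by blast
  then have "p - k \<in> annF0" using to_M_eq_annF0[OF p, of k] by (simp add: annF0_def)
  from annF0_add[OF this k(1)] show "p \<in> annF0" by simp
qed blast

lemma submodule_annF0: "submodule (to_M ` annF0) BB MM"
proof (rule MM.submoduleI)
  show "to_M ` annF0 \<subseteq> carrier MM" by (auto simp: to_M_carrier annF0_def)
  have "to_M 0 = \<zero>\<^bsub>MM\<^esub>"
    using to_M_zero_iff[OF SF_invF[OF zero_SF]] RM.submoduleD(2)[OF GI_submodule] by (simp add: to_B_zero RM_simps)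
  then show "\<zero>\<^bsub>MM\<^esub> \<in> to_M ` annF0" using WI_annF[OF WI_zero] annF_annF0 by (auto intro!: image_eqI[of _ _ 0])
next
  fix x y assume "x \<in> to_M ` annF0" "y \<in> to_M ` annF0"
  then obtain p q where "p \<in> annF0" "x = to_M p" "q \<in> annF0" "y = to_M q" by blast
  moreover from this have "to_M p \<oplus>\<^bsub>MM\<^esub> to_M q = to_M (p + q)" by (simp add: to_M_add annF0_def)
  ultimately show "x \<oplus>\<^bsub>MM\<^esub> y \<in> to_M ` annF0" by (auto simp: annF0_add)
next
  fix a x assume "a \<in> carrier BB" "x \<in> to_M ` annF0"
  then obtain p q where "p \<in> invF" "a = to_B p" "q \<in> annF0" "x = to_M q" by (auto simp: to_B_carrier)
  moreover from this have "to_B p \<odot>\<^bsub>MM\<^esub> to_M q = to_M (p * q)" by (simp add: to_M_smult annF0_def)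
  ultimately show "a \<odot>\<^bsub>MM\<^esub> x \<in> to_M ` annF0" by (auto simp: annF0_lmult)
qed

lemma component_sum: "q = (\<Sum>\<delta>\<in>degs q. \<Sum>w | w \<in> Poly_Mapping.keys q \<and> word_deg (letters w) = \<delta>.
    fconst (Poly_Mapping.lookup q w) * word (letters w))" (is "_ = sum ?h _")
  for q :: "'k free_alg"
proof -
  have "q = (\<Sum>w\<in>Poly_Mapping.keys q. fconst (Poly_Mapping.lookup q w) * word (letters w))"
    by (rule free_alg_expand)
  also have "\<dots> = sum ?h (degs q)" unfolding degs_def by (rule sum.image_gen) simp
  finally show ?thesis .
qed

text \<open>The homogeneous component of degree zero of \<open>q\<close> lies in \<open>Sym(tt)\<close> and has the same diagonal entry at
\<open>\<alpha>\<close> as \<open>q\<close>.\<close>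

lemma degree_zero_component:
  assumes H: "\<And>p. p \<in> H \<Longrightarrow> p \<in> FF" "\<And>p. p \<in> WI \<Longrightarrow> p \<in> H"
    "\<And>p q. p \<in> H \<Longrightarrow> q \<in> H \<Longrightarrow> p + q \<in> H" "\<And>c p. p \<in> H \<Longrightarrow> fconst c * p \<in> H"
    "\<And>i p. i < n \<Longrightarrow> p \<in> H \<Longrightarrow> euler i * p - p * euler i \<in> H"
    and q: "q \<in> H" "entry q 0 0 \<noteq> 0"
  shows "\<exists>f\<in>SF. f \<in> H \<and> evalF f a0 \<noteq> 0"
proof -
  define h where "h \<delta> = (\<Sum>w | w \<in> Poly_Mapping.keys q \<and> word_deg (letters w) = \<delta>.
    fconst (Poly_Mapping.lookup q w) * word (letters w))" for \<delta>
  have qF: "q \<in> FF" by (rule H(1)[OF q(1)])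
  have letters: "set (letters w) \<subseteq> weyl_gens r s" if "w \<in> Poly_Mapping.keys q" for w
    using qF that by (simp add: FF_iff)
  have z: "0 \<in> degs q" using entry_outside_degs[OF q(2)] .
  have homog: "h \<delta> \<in> FF \<and> (\<forall>i\<ge>n. \<delta> i = 0) \<and>
      (\<forall>i<n. weq r s (euler i * h \<delta> - h \<delta> * euler i) (fconst (of_int (\<delta> i)) * h \<delta>))"
    if \<delta>: "\<delta> \<in> degs q" for \<delta>
  proof (intro conjI allI impI)
    show "h \<delta> \<in> FF" unfolding h_def using letters by (intro FF_sum FF_mult FF_const FF_word) auto
    show "\<delta> i = 0" if "i \<ge> n" for i using degs_supp[OF qF \<delta> that] .
    fix i assume i: "i < n"
    have "weq r s (fconst c * (euler i * word w - word w * euler i)) (fconst c * (fconst (of_int (word_deg w i)) * word w))"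
      if "set w \<subseteq> weyl_gens r s" for c :: 'k and w
    proof (intro weq_lmult FF_const)
      have eq: "euler i * word w - word w * euler i - fconst (of_int (word_deg w i)) * word w
          = euler i * word w - word w * (euler i + fconst (of_int (word_deg w i)) :: 'k free_alg)"
        by (simp add: algebra_simps mult_of_int_commute)
      show "weq r s (euler i * word w - word w * euler i) (fconst (of_int (word_deg w i)) * word w :: 'k free_alg)"
        using euler_word[OF i that, where 'k = 'k] unfolding weq_def eq .
    qed
    then have "weq r s (\<Sum>w | w \<in> Poly_Mapping.keys q \<and> word_deg (letters w) = \<delta>.
        fconst (Poly_Mapping.lookup q w) * (euler i * word (letters w) - word (letters w) * euler i))
      (\<Sum>w | w \<in> Poly_Mapping.keys q \<and> word_deg (letters w) = \<delta>.
        fconst (Poly_Mapping.lookup q w) * (fconst (of_int (word_deg (letters w) i)) * word (letters w)))"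
      using letters by (intro weq_sum) auto
    moreover have "(\<Sum>w | w \<in> Poly_Mapping.keys q \<and> word_deg (letters w) = \<delta>.
        fconst (Poly_Mapping.lookup q w) * (euler i * word (letters w) - word (letters w) * euler i))
      = euler i * h \<delta> - h \<delta> * euler i"
      unfolding h_def sum_distrib_left sum_distrib_right sum_subtractf[symmetric] fconst_bracket ..
    moreover have "(\<Sum>w | w \<in> Poly_Mapping.keys q \<and> word_deg (letters w) = \<delta>.
        fconst (Poly_Mapping.lookup q w) * (fconst (of_int (word_deg (letters w) i)) * word (letters w)))
      = fconst (of_int (\<delta> i)) * h \<delta>"
      unfolding h_def sum_distrib_left
    proof (rule sum.cong[OF refl])
      fix w assume "w \<in> {w. w \<in> Poly_Mapping.keys q \<and> word_deg (letters w) = \<delta>}"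
      then have "word_deg (letters w) i = \<delta> i" by simp
      then show "fconst (Poly_Mapping.lookup q w) * (fconst (of_int (word_deg (letters w) i)) * word (letters w)) =
          fconst (of_int (\<delta> i)) * (fconst (Poly_Mapping.lookup q w) * word (letters w))"
        by (simp only: fconst_left_commute)
    qed
    ultimately show "weq r s (euler i * h \<delta> - h \<delta> * euler i) (fconst (of_int (\<delta> i)) * h \<delta>)"
      by (simp only:)
  qed
  have ins: "insert 0 (degs q - {0}) = degs q" using z by auto
  have hH: "h 0 \<in> H"
  proof (rule homogeneous_component_mem[of H r s "degs q - {0}" 0 h])
    show "(\<Sum>\<delta>\<in>insert 0 (degs q - {0}). h \<delta>) \<in> H"
      unfolding ins h_def component_sum[symmetric] by (rule q(1))
    fix \<delta> assume "\<delta> \<in> insert 0 (degs q - {0})"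
    then show "h \<delta> \<in> FF \<and> (\<forall>i\<ge>n. \<delta> i = 0) \<and>
      (\<forall>i<n. weq r s (euler i * h \<delta> - h \<delta> * euler i) (fconst (of_int (\<delta> i)) * h \<delta>))"
      unfolding ins by (rule homog)
  qed (use H in \<open>auto simp: finite_degs\<close>)
  have "\<exists>f\<in>SF. weq r s (h 0) f"
  proof -
    have "\<exists>F. \<forall>w. w \<in> Poly_Mapping.keys q \<and> word_deg (letters w) = 0 \<longrightarrow> F w \<in> SF \<and> weq r s (word (letters w)) (F w)"
      using degree_zero_word_symF[where 'k = 'k] letters by (intro choice allI) blast
    then obtain F where F: "\<And>w. w \<in> Poly_Mapping.keys q \<and> word_deg (letters w) = 0 \<Longrightarrow>
        F w \<in> SF \<and> weq r s (word (letters w)) (F w)" by blast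
    have "weq r s (h 0) (\<Sum>w | w \<in> Poly_Mapping.keys q \<and> word_deg (letters w) = 0. fconst (Poly_Mapping.lookup q w) * F w)"
      unfolding h_def using F by (intro weq_sum weq_lmult FF_const) auto
    then show ?thesis using F by (intro bexI) (auto intro!: symF_sum symF.mult symF.const)
  qed
  then obtain f where f: "f \<in> SF" "weq r s (h 0) f" by blast
  have "f - h 0 \<in> WI" using weq_sym[OF f(2)] by (simp add: weq_def)
  from H(3)[OF hH H(2)[OF this]] have fH: "f \<in> H" by simp
  have "entry q 0 0 = entry (h 0) 0 0"
  proof -
    have other: "entry (h \<delta>) 0 0 = 0" if "\<delta> \<noteq> 0" for \<delta>
      unfolding h_def entry_sum
    proof (rule sum.neutral, intro ballI)
      fix w assume "w \<in> {w. w \<in> Poly_Mapping.keys q \<and> word_deg (letters w) = \<delta>}"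
      then show "entry (fconst (Poly_Mapping.lookup q w) * word (letters w)) 0 0 = 0"
        using that by (simp add: entry_SF_mult[OF symF.const] entry_word)
    qed
    have "entry q 0 0 = entry (\<Sum>\<delta>\<in>degs q. h \<delta>) 0 0" unfolding h_def component_sum[symmetric] ..
    also have "\<dots> = (\<Sum>\<delta>\<in>degs q. if \<delta> = 0 then entry (h 0) 0 0 else 0)"
      unfolding entry_sum by (rule sum.cong) (auto simp: other)
    also have "\<dots> = entry (h 0) 0 0" using z by (simp add: finite_degs)
    finally show ?thesis .
  qed
  also have "\<dots> = evalF f a0" using entry_weq[OF f(2)] entry_SF[OF f(1)] by (simp add: weight_zero)
  finally show ?thesis using q(2) f(1) fH by auto
qed

text \<open>An element outside \<open>annF0\<close> can be moved back to the weight \<open>\<alpha>\<close> by a word. Its component of degree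
zero is then an element of \<open>Sym(tt)\<close> that does not vanish at \<open>\<alpha>\<close>, hence a nonzero scalar modulo the
maximal ideal of \<open>\<alpha>\<close>. So the submodule contains the generator.\<close>

lemma submodule_top:
  assumes N: "submodule N BB MM" and out: "\<not> N \<subseteq> to_M ` annF0"
  shows "N = carrier MM"
proof -
  define H where "H = {p \<in> invF. to_M p \<in> N}"
  have Nc: "N \<subseteq> carrier MM" by (rule MM.submoduleD(1)[OF N])
  have HG: "p \<in> H \<Longrightarrow> p \<in> invF" for p by (simp add: H_def)
  have H_add: "p + q \<in> H" if "p \<in> H" "q \<in> H" for p q
    using that MM.submoduleD(3)[OF N] by (simp add: H_def invF_add to_M_add)
  have H_mult: "q * p \<in> H" if "p \<in> H" "q \<in> invF" for p q
    using that MM.submoduleD(4)[OF N to_B_closed, of q "to_M p"] by (simp add: H_def invF_mult to_M_smult)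
  have H_GI: "p \<in> H" if "p \<in> invF" "to_B p \<in> GI" for p
    using that to_M_zero_iff[of p] MM.submoduleD(2)[OF N] by (simp add: H_def)
  have H_WI: "p \<in> H" if "p \<in> WI" for p
    using H_GI[OF WI_invF[OF that]] to_B_WI[OF that] RM.submoduleD(2)[OF GI_submodule] by (simp add: RM_simps)
  have H_euler: "euler i * p - p * euler i \<in> H" if i: "i < n" and p: "p \<in> H" for i p
  proof -
    have e: "euler i \<in> SF" "euler i - fconst (a0 i) \<in> SF" using i by (auto intro: symF.euler symF_diff symF.const)
    \<comment> \<open>Right multiplication by \<open>\<pi>\<^sub>i\<close> is not available in a left module, but modulo
      the maximal ideal of \<open>\<alpha>\<close> it is the scalar \<open>\<alpha>\<^sub>i\<close>.\<close>
    have "p * (euler i - fconst (a0 i)) \<in> H"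
      by (rule H_GI[OF invF_mult[OF HG[OF p] SF_invF[OF e(2)]] invF_max_GI[OF HG[OF p] e(2)]])
        (simp add: evalF_diff evalF_euler evalF_const)
    then have "fconst (-1) * (p * (euler i - fconst (a0 i))) \<in> H" by (rule H_mult[OF _ const_invF])
    moreover have "euler i * p + fconst (- a0 i) * p \<in> H" by (intro H_add H_mult p SF_invF e const_invF)
    ultimately have "fconst (-1) * (p * (euler i - fconst (a0 i))) + (euler i * p + fconst (- a0 i) * p) \<in> H"
      by (rule H_add)
    moreover have "fconst (-1) * (p * (euler i - fconst (a0 i))) + (euler i * p + fconst (- a0 i) * p)
        = euler i * p - p * euler i"
      by (simp add: fconst_minus right_diff_distrib fconst_commute[of "a0 i" p])
    ultimately show ?thesis by simp
  qed
  obtain p where p: "p \<in> H" "p \<notin> annF0"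
  proof -
    obtain x where x: "x \<in> N" "x \<notin> to_M ` annF0" using out by blast
    then obtain q where "q \<in> invF" "x = to_M q" using Nc unfolding to_M_carrier by blast
    then show thesis using that[of q] x unfolding H_def by blast
  qed
  then obtain \<nu> where \<nu>: "\<nu> \<in> orthant" "entry p \<nu> \<nu> \<noteq> 0" using HG by (auto simp: annF0_def)
  obtain w where w: "word w \<in> invF" "word_deg w = 0 - \<nu>" "word_coeff neg_coords w (weight 0) \<noteq> 0"
    using connecting_word[OF zero_orthant \<nu>(1)] by blast
  have "entry (word w * p) 0 0 = word_coeff neg_coords w (weight 0) * entry p \<nu> \<nu>"
    unfolding entry_word_mult w(2) by simp
  then have "entry (word w * p) 0 0 \<noteq> 0" using w(3) \<nu>(2) by simp
  from degree_zero_component[of H, OF _ H_WI H_add _ H_euler H_mult[OF p(1) w(1)] this]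
  obtain f where f: "f \<in> SF" "f \<in> H" "evalF f a0 \<noteq> 0"
    using HG invF_FF H_mult const_invF by blast
  let ?c = "evalF f a0"
  have "1 * (fconst ?c - f) \<in> H"
    using f by (intro H_GI invF_mult invF_max_GI SF_invF one_SF symF_diff symF.const) (auto simp: evalF_diff evalF_const)
  from H_add[OF this f(2)] have "fconst ?c \<in> H" by simp
  from H_mult[OF this const_invF[of "1 / ?c"]] have one: "1 \<in> H"
    using f(3) by (simp add: fconst_mult[symmetric])
  have "to_M q \<in> N" if "q \<in> invF" for q
    using H_mult[OF one that] by (simp add: H_def)
  then show ?thesis using Nc by (auto simp: to_M_carrier)
qed

lemma one_notin_annF0: "1 \<notin> annF0"
proof
  assume "1 \<in> annF0"
  then have "entry 1 0 0 = 0" using zero_orthant by (auto simp: annF0_def)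
  then show False using entry_SF[OF one_SF, of 0 0] evalF_const[of "1 :: 'k"] by simp
qed

lemma L_kernel_eq: "L_kernel r s g chi \<alpha> = to_M ` annF0"
  unfolding L_kernel_def
proof (rule MM.simple_quotient_kernel_eq[OF submodule_annF0 _ submodule_top])
  show "to_M ` annF0 \<noteq> carrier MM"
    using to_M_annF0_iff[OF SF_invF[OF one_SF]] one_notin_annF0 to_M_closed[OF SF_invF[OF one_SF]] by blast
qed

abbreviation LM :: "('k weyl set, 'k weyl set set set) module" where "LM \<equiv> L_module r s g chi \<alpha>"

lemma LM_left_module: "left_module BB LM"
  unfolding L_module_def L_kernel_eq by (rule MM.left_module_quotient[OF submodule_annF0])

definition to_L :: "'k free_alg \<Rightarrow> 'k weyl set set set" where "to_L p = to_M ` annF0 +>\<^bsub>MM\<^esub> to_M p"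

lemma to_L_carrier: "carrier LM = to_L ` invF"
  unfolding L_module_def L_kernel_eq MM.quotient_carrier[OF submodule_annF0] by (auto simp: to_M_carrier to_L_def)

lemma to_L_zero_iff: "p \<in> invF \<Longrightarrow> to_L p = \<zero>\<^bsub>LM\<^esub> \<longleftrightarrow> p \<in> annF0"
  unfolding L_module_def L_kernel_eq MM.quotient_zero[OF submodule_annF0] to_L_def
  using MM.coset_eq_zero_iff[OF submodule_annF0 to_M_closed] to_M_annF0_iff by simp

lemma to_L_smult: "p \<in> invF \<Longrightarrow> q \<in> invF \<Longrightarrow> to_B p \<odot>\<^bsub>LM\<^esub> to_L q = to_L (p * q)"
  unfolding L_module_def L_kernel_eq to_L_def
  by (subst MM.quotient_smult[OF submodule_annF0]) (simp_all add: to_B_closed to_M_closed to_M_smult)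

text \<open>An element annihilates \<open>L(\<alpha>)\<close> iff all its right multiples kill the generator.\<close>

lemma J_ideal_eq: "J_ideal r s g chi \<alpha> = to_B ` annF"
proof -
  have "to_B p \<in> J_ideal r s g chi \<alpha> \<longleftrightarrow> p \<in> annF" if p: "p \<in> invF" for p
    unfolding J_ideal_def annihilator_def
    using p by (simp add: to_B_closed to_L_carrier to_L_smult to_L_zero_iff invF_mult annF_iff)
  moreover have "J_ideal r s g chi \<alpha> \<subseteq> to_B ` invF"
    by (auto simp: J_ideal_def annihilator_def to_B_carrier)
  ultimately show ?thesis by (auto simp: annF_def)
qed

lemma ideal_J: "ideal (J_ideal r s g chi \<alpha>) BB"
  unfolding J_ideal_def by (rule left_module.annihilator_ideal[OF LM_left_module])

text \<open>For a weight \<open>\<beta>\<close> with nonzero part, \<open>\<pi>\<^sub>i - \<beta>\<^sub>i\<close> kills an element that has a nonzero entry at some orthant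
point, which must then be \<open>\<beta>\<close>. For a point of the orthant, a connecting word is homogeneous of the
right weight.\<close>

lemma L_support_eq: "L_support r s g chi \<alpha> = {\<beta> \<in> dual r s (tt r s). pt r s \<beta> \<in> weight ` orthant}"
proof -
  have "L_part r s g chi \<alpha> \<beta> \<noteq> {\<zero>\<^bsub>LM\<^esub>} \<longleftrightarrow> pt r s \<beta> \<in> weight ` orthant" if \<beta>: "\<beta> \<in> dual r s (tt r s)" for \<beta>
  proof -
    define G where "G = {p \<in> invF. \<forall>f\<in>SF. evalF f (pt r s \<beta>) = 0 \<longrightarrow> to_B (f * p) \<in> GI}"
    have part: "graded_part r s g chi MM \<beta> = to_M ` G"
    proof -
      have "to_M p \<in> graded_part r s g chi MM \<beta> \<longleftrightarrow> p \<in> G" if p: "p \<in> invF" for p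
        unfolding graded_part_def max_ideal_B_eq[OF \<beta>] G_def
        using p by (auto simp: to_M_closed to_M_smult SF_invF to_M_zero_iff invF_mult)
      moreover have "graded_part r s g chi MM \<beta> \<subseteq> to_M ` invF" by (auto simp: graded_part_def to_M_carrier)
      ultimately show ?thesis by (auto simp: G_def)
    qed
    have "0 \<in> G" using SF_invF[OF zero_SF] RM.submoduleD(2)[OF GI_submodule] by (simp add: G_def to_B_zero RM_simps)
    then have "L_part r s g chi \<alpha> \<beta> \<noteq> {\<zero>\<^bsub>LM\<^esub>} \<longleftrightarrow> (\<exists>p\<in>G. to_L p \<noteq> \<zero>\<^bsub>LM\<^esub>)"
      unfolding L_part_def part L_kernel_eq by (auto simp: to_L_def image_image)
    also have "\<dots> \<longleftrightarrow> (\<exists>p\<in>G. p \<notin> annF0)" by (auto simp: to_L_zero_iff G_def)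
    also have "\<dots> \<longleftrightarrow> pt r s \<beta> \<in> weight ` orthant"
    proof
      assume "\<exists>p\<in>G. p \<notin> annF0"
      then obtain p where p: "p \<in> G" "p \<notin> annF0" by blast
      have pG: "p \<in> invF" using p(1) by (simp add: G_def)
      then obtain \<nu> where \<nu>: "\<nu> \<in> orthant" "entry p \<nu> \<nu> \<noteq> 0" using p(2) by (auto simp: annF0_def)
      have "pt r s \<beta> i = weight \<nu> i" for i
      proof (cases "i < n")
        case True
        let ?f = "euler i - fconst (pt r s \<beta> i) :: 'k free_alg"
        have f: "?f \<in> SF" "evalF ?f (pt r s \<beta>) = 0"
          using True by (auto intro: symF.euler symF_diff symF.const simp: evalF_diff evalF_euler evalF_const)
        have "?f * p \<in> annF0"
          by (rule GI_annF0[OF invF_mult[OF SF_invF[OF f(1)] pG]]) (use p(1) f in \<open>auto simp: G_def\<close>)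
        then have "evalF ?f (weight \<nu>) * entry p \<nu> \<nu> = 0" using \<nu>(1) by (simp add: annF0_def entry_SF_mult[OF f(1)])
        then show ?thesis using \<nu>(2) by (simp add: evalF_diff evalF_euler evalF_const)
      next
        case False
        then show ?thesis using supp[OF orthant_L[OF \<nu>(1)], of i] by (simp add: pt_outside weight_def a0_outside)
      qed
      then show "pt r s \<beta> \<in> weight ` orthant" using \<nu>(1) by (intro image_eqI[of _ _ \<nu>]) auto
    next
      assume "pt r s \<beta> \<in> weight ` orthant"
      then obtain \<nu> where \<nu>: "\<nu> \<in> orthant" "pt r s \<beta> = weight \<nu>" by blast
      obtain w where w: "word w \<in> invF" "word_deg w = \<nu> - 0" "word_coeff neg_coords w (weight \<nu>) \<noteq> 0" "set w \<subseteq> weyl_gens r s"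
        using connecting_word[OF \<nu>(1) zero_orthant] by blast
      have cfw: "entry (word w) \<nu> \<nu> \<noteq> 0" using w by (simp add: entry_word)
      have "to_B (f * word w) \<in> GI" if f: "f \<in> SF" "evalF f (pt r s \<beta>) = 0" for f
      proof -
        obtain f' where f': "f' \<in> SF" "weq r s (f * word w) (word w * f')" using symF_word[OF f(1) w(4)] by blast
        have "evalF f (weight \<nu>) * entry (word w) \<nu> \<nu> = entry (word w) \<nu> \<nu> * evalF f' (weight (\<nu> - \<nu>))"
          using entry_weq[OF f'(2)] by (metis entry_SF_mult[OF f(1)] entry_mult_SF[OF f'(1)])
        then have "evalF f' a0 = 0" using f(2) \<nu>(2) cfw by (simp add: weight_zero)
        then have "to_B (word w * f') \<in> GI" by (rule invF_max_GI[OF w(1) f'(1)])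
        then show ?thesis using to_B_weq[OF invF_mult[OF SF_invF[OF f(1)] w(1)] invF_mult[OF w(1) SF_invF[OF f'(1)]] f'(2)] by simp
      qed
      then have "word w \<in> G" using w(1) by (simp add: G_def)
      moreover have "word w \<notin> annF0" using cfw \<nu>(1) by (auto simp: annF0_def)
      ultimately show "\<exists>p\<in>G. p \<notin> annF0" by blast
    qed
    finally show ?thesis .
  qed
  then show ?thesis by (auto simp: L_support_def)
qed

end

section \<open>The Goldie rank\<close>

context weight_data
begin

interpretation BB: ring BB by (rule ring_BB)
interpretation J: ideal "J_ideal r s g chi \<alpha>" BB by (rule ideal_J)

abbreviation RJ :: "'k weyl set set ring" where "RJ \<equiv> BB Quot J_ideal r s g chi \<alpha>"

interpretation RJ: ring RJ by (rule J.quotient_is_ring)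

definition to_R :: "'k free_alg \<Rightarrow> 'k weyl set set"
  where "to_R p = J_ideal r s g chi \<alpha> +>\<^bsub>BB\<^esub> to_B p"

lemma to_R_carrier: "carrier RJ = to_R ` invF"
  unfolding carrier_Quot to_B_carrier by (auto simp: to_R_def)
lemma to_R_closed: "p \<in> invF \<Longrightarrow> to_R p \<in> carrier RJ" by (simp add: to_R_carrier)
lemma to_R_add: "p \<in> invF \<Longrightarrow> q \<in> invF \<Longrightarrow> to_R (p + q) = to_R p \<oplus>\<^bsub>RJ\<^esub> to_R q"
  using ring_hom_add[OF J.rcos_ring_hom to_B_closed to_B_closed, of p q] by (simp add: to_R_def to_B_add)
lemma to_R_mult: "p \<in> invF \<Longrightarrow> q \<in> invF \<Longrightarrow> to_R (p * q) = to_R p \<otimes>\<^bsub>RJ\<^esub> to_R q"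
  using ring_hom_mult[OF J.rcos_ring_hom to_B_closed to_B_closed, of p q] by (simp add: to_R_def to_B_mult)

lemma to_R_zero_iff: "p \<in> invF \<Longrightarrow> to_R p = \<zero>\<^bsub>RJ\<^esub> \<longleftrightarrow> p \<in> annF"
proof -
  assume p: "p \<in> invF"
  have "to_R p = \<zero>\<^bsub>RJ\<^esub> \<longleftrightarrow> to_B p \<in> to_B ` annF"
    using BB.a_rcos_zero[OF ideal_J] J.rcos_const_imp_mem[OF to_B_closed[OF p]]
    unfolding zero_Quot to_R_def J_ideal_eq by blast
  also have "\<dots> \<longleftrightarrow> p \<in> annF"
  proof
    assume "to_B p \<in> to_B ` annF"
    then obtain k where k: "k \<in> annF" "to_B p = to_B k" by blast
    then have "p - k \<in> annF" using to_B_eq_diff[OF p, of k] by (simp add: annF_def)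
    from annF_add[OF this k(1)] show "p \<in> annF" by simp
  qed blast
  finally show ?thesis .
qed

lemma to_R_eqI: "p \<in> invF \<Longrightarrow> q \<in> invF \<Longrightarrow> p - q \<in> annF \<Longrightarrow> to_R p = to_R q"
proof -
  assume p: "p \<in> invF" and q: "q \<in> invF" and d: "p - q \<in> annF"
  have "to_R p = to_R (p - q) \<oplus>\<^bsub>RJ\<^esub> to_R q" using to_R_add[OF invF_diff[OF p q] q] by simp
  then show ?thesis using to_R_zero_iff[OF invF_diff[OF p q]] d to_R_closed[OF q] by simp
qed

lemma zero_invF: "0 \<in> invF" by (rule SF_invF[OF zero_SF])

lemma to_R_sum: "(\<And>j. j < m \<Longrightarrow> f j \<in> invF) \<Longrightarrow> to_R (\<Sum>j<m. f j) = finsum RJ (\<lambda>j. to_R (f j)) {..<m::nat}"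
proof (induction m)
  case 0
  show ?case using to_R_zero_iff[OF SF_invF[OF zero_SF]] WI_annF[OF WI_zero] by simp
next
  case (Suc m)
  have "to_R (\<Sum>j<Suc m. f j) = to_R (f m + (\<Sum>j<m. f j))" by (simp add: add.commute)
  also have "\<dots> = to_R (f m) \<oplus>\<^bsub>RJ\<^esub> to_R (\<Sum>j<m. f j)"
    using Suc.prems by (intro to_R_add invF_sum zero_invF) auto
  also have "\<dots> = finsum RJ (\<lambda>j. to_R (f j)) {..<Suc m}"
    using Suc by (simp add: lessThan_Suc to_R_closed)
  finally show ?case .
qed

text \<open>An interpolation polynomial in the bounded coordinates: the factor for \<open>c'\<close> vanishes on the face \<open>c'\<close>
and equals \<open>1\<close> on the face \<open>c\<close>.\<close>

definition separator :: "(nat \<Rightarrow> int) \<Rightarrow> (nat \<Rightarrow> 'k) \<Rightarrow> 'k"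
  where "separator c \<gamma> = (\<Prod>c'\<in>faces - {c}. let i = (SOME i. i \<in> bounded_coords \<and> c i \<noteq> c' i) in
    (\<gamma> i - weight c' i) * (1 / (of_int (c i) - of_int (c' i))))"

lemma distinct_faces:
  assumes "c \<in> faces" "c' \<in> faces - {c}"
  defines "i \<equiv> SOME i. i \<in> bounded_coords \<and> c i \<noteq> c' i"
  shows "i \<in> bounded_coords" "c i \<noteq> c' i"
proof -
  have "c \<noteq> c'" using assms(2) by blast
  then obtain j where j: "c j \<noteq> c' j" by (meson ext)
  have "j \<in> bounded_coords" using j assms(1,2) by (auto simp: faces_def face_def split: if_splits)
  then have "\<exists>i. i \<in> bounded_coords \<and> c i \<noteq> c' i" using j by blast
  from someI_ex[OF this] show "i \<in> bounded_coords" "c i \<noteq> c' i" unfolding i_def by auto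
qed

lemma bounded_coords_n: "i \<in> bounded_coords \<Longrightarrow> i < n"
proof -
  assume "i \<in> bounded_coords"
  then have "i \<in> int_coords" by (simp add: bounded_coords_def)
  then show ?thesis by (simp add: int_coords_def)
qed

lemma separator_polyfun: "c \<in> faces \<Longrightarrow> separator c \<in> polyfuns n"
proof -
  assume c: "c \<in> faces"
  have "(\<lambda>\<gamma>. \<Prod>c'\<in>faces - {c}. (\<lambda>c' \<gamma>. let i = (SOME i. i \<in> bounded_coords \<and> c i \<noteq> c' i) in
    (\<gamma> i - weight c' i) * (1 / (of_int (c i) - of_int (c' i)))) c' \<gamma>) \<in> polyfuns n"
    unfolding Let_def
    by (intro polyfuns_prod polyfuns.mult polyfuns_diff polyfuns.coord polyfuns.const bounded_coords_n
        distinct_faces(1)[OF c])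
  then show ?thesis unfolding separator_def .
qed

lemma separator_value:
  assumes c: "c \<in> faces" and \<nu>: "face \<nu> \<in> faces"
  shows "separator c (weight \<nu>) = (if face \<nu> = c then 1 else 0)"
proof (cases "face \<nu> = c")
  case True
  have "separator c (weight \<nu>) = 1"
    unfolding separator_def Let_def
  proof (rule prod.neutral, intro ballI)
    fix c' assume c': "c' \<in> faces - {c}"
    define i where "i = (SOME i. i \<in> bounded_coords \<and> c i \<noteq> c' i)"
    have i: "i \<in> bounded_coords" "c i \<noteq> c' i" unfolding i_def using distinct_faces[OF c c'] by auto
    have "\<nu> i = c i" using fun_cong[OF True, of i] i(1) by (simp add: face_def)
    then show "(weight \<nu> i - weight c' i) * (1 / (of_int (c i) - of_int (c' i))) = 1"
      using i(2) by (simp add: weight_def)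
  qed
  then show ?thesis using True by simp
next
  case False
  define i where "i = (SOME i. i \<in> bounded_coords \<and> c i \<noteq> face \<nu> i)"
  have c': "face \<nu> \<in> faces - {c}" using \<nu> False by simp
  have i: "i \<in> bounded_coords" unfolding i_def using distinct_faces[OF c c'] by auto
  have "weight \<nu> i - weight (face \<nu>) i = 0" using i by (simp add: weight_def face_def)
  then have "separator c (weight \<nu>) = 0"
    unfolding separator_def Let_def using c' finite_faces
    by (intro prod_zero) (auto intro!: bexI[of _ "face \<nu>"] simp: i_def)
  then show ?thesis using False by simp
qed

definition sepF :: "(nat \<Rightarrow> int) \<Rightarrow> 'k free_alg"
  where "sepF c = (SOME p. p \<in> SF \<and> evalF p = separator c)"

lemma sepF: "c \<in> faces \<Longrightarrow> sepF c \<in> SF" "c \<in> faces \<Longrightarrow> evalF (sepF c) = separator c"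
proof -
  assume "c \<in> faces"
  then have "\<exists>p. p \<in> SF \<and> evalF p = separator c" using polyfun_evalF[OF separator_polyfun] by blast
  from someI_ex[OF this] show "sepF c \<in> SF" "evalF (sepF c) = separator c" unfolding sepF_def by auto
qed

lemma goldie_lower: "\<exists>I. direct_left_ideals RJ (card faces) I"
proof -
  obtain h where h: "bij_betw h {0..<card faces} faces"
    using ex_bij_betw_nat_finite[OF finite_faces] by blast
  have hc: "h i \<in> faces" if "i < card faces" for i using h that by (auto simp: bij_betw_def)
  have hinj: "h i \<noteq> h j" if "i < card faces" "j < card faces" "i \<noteq> j" for i j
    using h that by (auto simp: bij_betw_def inj_on_def)
  have prod: "to_R (sepF c) \<otimes>\<^bsub>RJ\<^esub> to_R (sepF c') = to_R (sepF c * sepF c')" if "c \<in> faces" "c' \<in> faces" for c c'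
    using to_R_mult[OF SF_invF SF_invF] sepF(1) that by simp
  have "direct_left_ideals RJ (card faces) (\<lambda>i. (\<lambda>x. x \<otimes>\<^bsub>RJ\<^esub> to_R (sepF (h i))) ` carrier RJ)"
  proof (rule orthogonal_idempotents_direct[OF RJ.ring_axioms])
    fix i assume i: "i < card faces"
    note c = hc[OF i]
    show "to_R (sepF (h i)) \<in> carrier RJ" by (rule to_R_closed[OF SF_invF[OF sepF(1)[OF c]]])
    obtain \<nu> where "\<nu> \<in> orthant" "face \<nu> = h i" using c by (auto simp: faces_def)
    then have "sepF (h i) \<notin> annF"
      using SF_annF_iff[OF sepF(1)[OF c]] sepF(2)[OF c] separator_value[OF c] c by force
    then show "to_R (sepF (h i)) \<noteq> \<zero>\<^bsub>RJ\<^esub>" using to_R_zero_iff[OF SF_invF[OF sepF(1)[OF c]]] by simp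
    have "sepF (h i) * sepF (h i) - sepF (h i) \<in> annF"
      using SF_annF_iff[OF symF_diff[OF symF.mult[OF sepF(1) sepF(1)] sepF(1)], OF c c c]
      by (simp add: evalF_diff evalF_mult[OF sepF(1)[OF c]] sepF(2)[OF c] separator_value[OF c] face_orthant)
    then show "to_R (sepF (h i)) \<otimes>\<^bsub>RJ\<^esub> to_R (sepF (h i)) = to_R (sepF (h i))"
      unfolding prod[OF c c] by (intro to_R_eqI invF_mult SF_invF sepF(1) c)
    fix j assume j: "j < card faces" "i \<noteq> j"
    note c' = hc[OF j(1)]
    have "sepF (h i) * sepF (h j) \<in> annF"
      using SF_annF_iff[OF symF.mult[OF sepF(1)[OF c] sepF(1)[OF c']]] hinj[OF i j]
      by (auto simp: evalF_mult[OF sepF(1)[OF c]] sepF(2)[OF c] sepF(2)[OF c'] separator_value[OF c]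
          separator_value[OF c'] face_orthant)
    then show "to_R (sepF (h i)) \<otimes>\<^bsub>RJ\<^esub> to_R (sepF (h j)) = \<zero>\<^bsub>RJ\<^esub>"
      unfolding prod[OF c c'] using to_R_zero_iff[OF invF_mult[OF SF_invF SF_invF], OF sepF(1)[OF c] sepF(1)[OF c']] by simp
  qed
  then show ?thesis by blast
qed

lemma component_polyfun: "p \<in> FF \<Longrightarrow> component neg_coords p \<nu> \<in> polyfuns n"
proof -
  assume p: "p \<in> FF"
  have "(\<lambda>\<gamma>. \<Sum>w | w \<in> Poly_Mapping.keys p \<and> word_deg (letters w) = \<nu>.
     (\<lambda>w \<gamma>. Poly_Mapping.lookup p w * word_coeff neg_coords (letters w) \<gamma>) w \<gamma>) \<in> polyfuns n"
    using p by (intro polyfuns_sum polyfuns.mult polyfuns.const word_coeff_polyfun) (auto simp: FF_iff)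
  then show ?thesis unfolding component_def .
qed

lemma zero_faces: "0 \<in> faces" using face_orthant[OF zero_orthant] by (simp add: face_zero)

lemma zero_coset: "0 \<in> coset 0" by (simp add: coset_def zero_mem face_zero)

lemma box_shift: "\<delta> \<in> box k \<Longrightarrow> \<rho> \<in> coset 0 \<Longrightarrow> \<rho> - \<delta> \<in> coset 0 \<and> \<rho> + \<delta> \<in> coset 0"
  by (auto simp: box_def coset_def face_diff face_add intro: diff_mem add_mem)

lemma box_word:
  assumes \<delta>: "\<delta> \<in> box k"
  shows "\<exists>w. word w \<in> invF \<and> set w \<subseteq> weyl_gens r s \<and> word_deg w = \<delta> \<and> (\<exists>\<rho>\<in>coset 0. word_coeff neg_coords w (weight \<rho>) \<noteq> 0)"
proof -
  have "\<exists>\<rho>\<in>coset 0. (1::'k) \<noteq> 0 \<and> (\<forall>\<tau>\<in>{0, - \<delta>}. \<rho> + \<tau> \<in> orthant)"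
    using \<delta> zero_faces
    by (intro deep_point[OF polyfuns.const zero_coset])
      (auto simp: box_def zero_mem face_zero minus_mem face_diff[of 0 \<delta>, simplified] simp flip: face_diff)
  then obtain \<rho> where \<rho>: "\<rho> \<in> coset 0" "\<rho> + 0 \<in> orthant" "\<rho> + - \<delta> \<in> orthant" by blast
  obtain w where "word w \<in> invF" "word_deg w = (\<rho> + 0) - (\<rho> + - \<delta>)" "word_coeff neg_coords w (weight (\<rho> + 0)) \<noteq> 0" "set w \<subseteq> weyl_gens r s"
    using connecting_word[OF \<rho>(2,3)] by blast
  then show ?thesis using \<rho>(1) by auto
qed

lemma left_ideal_mult:
  assumes "left_ideal X RJ" "x \<in> X" "y \<in> carrier RJ"
  shows "y \<otimes>\<^bsub>RJ\<^esub> x \<in> X"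
proof -
  interpret L: left_module RJ "regular_module RJ" by (rule left_module_regular[OF RJ.ring_axioms])
  show ?thesis using L.submoduleD(4)[OF _ assms(3,2)] assms(1) by (simp add: left_ideal_def regular_module_def)
qed

text \<open>Multiply a nonzero element by a word that leads from the row of one of its nonzero entries to the
row of \<open>\<alpha>\<close>.\<close>

lemma nonzero_at_origin:
  assumes X: "left_ideal X RJ" "X \<noteq> {\<zero>\<^bsub>RJ\<^esub>}"
  shows "\<exists>p\<in>invF. to_R p \<in> X \<and> (\<exists>\<mu>\<in>orthant. entry p (- \<mu>) 0 \<noteq> 0)"
proof -
  interpret L: left_module RJ "regular_module RJ" by (rule left_module_regular[OF RJ.ring_axioms])
  have "X \<subseteq> carrier RJ" "\<zero>\<^bsub>RJ\<^esub> \<in> X"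
    using L.submoduleD(1,2) X(1) by (auto simp: left_ideal_def regular_module_def)
  moreover from this X(2) obtain x where "x \<in> X" "x \<noteq> \<zero>\<^bsub>RJ\<^esub>" by blast
  ultimately obtain a where a: "a \<in> invF" "to_R a \<in> X" "to_R a \<noteq> \<zero>\<^bsub>RJ\<^esub>" unfolding to_R_carrier by blast
  then have "a \<notin> annF" using to_R_zero_iff by blast
  then obtain \<nu> \<mu> where o: "\<nu> \<in> orthant" "\<mu> \<in> orthant" "entry a (\<nu> - \<mu>) \<nu> \<noteq> 0" using a(1) by (auto simp: annF_def)
  obtain w where w: "word w \<in> invF" "word_deg w = 0 - \<nu>" "word_coeff neg_coords w (weight 0) \<noteq> 0"
    using connecting_word[OF zero_orthant o(1)] by blast
  have "entry (word w * a) (- \<mu>) 0 = word_coeff neg_coords w (weight 0) * entry a (\<nu> - \<mu>) \<nu>"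
    unfolding entry_word_mult w(2) by (simp add: algebra_simps)
  then have "entry (word w * a) (- \<mu>) 0 \<noteq> 0" using w(3) o(3) by simp
  moreover have "to_R (word w * a) \<in> X"
    using left_ideal_mult[OF X(1) a(2) to_R_closed[OF w(1)]] by (simp add: to_R_mult w(1) a(1))
  ultimately show ?thesis using invF_mult[OF w(1) a(1)] o(2) by blast
qed

lemma finite_degree_bound:
  assumes "finite T" "\<And>\<tau> i. \<tau> \<in> T \<Longrightarrow> i \<ge> n \<Longrightarrow> \<tau> i = (0::int)"
  shows "\<exists>e. \<forall>\<tau>\<in>T. \<forall>i. \<bar>\<tau> i\<bar> \<le> int e"
  using assms
proof (induction T rule: finite_induct)
  case (insert \<tau> T)
  then obtain e where e: "\<forall>\<tau>\<in>T. \<forall>i. \<bar>\<tau> i\<bar> \<le> int e" by auto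
  have le: "\<bar>\<tau> i\<bar> \<le> int (\<Sum>i<n. nat \<bar>\<tau> i\<bar>)" for i
  proof (cases "i < n")
    case True
    then have "nat \<bar>\<tau> i\<bar> \<le> (\<Sum>i<n. nat \<bar>\<tau> i\<bar>)" by (intro member_le_sum) auto
    then show ?thesis by linarith
  next
    case False
    then have "\<tau> i = 0" using insert.prems[of \<tau> i] by simp
    then show ?thesis by simp
  qed
  show ?case
  proof (intro exI[of _ "e + (\<Sum>i<n. nat \<bar>\<tau> i\<bar>)"] ballI allI)
    fix \<tau>' i assume "\<tau>' \<in> insert \<tau> T"
    then have "\<bar>\<tau>' i\<bar> \<le> int e \<or> \<bar>\<tau>' i\<bar> \<le> int (\<Sum>i<n. nat \<bar>\<tau> i\<bar>)" using e le by auto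
    then show "\<bar>\<tau>' i\<bar> \<le> int (e + (\<Sum>i<n. nat \<bar>\<tau> i\<bar>))" by linarith
  qed
qed simp

text \<open>The equations are indexed by the degrees \<open>\<tau>\<close> that lead from some face to the face of \<open>\<alpha>\<close> and whose size
is bounded by that of the box and of the degrees of the \<open>A j\<close>; all other degrees contribute nothing. The
entries are polynomials in the weight that is reached, so the coefficients form an integral domain.\<close>

lemma relation_exists:
  assumes m: "card faces < m" and all_invF: "\<forall>j<m. A j \<in> invF"
  shows "\<exists>k w f. (\<forall>\<delta>\<in>box k. word (w \<delta>) \<in> invF \<and> set (w \<delta>) \<subseteq> weyl_gens r s \<and> word_deg (w \<delta>) = \<delta> \<and>
      (\<exists>\<rho>\<in>coset 0. word_coeff neg_coords (w \<delta>) (weight \<rho>) \<noteq> 0)) \<and>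
    (\<forall>j<m. \<forall>\<delta>\<in>box k. f j \<delta> \<in> SF) \<and> (\<exists>j<m. \<exists>\<delta>\<in>box k. \<exists>\<rho>\<in>coset 0. evalF (f j \<delta>) (weight \<rho>) \<noteq> 0) \<and>
    (\<forall>\<rho>\<in>coset 0. \<forall>\<tau>\<in>lat. - face \<tau> \<in> faces \<longrightarrow>
      (\<Sum>j<m. \<Sum>\<delta>\<in>box k. evalF (f j \<delta>) (weight \<rho>) * entry (word (w \<delta>) * A j) \<tau> \<rho>) = 0)"
proof -
  have A: "A j \<in> invF" if "j < m" for j using all_invF that by blast
  let ?T = "\<Union>j<m. degs (A j)"
  have finT: "finite ?T" by (simp add: finite_degs)
  have suppT: "\<tau> i = 0" if "\<tau> \<in> ?T" "i \<ge> n" for \<tau> i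
    using that degs_supp[OF invF_FF[OF A]] by blast
  obtain e where e: "\<forall>\<tau>\<in>?T. \<forall>i. \<bar>\<tau> i\<bar> \<le> int e" 
    using finite_degree_bound[of ?T] finT suppT by blast
  obtain k where k: "card {\<tau> \<in> lat. 0 - face \<tau> \<in> faces \<and> (\<forall>i. \<bar>\<tau> i\<bar> \<le> int (k + e))} < Suc (card faces) * card (box k)"
    using counting[OF zero_faces] by blast
  define E where "E = {\<tau> \<in> lat. 0 - face \<tau> \<in> faces \<and> (\<forall>i. \<bar>\<tau> i\<bar> \<le> int (k + e))}"
  have "\<exists>w. \<forall>\<delta>\<in>box k. word (w \<delta>) \<in> invF \<and> set (w \<delta>) \<subseteq> weyl_gens r s \<and> word_deg (w \<delta>) = \<delta> \<and>
      (\<exists>\<rho>\<in>coset 0. word_coeff neg_coords (w \<delta>) (weight \<rho>) \<noteq> 0)"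
    by (rule bchoice) (use box_word in blast)
  then obtain w where w: "\<And>\<delta>. \<delta> \<in> box k \<Longrightarrow> word (w \<delta>) \<in> invF \<and> set (w \<delta>) \<subseteq> weyl_gens r s \<and> word_deg (w \<delta>) = \<delta> \<and>
      (\<exists>\<rho>\<in>coset 0. word_coeff neg_coords (w \<delta>) (weight \<rho>) \<noteq> 0)" by blast
  define M where "M \<tau> = (\<lambda>(j, \<delta>) \<gamma>. word_coeff neg_coords (w \<delta>) \<gamma> * component neg_coords (A j) (\<tau> - \<delta>) (\<gamma> - ivec \<delta>))" for \<tau>
  have Mcf: "M \<tau> (j, \<delta>) (weight \<rho>) = entry (word (w \<delta>) * A j) \<tau> \<rho>" if "\<delta> \<in> box k" for \<tau> j \<delta> \<rho>
    using w[OF that] by (simp add: M_def entry_word_mult) (simp add: entry_def weight_diff)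
  let ?I = "{..<m} \<times> box k"
  have fE: "finite E" unfolding E_def by (rule finite_subset[OF _ finite_bounded_lattice[of "k + e"]]) auto
  have fI: "finite ?I" using finite_box by simp
  have "Suc (card faces) * card (box k) \<le> m * card (box k)" using m by (intro mult_le_mono1) simp
  then have cardE: "card E < card ?I" using k by (simp add: E_def card_cartesian_product)
  have "\<exists>f. (\<forall>i\<in>?I. f i \<in> polyfuns n) \<and> (\<exists>i\<in>?I. \<exists>x\<in>weight ` coset 0. f i x \<noteq> 0) \<and>
    (\<forall>\<tau>\<in>E. \<forall>x\<in>weight ` coset 0. (\<Sum>i\<in>?I. f i x * M \<tau> i x) = 0)"
  proof (rule homogeneous_system_solvable[OF polyfuns.const polyfuns.add polyfuns.mult _ _ fE fI cardE])
    fix f h x y assume "f \<in> polyfuns n" "h \<in> polyfuns n" "x \<in> weight ` coset 0" "y \<in> weight ` coset 0" "f x \<noteq> 0" "h y \<noteq> 0"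
    then show "\<exists>z\<in>weight ` coset 0. f z * h z \<noteq> 0"
      using coset_irreducible[of f n h _ 0 _ a0] unfolding weight_def by blast
  next
    show "weight ` coset 0 \<noteq> {}" using zero_coset by blast
  next
    fix \<tau> i assume "i \<in> ?I"
    then obtain j \<delta> where i: "i = (j, \<delta>)" "j < m" "\<delta> \<in> box k" by blast
    have "(\<lambda>\<gamma>. word_coeff neg_coords (w \<delta>) \<gamma> * component neg_coords (A j) (\<tau> - \<delta>) (\<gamma> - ivec \<delta>)) \<in> polyfuns n"
      using w[OF i(3)] by (intro polyfuns.mult word_coeff_polyfun polyfuns_shift component_polyfun invF_FF A i(2)) auto
    then show "M \<tau> i \<in> polyfuns n" unfolding M_def i by simp
  qed
  then obtain f where f: "\<forall>i\<in>?I. f i \<in> polyfuns n" "\<exists>i\<in>?I. \<exists>x\<in>weight ` coset 0. f i x \<noteq> 0"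
    "\<forall>\<tau>\<in>E. \<forall>x\<in>weight ` coset 0. (\<Sum>i\<in>?I. f i x * M \<tau> i x) = 0" by blast
  have "\<exists>F. \<forall>i\<in>?I. F i \<in> SF \<and> evalF (F i) = f i"
    by (rule bchoice) (use f(1) polyfun_evalF[where 'a = 'k] in blast)
  then obtain F where "\<forall>i\<in>?I. F i \<in> SF \<and> evalF (F i) = f i" by (elim exE)
  then have F: "F i \<in> SF \<and> evalF (F i) = f i" if "i \<in> ?I" for i using that by (rule bspec)
  have "(\<Sum>j<m. \<Sum>\<delta>\<in>box k. evalF (F (j, \<delta>)) (weight \<rho>) * entry (word (w \<delta>) * A j) \<tau> \<rho>) = 0"
    if \<rho>: "\<rho> \<in> coset 0" and \<tau>: "\<tau> \<in> lat" "- face \<tau> \<in> faces" for \<rho> \<tau>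
  proof (cases "\<forall>i. \<bar>\<tau> i\<bar> \<le> int (k + e)")
    case True
    then have "\<tau> \<in> E" using \<tau> by (simp add: E_def)
    then have "(\<Sum>i\<in>?I. f i (weight \<rho>) * M \<tau> i (weight \<rho>)) = 0" using f(3) \<rho> by blast
    moreover have "(\<Sum>i\<in>?I. f i (weight \<rho>) * M \<tau> i (weight \<rho>)) = (\<Sum>(j, \<delta>)\<in>?I. evalF (F (j, \<delta>)) (weight \<rho>) * entry (word (w \<delta>) * A j) \<tau> \<rho>)"
      using F by (intro sum.cong) (auto simp: Mcf)
    ultimately show ?thesis by (simp add: sum.cartesian_product)
  next
    case False
    then obtain i where i: "\<bar>\<tau> i\<bar> > int (k + e)" by (auto simp: not_le)
    have "entry (word (w \<delta>) * A j) \<tau> \<rho> = 0" if "j < m" "\<delta> \<in> box k" for j \<delta>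
    proof -
      have "\<bar>\<delta> i\<bar> \<le> int k" using that(2) by (simp add: box_def)
      then have "\<not> \<bar>(\<tau> - \<delta>) i\<bar> \<le> int e" using i by simp
      then have "\<tau> - \<delta> \<notin> degs (A j)" using e that(1) by blast
      then have "entry (A j) (\<tau> - \<delta>) (\<rho> - \<delta>) = 0" using entry_outside_degs by blast
      then show ?thesis using w[OF that(2)] by (simp add: entry_word_mult)
    qed
    then show ?thesis by simp
  qed
  moreover have "\<exists>j<m. \<exists>\<delta>\<in>box k. \<exists>\<rho>\<in>coset 0. evalF (F (j, \<delta>)) (weight \<rho>) \<noteq> 0"
  proof -
    obtain j \<delta> \<rho> where "j < m" "\<delta> \<in> box k" "\<rho> \<in> coset 0" "f (j, \<delta>) (weight \<rho>) \<noteq> 0" using f(2) by blast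
    then show ?thesis using F[of "(j, \<delta>)"] by (intro exI conjI bexI) auto
  qed
  ultimately show ?thesis using w F
    by (intro exI[of _ k] exI[of _ w] exI[of _ "\<lambda>j \<delta>. F (j, \<delta>)"]) auto
qed

text \<open>Choose degrees \<open>\<delta>\<close> and \<open>\<tau>\<close> in the supports of the two factors whose sum is attained only once. The
entry of degree \<open>\<delta> + \<tau>\<close> is then a product of three polynomials, none of which vanishes identically on the
coset; it is evaluated at a point for which source and target both lie in the orthant.\<close>

lemma product_nonzero:
  assumes A: "A \<in> invF" and \<mu>: "\<mu> \<in> orthant" "entry A (- \<mu>) 0 \<noteq> 0"
    and w: "\<And>\<delta>. \<delta> \<in> box k \<Longrightarrow> word (w \<delta>) \<in> invF \<and> set (w \<delta>) \<subseteq> weyl_gens r s \<and> word_deg (w \<delta>) = \<delta> \<and>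
      (\<exists>\<rho>\<in>coset 0. word_coeff neg_coords (w \<delta>) (weight \<rho>) \<noteq> 0)"
    and f: "\<And>\<delta>. \<delta> \<in> box k \<Longrightarrow> f \<delta> \<in> SF" and nz: "\<exists>\<delta>\<in>box k. \<exists>\<rho>\<in>coset 0. evalF (f \<delta>) (weight \<rho>) \<noteq> 0"
  shows "\<exists>\<rho>\<in>coset 0. \<exists>\<tau>. \<rho> \<in> orthant \<and> \<rho> - \<tau> \<in> orthant \<and>
    (\<Sum>\<delta>\<in>box k. evalF (f \<delta>) (weight \<rho>) * entry (word (w \<delta>) * A) \<tau> \<rho>) \<noteq> 0"
proof -
  define S1 where "S1 = {\<delta> \<in> box k. \<exists>\<rho>\<in>coset 0. evalF (f \<delta>) (weight \<rho>) \<noteq> 0}"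
  define S2 where "S2 = {\<tau> \<in> degs A. \<tau> \<in> lat \<and> face \<tau> = - face \<mu> \<and> (\<exists>\<rho>\<in>coset 0. entry A \<tau> \<rho> \<noteq> 0)}"
  have "finite S1" "finite S2" by (simp_all add: S1_def S2_def finite_box finite_degs)
  moreover have "S1 \<noteq> {}" using nz by (auto simp: S1_def)
  moreover have "- \<mu> \<in> S2"
    using entry_outside_degs[OF \<mu>(2)] entry_lat[OF A \<mu>(2)] \<mu>(2) zero_coset face_diff[of 0 \<mu>]
    by (auto simp: S2_def face_zero)
  then have "S2 \<noteq> {}" by blast
  moreover have "a i = 0" if "a \<in> S1 \<union> S2" "i \<ge> n" for a i
    using that supp by (auto simp: S1_def S2_def box_def)
  ultimately obtain \<delta> \<tau> where \<delta>: "\<delta> \<in> S1" and \<tau>: "\<tau> \<in> S2"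
    and uniq: "\<And>\<delta>' \<tau>'. \<delta>' \<in> S1 \<Longrightarrow> \<tau>' \<in> S2 \<Longrightarrow> \<delta>' + \<tau>' = \<delta> + \<tau> \<Longrightarrow> \<delta>' = \<delta> \<and> \<tau>' = \<tau>"
    using ex_unique_sum[of S1 S2 n] by metis
  have \<delta>b: "\<delta> \<in> box k" using \<delta> by (simp add: S1_def)
  obtain \<rho>1 where \<rho>1: "\<rho>1 \<in> coset 0" "evalF (f \<delta>) (weight \<rho>1) \<noteq> 0" using \<delta> by (auto simp: S1_def)
  obtain \<rho>2 where \<rho>2: "\<rho>2 \<in> coset 0" "word_coeff neg_coords (w \<delta>) (weight \<rho>2) \<noteq> 0" using w[OF \<delta>b] by blast
  obtain \<rho>3 where \<rho>3: "\<rho>3 \<in> coset 0" "entry A \<tau> \<rho>3 \<noteq> 0" using \<tau> by (auto simp: S2_def)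
  \<comment> \<open>The entry of \<open>A\<close> is evaluated at the weight from which the word \<open>w
    \<delta>\<close> starts.\<close>
  define p3 where "p3 = (\<lambda>\<gamma>. component neg_coords A \<tau> (\<gamma> - ivec \<delta>))"
  have p1: "evalF (f \<delta>) \<in> polyfuns n" by (rule evalF_polyfun[OF f[OF \<delta>b]])
  have p2: "word_coeff neg_coords (w \<delta>) \<in> polyfuns n" using w[OF \<delta>b] by (intro word_coeff_polyfun) blast
  have p3: "p3 \<in> polyfuns n" unfolding p3_def by (intro polyfuns_shift component_polyfun invF_FF A)
  have p3P: "p3 (weight \<rho>) = entry A \<tau> (\<rho> - \<delta>)" for \<rho> by (simp add: p3_def entry_def weight_diff)
  have "p3 (weight (\<rho>3 + \<delta>)) \<noteq> 0" using \<rho>3(2) by (simp add: p3P)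
  moreover have "\<rho>3 + \<delta> \<in> coset 0" using box_shift[OF \<delta>b \<rho>3(1)] by blast
  ultimately obtain \<rho>4 where \<rho>4: "\<rho>4 \<in> coset 0" "word_coeff neg_coords (w \<delta>) (weight \<rho>4) * p3 (weight \<rho>4) \<noteq> 0"
    using coset_irreducible[OF p2 p3 \<rho>2(1), of "\<rho>3 + \<delta>" a0] \<rho>2(2) unfolding weight_def by blast
  obtain \<rho>5 where \<rho>5: "\<rho>5 \<in> coset 0"
    "evalF (f \<delta>) (weight \<rho>5) * (word_coeff neg_coords (w \<delta>) (weight \<rho>5) * p3 (weight \<rho>5)) \<noteq> 0"
    using coset_irreducible[OF p1 polyfuns.mult[OF p2 p3] \<rho>1(1) \<rho>4(1), of a0] \<rho>1(2) \<rho>4(2)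
    unfolding weight_def by blast
  have \<delta>L: "\<delta> \<in> lat" "face \<delta> = 0" using \<delta>b by (auto simp: box_def)
  have \<tau>L: "\<tau> \<in> lat" "face \<tau> = - face \<mu>" using \<tau> by (auto simp: S2_def)
  have "face (0 - (\<delta> + \<tau>)) = face \<mu>" unfolding face_diff face_add \<delta>L(2) \<tau>L(2) face_zero by simp
  then have fm: "face (- (\<delta> + \<tau>)) = face \<mu>" by simp
  have "\<exists>\<rho>\<in>coset 0. evalF (f \<delta>) (weight \<rho>) * (word_coeff neg_coords (w \<delta>) (weight \<rho>) * p3 (weight \<rho>)) \<noteq> 0 \<and>
      (\<forall>\<tau>\<in>{0, - (\<delta> + \<tau>)}. \<rho> + \<tau> \<in> orthant)"
    unfolding weight_def
  proof (rule deep_point[OF polyfuns.mult[OF p1 polyfuns.mult[OF p2 p3]] \<rho>5(1)])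
    show "evalF (f \<delta>) (a0 + ivec \<rho>5) * (word_coeff neg_coords (w \<delta>) (a0 + ivec \<rho>5) * p3 (a0 + ivec \<rho>5)) \<noteq> 0"
      using \<rho>5(2) unfolding weight_def .
    fix \<tau>' assume "\<tau>' \<in> {0, - (\<delta> + \<tau>)}"
    then consider "\<tau>' = 0" | "\<tau>' = - (\<delta> + \<tau>)" by blast
    then show "\<tau>' \<in> lat \<and> 0 + face \<tau>' \<in> faces"
    proof cases
      case 1
      then show ?thesis using zero_mem zero_faces by (simp add: face_zero)
    next
      case 2
      then show ?thesis using minus_mem[OF add_mem[OF \<delta>L(1) \<tau>L(1)]] fm face_orthant[OF \<mu>(1)] by simp
    qed
  qed simp
  then obtain \<rho> where \<rho>: "\<rho> \<in> coset 0" "evalF (f \<delta>) (weight \<rho>) * (word_coeff neg_coords (w \<delta>) (weight \<rho>) * entry A \<tau> (\<rho> - \<delta>)) \<noteq> 0"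
    "\<rho> + 0 \<in> orthant" "\<rho> + - (\<delta> + \<tau>) \<in> orthant" unfolding p3P by blast
  have "(\<Sum>\<delta>'\<in>box k. evalF (f \<delta>') (weight \<rho>) * entry (word (w \<delta>') * A) (\<delta> + \<tau>) \<rho>) =
      (\<Sum>\<delta>'\<in>box k. if \<delta>' = \<delta> then evalF (f \<delta>) (weight \<rho>) * (word_coeff neg_coords (w \<delta>) (weight \<rho>) * entry A \<tau> (\<rho> - \<delta>)) else 0)"
  proof (rule sum.cong[OF refl])
    fix \<delta>' assume \<delta>': "\<delta>' \<in> box k"
    have eq: "entry (word (w \<delta>') * A) (\<delta> + \<tau>) \<rho> = word_coeff neg_coords (w \<delta>') (weight \<rho>) * entry A (\<delta> + \<tau> - \<delta>') (\<rho> - \<delta>')"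
      using w[OF \<delta>'] by (simp add: entry_word_mult)
    show "evalF (f \<delta>') (weight \<rho>) * entry (word (w \<delta>') * A) (\<delta> + \<tau>) \<rho> =
      (if \<delta>' = \<delta> then evalF (f \<delta>) (weight \<rho>) * (word_coeff neg_coords (w \<delta>) (weight \<rho>) * entry A \<tau> (\<rho> - \<delta>)) else 0)"
    proof (cases "\<delta>' = \<delta>")
      case True
      then show ?thesis using eq by simp
    next
      case False
      have "evalF (f \<delta>') (weight \<rho>) = 0 \<or> entry A (\<delta> + \<tau> - \<delta>') (\<rho> - \<delta>') = 0"
      proof (rule ccontr)
        assume "\<not> ?thesis"
        then have n1: "evalF (f \<delta>') (weight \<rho>) \<noteq> 0" and n2: "entry A (\<delta> + \<tau> - \<delta>') (\<rho> - \<delta>') \<noteq> 0" by auto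
        have "\<delta>' \<in> S1" using n1 \<rho>(1) \<delta>' by (auto simp: S1_def)
        moreover have "face (\<delta> + \<tau> - \<delta>') = - face \<mu>"
          using \<delta>' unfolding face_diff face_add \<delta>L(2) \<tau>L(2) by (simp add: box_def)
        then have "\<delta> + \<tau> - \<delta>' \<in> S2"
          using n2 entry_outside_degs[OF n2] entry_lat[OF A n2] box_shift[OF \<delta>' \<rho>(1)] by (auto simp: S2_def)
        ultimately show False using uniq[of \<delta>' "\<delta> + \<tau> - \<delta>'"] False by simp
      qed
      then show ?thesis using eq False by auto
    qed
  qed
  also have "\<dots> \<noteq> 0" using \<rho>(2) \<delta>b finite_box by simp
  finally have "(\<Sum>\<delta>'\<in>box k. evalF (f \<delta>') (weight \<rho>) * entry (word (w \<delta>') * A) (\<delta> + \<tau>) \<rho>) \<noteq> 0" .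
  moreover have "\<rho> \<in> orthant" "\<rho> - (\<delta> + \<tau>) \<in> orthant"
    using \<rho>(3,4) by (simp_all only: add_0_right add_uminus_conv_diff)
  ultimately show ?thesis using \<rho>(1) by blast
qed

lemma goldie_upper:
  assumes dir: "direct_left_ideals RJ m I"
  shows "m \<le> card faces"
proof (rule ccontr)
  assume "\<not> m \<le> card faces"
  then have m: "card faces < m" by simp
  have left: "left_ideal (I j) RJ" "I j \<noteq> {\<zero>\<^bsub>RJ\<^esub>}" if "j < m" for j
    using dir that unfolding direct_left_ideals_def by blast+
  have "\<exists>A. \<forall>j\<in>{..<m}. A j \<in> invF \<and> to_R (A j) \<in> I j \<and> (\<exists>\<mu>\<in>orthant. entry (A j) (- \<mu>) 0 \<noteq> 0)"
    by (rule bchoice) (use nonzero_at_origin[OF left] in blast)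
  then obtain A where A: "\<And>j. j < m \<Longrightarrow> A j \<in> invF" "\<And>j. j < m \<Longrightarrow> to_R (A j) \<in> I j"
    "\<And>j. j < m \<Longrightarrow> \<exists>\<mu>\<in>orthant. entry (A j) (- \<mu>) 0 \<noteq> 0" by blast
  have "\<forall>j<m. A j \<in> invF" using A(1) by blast
  from relation_exists[OF m this]
  obtain k w f where R: "(\<forall>\<delta>\<in>box k. word (w \<delta>) \<in> invF \<and> set (w \<delta>) \<subseteq> weyl_gens r s \<and> word_deg (w \<delta>) = \<delta> \<and>
      (\<exists>\<rho>\<in>coset 0. word_coeff neg_coords (w \<delta>) (weight \<rho>) \<noteq> 0)) \<and>
    (\<forall>j<m. \<forall>\<delta>\<in>box k. f j \<delta> \<in> SF) \<and> (\<exists>j<m. \<exists>\<delta>\<in>box k. \<exists>\<rho>\<in>coset 0. evalF (f j \<delta>) (weight \<rho>) \<noteq> 0) \<and>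
    (\<forall>\<rho>\<in>coset 0. \<forall>\<tau>\<in>lat. - face \<tau> \<in> faces \<longrightarrow>
      (\<Sum>j<m. \<Sum>\<delta>\<in>box k. evalF (f j \<delta>) (weight \<rho>) * entry (word (w \<delta>) * A j) \<tau> \<rho>) = 0)"
    by (elim exE) (rule that)
  have w: "\<And>\<delta>. \<delta> \<in> box k \<Longrightarrow> word (w \<delta>) \<in> invF \<and> set (w \<delta>) \<subseteq> weyl_gens r s \<and> word_deg (w \<delta>) = \<delta> \<and>
      (\<exists>\<rho>\<in>coset 0. word_coeff neg_coords (w \<delta>) (weight \<rho>) \<noteq> 0)"
    and f: "\<And>j \<delta>. j < m \<Longrightarrow> \<delta> \<in> box k \<Longrightarrow> f j \<delta> \<in> SF"
    and nz: "\<exists>j<m. \<exists>\<delta>\<in>box k. \<exists>\<rho>\<in>coset 0. evalF (f j \<delta>) (weight \<rho>) \<noteq> 0"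
    and rel: "\<And>\<rho> \<tau>. \<rho> \<in> coset 0 \<Longrightarrow> \<tau> \<in> lat \<Longrightarrow> - face \<tau> \<in> faces \<Longrightarrow>
      (\<Sum>j<m. \<Sum>\<delta>\<in>box k. evalF (f j \<delta>) (weight \<rho>) * entry (word (w \<delta>) * A j) \<tau> \<rho>) = 0"
    using R[THEN conjunct1] R[THEN conjunct2, THEN conjunct1] R[THEN conjunct2, THEN conjunct2, THEN conjunct1]
      R[THEN conjunct2, THEN conjunct2, THEN conjunct2] by simp_all
  \<comment> \<open>The factor \<open>sepF 0\<close> removes all rows outside the face of \<open>\<alpha>\<close>, on
    which the relation says nothing.\<close>
  define b where "b j = sepF 0 * (\<Sum>\<delta>\<in>box k. f j \<delta> * word (w \<delta>))" for j
  have bG: "b j \<in> invF" if "j < m" for j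
    unfolding b_def
    by (intro invF_mult invF_sum zero_invF SF_invF[OF sepF(1)[OF zero_faces]]) (use f[OF that] w SF_invF in blast)+
  have cfb: "entry (b j * A j) \<tau> \<nu> = separator 0 (weight \<nu>) * (\<Sum>\<delta>\<in>box k. evalF (f j \<delta>) (weight \<nu>) * entry (word (w \<delta>) * A j) \<tau> \<nu>)"
    if "j < m" for j \<tau> \<nu>
  proof -
    have "b j * A j = sepF 0 * (\<Sum>\<delta>\<in>box k. f j \<delta> * (word (w \<delta>) * A j))"
      by (simp add: b_def sum_distrib_right mult.assoc)
    then have "entry (b j * A j) \<tau> \<nu> = separator 0 (weight \<nu>) * (\<Sum>\<delta>\<in>box k. entry (f j \<delta> * (word (w \<delta>) * A j)) \<tau> \<nu>)"
      using entry_SF_mult[OF sepF(1)[OF zero_faces]] by (simp add: sepF(2)[OF zero_faces] entry_sum)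
    also have "(\<Sum>\<delta>\<in>box k. entry (f j \<delta> * (word (w \<delta>) * A j)) \<tau> \<nu>) = (\<Sum>\<delta>\<in>box k. evalF (f j \<delta>) (weight \<nu>) * entry (word (w \<delta>) * A j) \<tau> \<nu>)"
      by (intro sum.cong refl entry_SF_mult f that)
    finally show ?thesis .
  qed
  have sumK: "(\<Sum>j<m. b j * A j) \<in> annF"
    unfolding annF_def
  proof (intro CollectI conjI ballI)
    show "(\<Sum>j<m. b j * A j) \<in> invF" using bG A(1) by (intro invF_sum invF_mult zero_invF) auto
    fix \<nu> \<mu> assume o: "\<nu> \<in> orthant" "\<mu> \<in> orthant"
    have "entry (\<Sum>j<m. b j * A j) (\<nu> - \<mu>) \<nu> =
       separator 0 (weight \<nu>) * (\<Sum>j<m. \<Sum>\<delta>\<in>box k. evalF (f j \<delta>) (weight \<nu>) * entry (word (w \<delta>) * A j) (\<nu> - \<mu>) \<nu>)"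
      unfolding entry_sum sum_distrib_left[of "separator 0 (weight \<nu>)" _ "{..<m}"] by (rule sum.cong) (auto simp: cfb)
    also have "\<dots> = 0"
    proof (cases "face \<nu> = 0")
      case True
      have "- face (\<nu> - \<mu>) \<in> faces" unfolding face_diff True using face_orthant[OF o(2)] by simp
      moreover have "\<nu> \<in> coset 0" "\<nu> - \<mu> \<in> lat" using True o orthant_L diff_mem by (auto simp: coset_def)
      ultimately show ?thesis using rel by simp
    next
      case False
      then show ?thesis using separator_value[OF zero_faces face_orthant[OF o(1)]] by simp
    qed
    finally show "entry (\<Sum>j<m. b j * A j) (\<nu> - \<mu>) \<nu> = 0" .
  qed
  have mem: "to_R (b j * A j) \<in> I j" if "j < m" for j
    using left_ideal_mult[OF left(1)[OF that] A(2)[OF that] to_R_closed[OF bG[OF that]]]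
    by (simp add: to_R_mult bG A(1) that)
  have "finsum RJ (\<lambda>j. to_R (b j * A j)) {..<m} = \<zero>\<^bsub>RJ\<^esub>"
    using to_R_sum[of m "\<lambda>j. b j * A j"] to_R_zero_iff[of "\<Sum>j<m. b j * A j"] sumK bG A(1)
    by (simp add: invF_mult annF_def)
  then have "\<forall>j<m. to_R (b j * A j) = \<zero>\<^bsub>RJ\<^esub>"
    using dir mem unfolding direct_left_ideals_def by (metis (no_types, lifting))
  then have inK: "b j * A j \<in> annF" if "j < m" for j
    using to_R_zero_iff[OF invF_mult[OF bG A(1)], OF that that] that by blast
  obtain j where j: "j < m" "\<exists>\<delta>\<in>box k. \<exists>\<rho>\<in>coset 0. evalF (f j \<delta>) (weight \<rho>) \<noteq> 0" using nz by blast
  obtain \<mu> where \<mu>: "\<mu> \<in> orthant" "entry (A j) (- \<mu>) 0 \<noteq> 0" using A(3)[OF j(1)] by blast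
  obtain \<rho> \<tau> where \<rho>: "\<rho> \<in> coset 0" "\<rho> \<in> orthant" "\<rho> - \<tau> \<in> orthant"
    "(\<Sum>\<delta>\<in>box k. evalF (f j \<delta>) (weight \<rho>) * entry (word (w \<delta>) * A j) \<tau> \<rho>) \<noteq> 0"
    using product_nonzero[OF A(1)[OF j(1)] \<mu> w f[OF j(1)] j(2)] by blast
  have "entry (b j * A j) (\<rho> - (\<rho> - \<tau>)) \<rho> = 0" using inK[OF j(1)] \<rho>(2,3) unfolding annF_def by blast
  then have "entry (b j * A j) \<tau> \<rho> = 0" by simp
  moreover have "separator 0 (weight \<rho>) = 1"
    using separator_value[OF zero_faces face_orthant[OF \<rho>(2)]] \<rho>(1) by (simp add: coset_def)
  ultimately show False using cfb[OF j(1)] \<rho>(4) by simp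
qed

lemma goldie_rank_eq: "goldie_rank RJ = enat (card faces)"
  unfolding goldie_rank_def
proof (rule antisym)
  show "Sup {enat m |m. \<exists>I. direct_left_ideals RJ m I} \<le> enat (card faces)"
    by (rule Sup_least) (use goldie_upper in auto)
  show "enat (card faces) \<le> Sup {enat m |m. \<exists>I. direct_left_ideals RJ m I}"
    by (rule Sup_upper) (use goldie_lower in blast)
qed

end

section \<open>Connected components of the closure of the support\<close>

text \<open>Each part is open too, its complement being a finite union of closed sets.\<close>

lemma connected_components_of_finite_partition:
  assumes C: "finite C" and cover: "(\<Union>c\<in>C. Z c) = topspace Y"
    and closed: "\<And>c. c \<in> C \<Longrightarrow> closedin Y (Z c)" and conn: "\<And>c. c \<in> C \<Longrightarrow> connectedin Y (Z c)"
    and ne: "\<And>c. c \<in> C \<Longrightarrow> Z c \<noteq> {}"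
    and disj: "\<And>c c'. c \<in> C \<Longrightarrow> c' \<in> C \<Longrightarrow> c \<noteq> c' \<Longrightarrow> Z c \<inter> Z c' = {}"
  shows "connected_components_of Y = Z ` C" "inj_on Z C"
proof -
  have comp: "connected_component_of_set Y x = Z c" if c: "c \<in> C" and x: "x \<in> Z c" for c x
  proof
    show "Z c \<subseteq> connected_component_of_set Y x" by (rule connected_component_of_maximal[OF conn[OF c] x])
    have "closedin Y (\<Union>c'\<in>C - {c}. Z c')" using C closed by (intro closedin_Union) auto
    then have "openin Y (topspace Y - (\<Union>c'\<in>C - {c}. Z c'))" by (rule openin_diff[OF openin_topspace])
    moreover have "topspace Y - (\<Union>c'\<in>C - {c}. Z c') = Z c"
      using cover[symmetric] disj[OF c] c by auto
    ultimately have op: "openin Y (Z c)" by simp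
    have op': "openin Y (topspace Y - Z c)" by (rule openin_diff[OF openin_topspace closed[OF c]])
    have "x \<in> connected_component_of_set Y x"
      using x cover c connected_component_of_refl[of Y x] by auto
    then have meet: "Z c \<inter> connected_component_of_set Y x \<noteq> {}" using x by blast
    have "connectedin Y (connected_component_of_set Y x)" by (rule connectedin_connected_component_of)
    then have top: "connected_component_of_set Y x \<subseteq> topspace Y"
      and noSplit: "\<not> (openin Y E1 \<and> openin Y E2 \<and> connected_component_of_set Y x \<subseteq> E1 \<union> E2 \<and>
        E1 \<inter> E2 \<inter> connected_component_of_set Y x = {} \<and> E1 \<inter> connected_component_of_set Y x \<noteq> {} \<and>
        E2 \<inter> connected_component_of_set Y x \<noteq> {})" for E1 E2
      unfolding connectedin by blast+
    show "connected_component_of_set Y x \<subseteq> Z c"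
      using noSplit[of "Z c" "topspace Y - Z c"] op op' meet top by blast
  qed
  show "connected_components_of Y = Z ` C"
  proof (intro equalityI subsetI)
    fix S assume "S \<in> connected_components_of Y"
    then obtain x where x: "x \<in> topspace Y" "S = connected_component_of_set Y x"
      by (auto simp: connected_components_of_def)
    then obtain c where "c \<in> C" "x \<in> Z c" using cover by blast
    then show "S \<in> Z ` C" using comp x(2) by blast
  next
    fix S assume "S \<in> Z ` C"
    then obtain c where c: "c \<in> C" "S = Z c" by blast
    then obtain x where x: "x \<in> Z c" using ne by blast
    have "x \<in> topspace Y" using x c(1) cover by blast
    then show "S \<in> connected_components_of Y"
      unfolding connected_components_of_def c(2) comp[OF c(1) x, symmetric] by blast
  qed
  show "inj_on Z C"
  proof (rule inj_onI, rule ccontr)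
    fix c c' assume "c \<in> C" "c' \<in> C" "Z c = Z c'" "c \<noteq> c'"
    then show False using disj[of c c'] ne[of c] by simp
  qed
qed

context weight_data
begin

definition basic :: "'k free_alg \<Rightarrow> ('k weyl \<Rightarrow> 'k) set"
  where "basic f = {\<gamma> \<in> dual r s (tt r s). evalF f (pt r s \<gamma>) \<noteq> 0}"

lemma zariski_basic: "zariski r s = topology_generated_by (basic ` SF)"
proof -
  have "{\<gamma> \<in> dual r s (tt r s). cls f \<notin> max_ideal r s \<gamma>} = basic f" if "f \<in> SF" for f
    unfolding basic_def using cls_max_ideal_iff[OF _ that] by blast
  then have "(\<lambda>a. {\<gamma> \<in> dual r s (tt r s). a \<notin> max_ideal r s \<gamma>}) ` (cls ` SF) = basic ` SF"
    by (simp add: image_image cong: image_cong)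
  moreover have "{{\<gamma> \<in> dual r s (tt r s). f \<notin> max_ideal r s \<gamma>} |f. f \<in> carrier (sym_ring r s)}
     = (\<lambda>a. {\<gamma> \<in> dual r s (tt r s). a \<notin> max_ideal r s \<gamma>}) ` (cls ` SF)"
    unfolding sym_carrier by blast
  ultimately show ?thesis by (simp add: zariski_def)
qed

lemma basic_one: "basic 1 = dual r s (tt r s)"
  using evalF_const[of "1 :: 'k"] by (simp add: basic_def)

lemma topspace_zariski: "topspace (zariski r s :: ('k weyl \<Rightarrow> 'k) topology) = dual r s (tt r s)"
proof -
  have "basic f \<subseteq> dual r s (tt r s)" for f by (auto simp: basic_def)
  then have "\<Union> (basic ` SF) \<subseteq> dual r s (tt r s)" by (intro UN_least)
  moreover have "dual r s (tt r s) \<subseteq> \<Union> (basic ` SF)"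
    unfolding basic_one[symmetric] using one_SF by (rule UN_upper)
  ultimately show ?thesis unfolding zariski_basic topology_generated_by_topspace by (rule equalityI)
qed

text \<open>The sets \<open>D(f)\<close> are closed under intersection, so they form a base.\<close>

lemma open_basic_nbhd:
  assumes "openin (zariski r s) U" "\<gamma> \<in> U"
  shows "\<exists>f\<in>SF. \<gamma> \<in> basic f \<and> basic f \<subseteq> U"
proof -
  have "generate_topology_on (basic ` SF) U"
    using assms(1) unfolding zariski_basic openin_topology_generated_by_iff .
  then have "\<forall>\<gamma>\<in>U. \<exists>f\<in>SF. \<gamma> \<in> basic f \<and> basic f \<subseteq> U"
  proof induction
    case (Int a b)
    show ?case
    proof
      fix \<gamma> assume "\<gamma> \<in> a \<inter> b"
      then obtain f h where fh: "f \<in> SF" "\<gamma> \<in> basic f" "basic f \<subseteq> a" "h \<in> SF" "\<gamma> \<in> basic h" "basic h \<subseteq> b"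
        using Int.IH by blast
      have "basic (f * h) = basic f \<inter> basic h" using fh(1) by (auto simp: basic_def evalF_mult)
      then show "\<exists>f\<in>SF. \<gamma> \<in> basic f \<and> basic f \<subseteq> a \<inter> b"
        using fh symF.mult by (intro bexI[of _ "f * h"]) auto
    qed
  next
    case (UN \<K>)
    then show ?case by blast
  qed auto
  then show ?thesis using assms(2) by blast
qed

lemma closedin_zeros: "f \<in> SF \<Longrightarrow> closedin (zariski r s) {\<gamma> \<in> dual r s (tt r s). evalF f (pt r s \<gamma>) = 0}"
proof -
  assume f: "f \<in> SF"
  have "openin (zariski r s) (basic f)"
    unfolding zariski_basic by (rule topology_generated_by_Basis) (use f in blast)
  moreover have "dual r s (tt r s) - {\<gamma> \<in> dual r s (tt r s). evalF f (pt r s \<gamma>) = 0} = basic f"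
    by (auto simp: basic_def)
  ultimately show ?thesis by (auto simp: closedin_def topspace_zariski)
qed

definition face_support :: "(nat \<Rightarrow> int) \<Rightarrow> ('k weyl \<Rightarrow> 'k) set"
  where "face_support c = {\<gamma> \<in> dual r s (tt r s). \<exists>\<nu>\<in>orthant. face \<nu> = c \<and> pt r s \<gamma> = weight \<nu>}"

lemma support_faces: "L_support r s g chi \<alpha> = (\<Union>c\<in>faces. face_support c)"
  unfolding L_support_eq face_support_def by (auto intro: face_orthant)

lemma ex_dual_weight: "\<nu> \<in> orthant \<Longrightarrow> \<exists>\<gamma>\<in>dual r s (tt r s). pt r s \<gamma> = weight \<nu>"
  using ex_dual_pt[of r s "weight \<nu>"] supp[OF orthant_L] by (simp add: weight_def a0_outside)

text \<open>Any two nonempty relatively open subsets meet, by irreducibility of the coset.\<close>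

lemma connected_face_support:
  assumes c: "c \<in> faces"
  shows "connectedin (zariski r s) (face_support c)"
  unfolding connectedin
proof (intro conjI notI)
  show "face_support c \<subseteq> topspace (zariski r s)" by (auto simp: face_support_def topspace_zariski)
  assume "\<exists>E1 E2. openin (zariski r s) E1 \<and> openin (zariski r s) E2 \<and> face_support c \<subseteq> E1 \<union> E2 \<and>
    E1 \<inter> E2 \<inter> face_support c = {} \<and> E1 \<inter> face_support c \<noteq> {} \<and> E2 \<inter> face_support c \<noteq> {}"
  then obtain E1 E2 where E: "openin (zariski r s) E1" "openin (zariski r s) E2"
    "E1 \<inter> E2 \<inter> face_support c = {}" "E1 \<inter> face_support c \<noteq> {}" "E2 \<inter> face_support c \<noteq> {}"
    by (elim exE conjE) (rule that)
  obtain \<gamma>1 \<gamma>2 where \<gamma>: "\<gamma>1 \<in> E1" "\<gamma>1 \<in> face_support c" "\<gamma>2 \<in> E2" "\<gamma>2 \<in> face_support c" using E(4,5) by blast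
  obtain f where f: "f \<in> SF" "\<gamma>1 \<in> basic f" "basic f \<subseteq> E1" using open_basic_nbhd[OF E(1) \<gamma>(1)] by blast
  obtain h where h: "h \<in> SF" "\<gamma>2 \<in> basic h" "basic h \<subseteq> E2" using open_basic_nbhd[OF E(2) \<gamma>(3)] by blast
  obtain \<nu> where \<nu>: "\<nu> \<in> orthant" "face \<nu> = c" "pt r s \<gamma>1 = weight \<nu>" using \<gamma>(2) by (auto simp: face_support_def)
  obtain \<mu> where \<mu>: "\<mu> \<in> orthant" "face \<mu> = c" "pt r s \<gamma>2 = weight \<mu>" using \<gamma>(4) by (auto simp: face_support_def)
  have nz: "evalF f (a0 + ivec \<nu>) \<noteq> 0" "evalF h (a0 + ivec \<mu>) \<noteq> 0"
    using f(2) h(2) \<nu>(3) \<mu>(3) by (auto simp: basic_def weight_def)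
  have co: "\<nu> \<in> coset c" "\<mu> \<in> coset c" using \<nu> \<mu> orthant_L by (auto simp: coset_def)
  have pf: "evalF f \<in> polyfuns n" "evalF h \<in> polyfuns n" using f(1) h(1) by (auto intro: evalF_polyfun)
  obtain \<rho> where \<rho>: "\<rho> \<in> coset c" "evalF f (a0 + ivec \<rho>) * evalF h (a0 + ivec \<rho>) \<noteq> 0"
    using coset_irreducible[OF pf co nz] by blast
  have "\<exists>\<rho>\<in>coset c. evalF f (a0 + ivec \<rho>) * evalF h (a0 + ivec \<rho>) \<noteq> 0 \<and> (\<forall>\<tau>\<in>{0}. \<rho> + \<tau> \<in> orthant)"
    by (rule deep_point[OF polyfuns.mult[OF pf] \<rho>]) (auto simp: zero_mem face_zero c)
  then obtain \<rho>' where \<rho>': "\<rho>' \<in> coset c" "evalF f (weight \<rho>') \<noteq> 0" "evalF h (weight \<rho>') \<noteq> 0" "\<rho>' \<in> orthant"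
    unfolding weight_def by auto
  obtain \<gamma> where \<gamma>': "\<gamma> \<in> dual r s (tt r s)" "pt r s \<gamma> = weight \<rho>'" using ex_dual_weight[OF \<rho>'(4)] by blast
  have "\<gamma> \<in> basic f" "\<gamma> \<in> basic h" "\<gamma> \<in> face_support c"
    using \<gamma>' \<rho>' by (auto simp: basic_def face_support_def coset_def)
  then show False using E(3) f(3) h(3) by blast
qed

abbreviation face_closure :: "(nat \<Rightarrow> int) \<Rightarrow> ('k weyl \<Rightarrow> 'k) set"
  where "face_closure c \<equiv> zariski r s closure_of face_support c"

lemma face_closures_disjoint:
  assumes c: "c \<in> faces" "c' \<in> faces" "c \<noteq> c'"
  shows "face_closure c \<inter> face_closure c' = {}"
proof -
  let ?f = "sepF c"
  have f: "?f \<in> SF" "1 - ?f \<in> SF" using sepF(1)[OF c(1)] one_SF by (auto intro: symF_diff)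
  have one: "evalF 1 = (\<lambda>_. 1 :: 'k)" using evalF_const[of "1 :: 'k"] by simp
  have sep_value: "\<gamma> \<in> dual r s (tt r s)" "separator c (pt r s \<gamma>) = (if d = c then 1 else 0)"
    if \<gamma>: "\<gamma> \<in> face_support d" for \<gamma> d
  proof -
    obtain \<nu> where "\<nu> \<in> orthant" "face \<nu> = d" "pt r s \<gamma> = weight \<nu>"
      using \<gamma> unfolding face_support_def by blast
    then show "separator c (pt r s \<gamma>) = (if d = c then 1 else 0)"
      using separator_value[OF c(1) face_orthant, of \<nu>] by simp
    show "\<gamma> \<in> dual r s (tt r s)" using \<gamma> by (simp add: face_support_def)
  qed
  have s1: "face_closure c \<subseteq> {\<gamma> \<in> dual r s (tt r s). evalF (1 - ?f) (pt r s \<gamma>) = 0}"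
    by (rule closure_of_minimal[OF _ closedin_zeros[OF f(2)]])
      (auto simp: evalF_diff one sepF(2)[OF c(1)] sep_value)
  have s2: "face_closure c' \<subseteq> {\<gamma> \<in> dual r s (tt r s). evalF ?f (pt r s \<gamma>) = 0}"
    by (rule closure_of_minimal[OF _ closedin_zeros[OF f(1)]])
      (use c(3) in \<open>auto simp: sepF(2)[OF c(1)] sep_value\<close>)
  show ?thesis
  proof (rule equals0I)
    fix x assume "x \<in> face_closure c \<inter> face_closure c'"
    then have "evalF (1 - ?f) (pt r s x) = 0" "evalF ?f (pt r s x) = 0"
      using subsetD[OF s1] subsetD[OF s2] by blast+
    then show False by (simp add: evalF_diff one)
  qed
qed

lemma components_eq:
  "L_components r s g chi \<alpha> = face_closure ` faces" "inj_on face_closure faces"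
proof -
  let ?X = "zariski r s closure_of L_support r s g chi \<alpha>"
  let ?Y = "subtopology (zariski r s) ?X"
  have X: "?X = (\<Union>c\<in>faces. face_closure c)"
    using closure_of_Union[of "face_support ` faces" "zariski r s"] finite_faces
    by (simp add: support_faces)
  have sub: "face_closure c \<subseteq> ?X" if "c \<in> faces" for c using that X by blast
  have cover: "(\<Union>c\<in>faces. face_closure c) = topspace ?Y"
    unfolding X[symmetric] by (rule topspace_subtopology_subset[OF closure_of_subset_topspace, symmetric])
  have closed: "closedin ?Y (face_closure c)" if "c \<in> faces" for c
    by (rule closedin_subset_topspace[OF closedin_closure_of sub[OF that]])
  have conn: "connectedin ?Y (face_closure c)" if "c \<in> faces" for c
    unfolding connectedin_subtopology
    using connectedin_closure_of[OF connected_face_support[OF that]] sub[OF that] by blast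
  have nonempty: "face_closure c \<noteq> {}" if c: "c \<in> faces" for c
  proof -
    obtain \<nu> where "\<nu> \<in> orthant" "face \<nu> = c" using c by (auto simp: faces_def)
    moreover from this obtain \<gamma> where "\<gamma> \<in> dual r s (tt r s)" "pt r s \<gamma> = weight \<nu>" using ex_dual_weight by blast
    ultimately have "\<gamma> \<in> face_support c" by (auto simp: face_support_def)
    moreover have "face_support c \<subseteq> face_closure c"
      by (rule closure_of_subset) (auto simp: face_support_def topspace_zariski)
    ultimately show ?thesis by blast
  qed
  show "L_components r s g chi \<alpha> = face_closure ` faces"
    unfolding L_components_def
    by (rule connected_components_of_finite_partition(1)
        [OF finite_faces cover closed conn nonempty face_closures_disjoint])
  show "inj_on face_closure faces"
    by (rule connected_components_of_finite_partition(2)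
        [OF finite_faces cover closed conn nonempty face_closures_disjoint])
qed

end

theorem theorem20:
  fixes r s :: nat
    and g :: "'k::{alg_closed_field, field_char_0} weyl set"
    and chi \<alpha> :: "'k weyl \<Rightarrow> 'k"
  assumes "subspace_of_tt r s g"
    and "chi \<in> dual r s g"
    and "\<alpha> \<in> V_shift r s g chi"
  shows "finite (L_components r s g chi \<alpha>) \<and>
    goldie_rank (B_ring r s g chi Quot J_ideal r s g chi \<alpha>) = enat (card (L_components r s g chi \<alpha>))"
proof -
  interpret weight_data r s g chi \<alpha> by standard (rule assms(1) assms(3))+
  show ?thesis
    using finite_faces by (simp add: goldie_rank_eq components_eq(1) card_image[OF components_eq(2)])
qed

end
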